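(* Let $1\le p<\infty$, let $u\in h^p(\mathbb{R}^n_+)$, and let $x=(x',x_n)$ be an arbitrary point in $\mathbb{R}^n_+$. The sharp coefficient $\mathcal{C}_p(x)$ in the inequality $$|\nabla u(x)|\le \mathcal{C}_p(x)\,\|u\|_p$$ is given by $$\mathcal{C}_p(x)=C_p\,x_n^{(1-n-p)/p},$$ where $$C_1=\frac{2(n-1)}{\omega_n},$$ and $$C_p=\frac{2(\omega_{n-2})^{(p-1)/p}}{\omega_n}\ \sup_{\gamma\ge 0}\ \frac{1}{\sqrt{1+\gamma^2}}\left\{\int_0^{\pi}d\varphi\int_0^{\pi/2}\mathcal{F}_{n,p}(\varphi,\vartheta;\gamma)\,d\vartheta\right\}^{(p-1)/p}$$ if $1<p<\infty$. Here $$\mathcal{F}_{n,p}(\varphi,\vartheta;\gamma)=\big|(n\cos^2\vartheta-1)+n\gamma\cos\vartheta\sin\vartheta\cos\varphi\big|^{p/(p-1)}\cos^{n/(p-1)}\vartheta\,\sin^{n-2}\vartheta\,\sin^{n-3}\varphi.$$ In particular, $$C_2=\sqrt{\frac{n(n-1)}{2^n\omega_n}}.$$ For $p=1$ and $p=2$ the coefficient $\mathcal{C}_p(x)$ is optimal also in the weaker inequality obtained from $|\nabla u(x)|\le \mathcal{C}_p(x)\|u\|_p$ by replacing $\nabla u$ by $\partial u/\partial x_n$.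
   Context: $\mathbb{R}^n_+=\{x=(x',x_n): x'=(x_1,\dots,x_{n-1})\in\mathbb{R}^{n-1},\ x_n>0\}$. $\omega_n$ denotes the area of the unit sphere in $\mathbb{R}^n$ (and $\omega_{n-2}$ is the same quantity with $n-2$ in place of $n$). $h^p(\mathbb{R}^n_+)$ is the Hardy space of harmonic functions on $\mathbb{R}^n_+$ which can be represented as the Poisson integral $$u(x)=\frac{2}{\omega_n}\int_{\mathbb{R}^{n-1}}\frac{x_n}{|y-x|^n}\,u(y')\,dy',\qquad y=(y',0),\ y'\in\mathbb{R}^{n-1},$$ with boundary values $u(y')$ in $L^p(\mathbb{R}^{n-1})$; $\|u\|_p$ denotes the $L^p(\mathbb{R}^{n-1})$ norm of the boundary values. The "sharp" (or "optimal") coefficient is the smallest one, depending on $x$, for which the inequality holds for all $u\in h^p(\mathbb{R}^n_+)$. *)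

theory Defs
  imports "HOL-Analysis.Analysis"
begin

text \<open>
  The area of the unit sphere in \<open>n\<close>-dimensional space. The library has no surface measure; the
  value is \<open>n\<close> times the volume of the unit ball. The two lemmas following the definition record
  the classical closed form and that this is the rate of growth of the volume of a ball at radius 1.
\<close>

definition sphere_area :: "nat \<Rightarrow> real" where
  "sphere_area n = real n * unit_ball_vol (real n)"

lemma sphere_area_eq_Gamma:
  assumes "n > 0"
  shows "sphere_area n = 2 * pi powr (real n / 2) / Gamma (real n / 2)"
proof -
  have "Gamma (real n / 2 + 1) = real n / 2 * Gamma (real n / 2)"
    using assms by (intro Gamma_plus1) (auto elim!: nonpos_Ints_cases)
  then show ?thesis
    using assms unfolding sphere_area_def unit_ball_vol_def
    by (simp del: times_divide_eq_left) (simp add: field_simps)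
qed

lemma sphere_area_growth_of_ball:
  "((\<lambda>r. measure lborel (ball (0 :: 'a :: euclidean_space) r))
     has_real_derivative sphere_area DIM('a)) (at 1)"
proof (rule has_field_derivative_transform_within_open)
  show "((\<lambda>r. unit_ball_vol (real DIM('a)) * r ^ DIM('a))
     has_real_derivative sphere_area DIM('a)) (at 1)"
    by (auto intro!: derivative_eq_intros simp: sphere_area_def)
  show "open {0::real<..}" "(1::real) \<in> {0<..}" by auto
  show "unit_ball_vol (real DIM('a)) * r ^ DIM('a) = measure lborel (ball (0 :: 'a) r)"
    if "r \<in> {0<..}" for r
    using that by (simp add: content_ball)
qed

text \<open>
  Euclidean space of dimension \<open>n = CARD('m) + 1\<close> is the product of \<open>real ^ 'm\<close> (the variables
  \<open>x'\<close>) with \<open>real\<close> (the variable \<open>x\<^sub>n\<close>); the product type carries the Euclidean norm.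
\<close>

definition half_space :: "((real ^ 'm::finite) \<times> real) set" where
  "half_space = {x. snd x > 0}"

definition grad :: "('a::euclidean_space \<Rightarrow> real) \<Rightarrow> 'a \<Rightarrow> 'a" where
  "grad u x = (THE D. GDERIV u x :> D)"

lemma grad_eq:
  assumes "GDERIV u x :> D"
  shows "grad u x = D"
  unfolding grad_def
proof (rule the_equality[where P = "\<lambda>D. GDERIV u x :> D", OF assms])
  fix D' assume "GDERIV u x :> D'"
  then have "(\<lambda>h. h \<bullet> D') = (\<lambda>h. h \<bullet> D)"
    using assms has_derivative_unique unfolding gderiv_def by blast
  then show "D' = D"
    by (metis inner_commute vector_eq_ldot)
qed

text \<open>Here \<open>g\<close> is the gradient of \<open>u\<close> and \<open>H x\<close> is its (continuous) Hessian at \<open>x\<close>.\<close>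

definition harmonic_on :: "('a::euclidean_space \<Rightarrow> real) \<Rightarrow> 'a set \<Rightarrow> bool" where
  "harmonic_on u S \<longleftrightarrow>
     (\<exists>g H. (\<forall>x\<in>S. GDERIV u x :> g x) \<and>
            (\<forall>x\<in>S. (g has_derivative H x) (at x)) \<and>
            (\<forall>b\<in>Basis. continuous_on S (\<lambda>x. H x b)) \<and>
            (\<forall>x\<in>S. (\<Sum>b\<in>Basis. H x b \<bullet> b) = 0))"

definition Lp_space :: "real \<Rightarrow> ('a::euclidean_space \<Rightarrow> real) set" where
  "Lp_space p = {f. f \<in> borel_measurable lebesgue \<and> integrable lebesgue (\<lambda>y. \<bar>f y\<bar> powr p)}"

definition Lp_norm :: "real \<Rightarrow> ('a::euclidean_space \<Rightarrow> real) \<Rightarrow> real" where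
  "Lp_norm p f = (LINT y|lebesgue. \<bar>f y\<bar> powr p) powr (1 / p)"

definition poisson_integral :: "(real ^ 'm::finite \<Rightarrow> real) \<Rightarrow> (real ^ 'm) \<times> real \<Rightarrow> real" where
  "poisson_integral f x =
     2 / sphere_area (CARD('m) + 1) *
     (LINT y|lebesgue. snd x / norm ((y, 0) - x) ^ (CARD('m) + 1) * f y)"

text \<open>
  \<open>f\<close> is a function of boundary values of \<open>u\<close>. It is determined by \<open>u\<close> only almost everywhere,
  so it is kept as an explicit argument; \<open>\<parallel>u\<parallel>\<^sub>p\<close> is \<open>Lp_norm p f\<close>.
\<close>

definition boundary_values ::
  "real \<Rightarrow> ((real ^ 'm::finite) \<times> real \<Rightarrow> real) \<Rightarrow> (real ^ 'm \<Rightarrow> real) \<Rightarrow> bool" where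
  "boundary_values p u f \<longleftrightarrow> f \<in> Lp_space p \<and> (\<forall>x\<in>half_space. u x = poisson_integral f x)"

definition hardy_space :: "real \<Rightarrow> ((real ^ 'm::finite) \<times> real \<Rightarrow> real) set" where
  "hardy_space p = {u. harmonic_on u half_space \<and> (\<exists>f. boundary_values p u f)}"

text \<open>
  The inequality \<open>T u \<le> C \<parallel>u\<parallel>\<^sub>p\<close> for all \<open>u\<close> in the Hardy space, and \<open>C\<close> being the smallest
  constant in it. In the intended uses \<open>T u\<close> is \<open>\<bar>\<nabla>u(x)\<bar>\<close> or \<open>\<bar>\<partial>u/\<partial>x\<^sub>n(x)\<bar>\<close> at a fixed point \<open>x\<close>.
\<close>

definition hardy_bound ::
  "real \<Rightarrow> (((real ^ 'm::finite) \<times> real \<Rightarrow> real) \<Rightarrow> real) \<Rightarrow> real \<Rightarrow> bool" where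
  "hardy_bound p T C \<longleftrightarrow>
     (\<forall>u\<in>hardy_space p. \<forall>f. boundary_values p u f \<longrightarrow> T u \<le> C * Lp_norm p f)"

definition sharp_coefficient ::
  "real \<Rightarrow> (((real ^ 'm::finite) \<times> real \<Rightarrow> real) \<Rightarrow> real) \<Rightarrow> real \<Rightarrow> bool" where
  "sharp_coefficient p T C \<longleftrightarrow> hardy_bound p T C \<and> (\<forall>C'. hardy_bound p T C' \<longrightarrow> C \<le> C')"

definition normal_deriv :: "((real ^ 'm::finite) \<times> real \<Rightarrow> real) \<Rightarrow> (real ^ 'm) \<times> real \<Rightarrow> real" where
  "normal_deriv u x = deriv (\<lambda>t. u (fst x, t)) (snd x)"

definition F_integrand :: "nat \<Rightarrow> real \<Rightarrow> real \<Rightarrow> real \<Rightarrow> real \<Rightarrow> real" where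
  "F_integrand n p \<phi> \<theta> \<gamma> =
     \<bar>(real n * cos \<theta> ^ 2 - 1) + real n * \<gamma> * cos \<theta> * sin \<theta> * cos \<phi>\<bar> powr (p / (p - 1)) *
     cos \<theta> powr (real n / (p - 1)) * sin \<theta> ^ (n - 2) * sin \<phi> ^ (n - 3)"

definition grad_const :: "nat \<Rightarrow> real \<Rightarrow> real" where
  "grad_const n p =
     (if p = 1 then 2 * (real n - 1) / sphere_area n
      else 2 * sphere_area (n - 2) powr ((p - 1) / p) / sphere_area n *
           (SUP \<gamma>\<in>{0..}. 1 / sqrt (1 + \<gamma> ^ 2) *
              (integral {0..pi} (\<lambda>\<phi>. integral {0..pi / 2} (\<lambda>\<theta>. F_integrand n p \<phi> \<theta> \<gamma>)))
                powr ((p - 1) / p)))"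

end

theory Submission
  imports Defs
begin

text \<open>
  The derivative of the Poisson integral of \<open>f\<close> at \<open>x\<close> in a direction \<open>z\<close> is
  \<open>2 / \<omega>\<^sub>n\<close> times the integral of \<open>f\<close> against a kernel \<open>k\<^sub>z\<close>, so by duality the best constant for
  this derivative is \<open>2 / \<omega>\<^sub>n\<close> times the \<open>L\<^sup>q\<close> norm of \<open>k\<^sub>z\<close>, where \<open>1/p + 1/q = 1\<close>, and the best constant for the
  gradient is the supremum over all unit vectors \<open>z\<close>. Horizontal \<open>z\<close> may be left out by density, and the
  others are up to sign \<open>(\<gamma> e, -1) / sqrt (1 + \<gamma>\<^sup>2)\<close> with a unit vector \<open>e\<close> and \<open>\<gamma> \<ge> 0\<close>. In polar coordinates about
  the axis \<open>e\<close> with radius \<open>x\<^sub>n tan \<theta>\<close> the norm becomes the double integral of the statement. For \<open>p = 1\<close>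
  the norm of the kernel of the gradient is largest at \<open>(x', 0)\<close>, where it points in the normal direction.
  For \<open>p = 2\<close> the double integral is a quadratic polynomial in \<open>\<gamma>\<close> with explicit Beta integrals as
  coefficients, and the supremum is attained at \<open>\<gamma> = 0\<close>.
\<close>

subsection \<open>Polar coordinates\<close>

text \<open>Volumes are computed with nonnegative integrals, so that Tonelli and substitution apply
  before any integrability is known; finiteness of the final trigonometric integral then makes the
  kernel integrable. The radius is chosen because |y - x| = x_n / cos \<theta>: all distances become
  powers of the cosine, and x_n leaves the integral as x_n^(n-1-nq), whose (1/q)-th power is the
  factor x_n^((1-n-p)/p) of the statement. The exponent n/(p-1) of the cosine is nq - n, the
  subtracted n coming from the volume element. The supremum is taken in the reals, so its
  boundedness has to be proved before it can serve as an upper bound; it follows from a kernel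
  estimate uniform in the direction. Lower bounds are proved for any functional \<open>T\<close>
  that dominates one directional derivative, which treats the gradient and the normal derivative
  together; the latter is the direction \<gamma> = 0. The condition n >= 3 means that at least one
  dimension remains orthogonal to e; for n = 3 it is a line, and \<open>sphere_area 1\<close> = 2
  counts its two sides.\<close>

text \<open>Substitution on compact intervals is extended by exhaustion: \<open>tan\<close> maps
  \<open>{-a k..a k}\<close> onto \<open>{-real (Suc k)..real (Suc k)}\<close>, and both sides
  converge monotonically.\<close>

lemma nn_integral_tan:
  fixes f :: "real \<Rightarrow> ennreal"
  assumes [measurable]: "f \<in> borel_measurable borel"
  shows "(\<integral>\<^sup>+s. f s \<partial>lborel) =
    (\<integral>\<^sup>+\<psi>. indicator {-(pi/2)<..<pi/2} \<psi> * (f (tan \<psi>) * ennreal (1 / cos \<psi> ^ 2)) \<partial>lborel)"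
proof -
  \<comment> \<open>With \<open>Suc k\<close> in place of \<open>k\<close> no interval of the
    exhaustion degenerates to a point; the substitution rule asks for
    \<open>- a k < a k\<close>.\<close>
  define a where "a k = arctan (real (Suc k))" for k
  have a_less: "a k < pi/2" and a_gt: "- (pi/2) < a k" "- (pi/2) < - a k" for k
    using arctan_bounded[of "real (Suc k)"] by (auto simp: a_def)
  have a_pos: "0 < a k" for k by (simp add: a_def)
  have cos_pos: "cos t > 0" if "t \<in> {-a k..a k}" for t k
    using that a_less[of k] a_gt[of k] by (intro cos_gt_zero_pi) auto
  have tan_a: "tan (a k) = real (Suc k)" for k by (simp add: a_def tan_arctan)
  have *: "(\<integral>\<^sup>+s. f s * indicator {-real (Suc k)..real (Suc k)} s \<partial>lborel) =
     (\<integral>\<^sup>+\<psi>. indicator {-a k..a k} \<psi> * (f (tan \<psi>) * ennreal (1 / cos \<psi> ^ 2)) \<partial>lborel)" for k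
  proof -
    have "(\<integral>\<^sup>+s. f s * indicator {tan (- a k)..tan (a k)} s \<partial>lborel) =
       (\<integral>\<^sup>+\<psi>. f (tan \<psi>) * ennreal (1 / cos \<psi> ^ 2) * indicator {-a k..a k} \<psi> \<partial>lborel)"
    proof (rule nn_integral_substitution_aux)
      show "(tan has_real_derivative 1 / (cos x)\<^sup>2) (at x)" if "x \<in> {- a k..a k}" for x
        using cos_pos[OF that] by (auto intro!: derivative_eq_intros simp: field_simps)
      show "continuous_on {- a k..a k} (\<lambda>x. 1 / (cos x)\<^sup>2)"
        using cos_pos by (auto intro!: continuous_intros) force
      show "- a k < a k" using a_pos[of k] by simp
    qed auto
    then show ?thesis by (simp add: tan_a mult_ac)
  qed
  have inc1: "incseq (\<lambda>k s. f s * indicator {-real (Suc k)..real (Suc k)} s)"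
    by (auto simp: incseq_def le_fun_def split: split_indicator)
  have a_mono: "a j \<le> a k" if "j \<le> k" for j k
    using that by (simp add: a_def arctan_le_iff)
  have inc2: "incseq (\<lambda>k \<psi>. indicator {-a k..a k} \<psi> * (f (tan \<psi>) * ennreal (1 / cos \<psi> ^ 2)))"
  proof (intro incseq_SucI le_funI)
    fix k \<psi> show "indicator {-a k..a k} \<psi> * (f (tan \<psi>) * ennreal (1 / cos \<psi> ^ 2))
      \<le> indicator {-a (Suc k)..a (Suc k)} \<psi> * (f (tan \<psi>) * ennreal (1 / cos \<psi> ^ 2))"
      using a_mono[of k "Suc k"] by (auto split: split_indicator)
  qed
  have sup1: "(SUP k. f s * indicator {-real (Suc k)..real (Suc k)} s) = f s" for s
  proof (rule antisym)
    obtain k :: nat where "\<bar>s\<bar> \<le> real k" using real_arch_simple by blast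
    then show "f s \<le> (SUP k. f s * indicator {-real (Suc k)..real (Suc k)} s)"
      by (intro SUP_upper2[of k]) (auto simp: indicator_def)
  qed (auto intro!: SUP_least split: split_indicator)
  have sup2: "(SUP k. indicator {-a k..a k} \<psi> * (f (tan \<psi>) * ennreal (1 / cos \<psi> ^ 2)))
     = indicator {-(pi/2)<..<pi/2} \<psi> * (f (tan \<psi>) * ennreal (1 / cos \<psi> ^ 2))" for \<psi>
  proof (rule antisym)
    show "indicator {-(pi/2)<..<pi/2} \<psi> * (f (tan \<psi>) * ennreal (1 / cos \<psi> ^ 2)) \<le>
      (SUP k. indicator {-a k..a k} \<psi> * (f (tan \<psi>) * ennreal (1 / cos \<psi> ^ 2)))"
    proof (cases "\<psi> \<in> {-(pi/2)<..<pi/2}")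
      case True
      obtain k :: nat where k: "\<bar>tan \<psi>\<bar> \<le> real k" using real_arch_simple by blast
      have "\<psi> = arctan (tan \<psi>)" using True by (simp add: arctan_tan)
      moreover have "arctan (tan \<psi>) \<le> a k" "- a k \<le> arctan (tan \<psi>)"
        unfolding a_def arctan_minus[symmetric] using k by (auto simp: arctan_le_iff)
      ultimately have "\<psi> \<in> {-a k..a k}" by simp
      then show ?thesis using True by (intro SUP_upper2[of k]) auto
    qed auto
  next
    show "(SUP k. indicator {-a k..a k} \<psi> * (f (tan \<psi>) * ennreal (1 / cos \<psi> ^ 2)))
      \<le> indicator {-(pi/2)<..<pi/2} \<psi> * (f (tan \<psi>) * ennreal (1 / cos \<psi> ^ 2))"
    proof (rule SUP_least)
      fix k
      have "\<psi> \<in> {-a k..a k} \<Longrightarrow> \<psi> \<in> {-(pi/2)<..<pi/2}"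
        using a_less[of k] a_gt[of k] by auto
      then show "indicator {-a k..a k} \<psi> * (f (tan \<psi>) * ennreal (1 / cos \<psi> ^ 2))
        \<le> indicator {-(pi/2)<..<pi/2} \<psi> * (f (tan \<psi>) * ennreal (1 / cos \<psi> ^ 2))"
        by (auto split: split_indicator)
    qed
  qed
  have "(\<integral>\<^sup>+s. f s \<partial>lborel) = (\<integral>\<^sup>+s. (SUP k. f s * indicator {-real (Suc k)..real (Suc k)} s) \<partial>lborel)"
    by (simp only: sup1)
  also have "\<dots> = (SUP k. \<integral>\<^sup>+s. f s * indicator {-real (Suc k)..real (Suc k)} s \<partial>lborel)"
    by (rule nn_integral_monotone_convergence_SUP[OF inc1]) auto
  also have "\<dots> = (SUP k. \<integral>\<^sup>+\<psi>. indicator {-a k..a k} \<psi> * (f (tan \<psi>) * ennreal (1 / cos \<psi> ^ 2)) \<partial>lborel)"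
    by (simp only: *)
  also have "\<dots> = (\<integral>\<^sup>+\<psi>. (SUP k. indicator {-a k..a k} \<psi> * (f (tan \<psi>) * ennreal (1 / cos \<psi> ^ 2))) \<partial>lborel)"
    by (rule nn_integral_monotone_convergence_SUP[symmetric, OF inc2]) (auto simp: tan_def)
  finally show ?thesis by (simp only: sup2)
qed

text \<open>Polar coordinates are assembled from one-dimensional substitutions: s = t tan \<psi> for
  fixed t, then after Tonelli t = r cos \<psi> for fixed \<psi>, and finally r = c tan \<theta>. The
  weight in the result is r dr/d\<theta>.\<close>

lemma nn_integral_half_plane_polar:
  fixes H :: "real \<times> real \<Rightarrow> ennreal"
  assumes [measurable]: "H \<in> borel_measurable borel" and c: "c > 0"
  shows "(\<integral>\<^sup>+s. \<integral>\<^sup>+t. indicator {0<..} t * H (s, t) \<partial>lborel \<partial>lborel) =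
    (\<integral>\<^sup>+\<phi>. indicator {0<..<pi} \<phi> * (\<integral>\<^sup>+\<theta>. indicator {0<..<pi/2} \<theta> *
       (ennreal (c\<^sup>2 * tan \<theta> / (cos \<theta>)\<^sup>2) * H (c * tan \<theta> * cos \<phi>, c * tan \<theta> * sin \<phi>)) \<partial>lborel) \<partial>lborel)"
proof -
  have [measurable]: "H \<in> borel_measurable (borel \<Otimes>\<^sub>M borel)"
    using assms(1) by (simp add: borel_prod)
  have [measurable]: "(tan :: real \<Rightarrow> real) \<in> borel_measurable borel"
    unfolding tan_def by measurable
  let ?I = "{-(pi/2)<..<pi/2}"
  have "(\<integral>\<^sup>+s. \<integral>\<^sup>+t. indicator {0<..} t * H (s, t) \<partial>lborel \<partial>lborel) =
    (\<integral>\<^sup>+t. \<integral>\<^sup>+s. indicator {0<..} t * H (s, t) \<partial>lborel \<partial>lborel)"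
    by (rule lborel_pair.Fubini'[symmetric, of "\<lambda>s t. indicator {0<..} t * H (s, t)", simplified])
       measurable
  also have "\<dots> = (\<integral>\<^sup>+t. \<integral>\<^sup>+\<psi>. indicator {0<..} t * (ennreal t * (indicator ?I \<psi> * 
       (ennreal (1 / cos \<psi> ^ 2) * H (t * tan \<psi>, t)))) \<partial>lborel \<partial>lborel)"
  proof (rule nn_integral_cong)
    fix t :: real
    show "(\<integral>\<^sup>+s. indicator {0<..} t * H (s, t) \<partial>lborel) = (\<integral>\<^sup>+\<psi>. indicator {0<..} t * (ennreal t * (indicator ?I \<psi> * 
       (ennreal (1 / cos \<psi> ^ 2) * H (t * tan \<psi>, t)))) \<partial>lborel)"
    proof (cases "t > 0")
      case True
      have "(\<integral>\<^sup>+s. H (s, t) \<partial>lborel) = ennreal t * (\<integral>\<^sup>+s. H (t * s, t) \<partial>lborel)"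
        using True by (subst nn_integral_real_affine[of _ t 0]) auto
      also have "(\<integral>\<^sup>+s. H (t * s, t) \<partial>lborel) = (\<integral>\<^sup>+\<psi>. indicator ?I \<psi> * 
         (H (t * tan \<psi>, t) * ennreal (1 / cos \<psi> ^ 2)) \<partial>lborel)"
        by (rule nn_integral_tan) measurable
      finally show ?thesis using True by (simp add: nn_integral_cmult mult_ac)
    qed auto
  qed
  also have "\<dots> = (\<integral>\<^sup>+\<psi>. \<integral>\<^sup>+t. indicator {0<..} t * (ennreal t * (indicator ?I \<psi> * 
       (ennreal (1 / cos \<psi> ^ 2) * H (t * tan \<psi>, t)))) \<partial>lborel \<partial>lborel)"
    by (rule lborel_pair.Fubini'[of "\<lambda>\<psi> t. indicator {0<..} t * (ennreal t * (indicator ?I \<psi> * 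
       (ennreal (1 / cos \<psi> ^ 2) * H (t * tan \<psi>, t))))", simplified])
       measurable
  also have "\<dots> = (\<integral>\<^sup>+\<psi>. indicator ?I \<psi> * (\<integral>\<^sup>+r. indicator {0<..} r * 
       (ennreal r * H (r * sin \<psi>, r * cos \<psi>)) \<partial>lborel) \<partial>lborel)"
  proof (rule nn_integral_cong)
    fix \<psi> :: real
    show "(\<integral>\<^sup>+t. indicator {0<..} t * (ennreal t * (indicator ?I \<psi> * 
       (ennreal (1 / cos \<psi> ^ 2) * H (t * tan \<psi>, t)))) \<partial>lborel) = indicator ?I \<psi> * (\<integral>\<^sup>+r. indicator {0<..} r * 
       (ennreal r * H (r * sin \<psi>, r * cos \<psi>)) \<partial>lborel)"
    proof (cases "\<psi> \<in> ?I")
      case True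
      then have cp: "cos \<psi> > 0" by (auto intro: cos_gt_zero_pi)
      have "(\<integral>\<^sup>+t. indicator {0<..} t * (ennreal t * (ennreal (1 / cos \<psi> ^ 2) * H (t * tan \<psi>, t))) \<partial>lborel)
         = ennreal (cos \<psi>) * (\<integral>\<^sup>+r. indicator {0<..} (cos \<psi> * r) * (ennreal (cos \<psi> * r) * (ennreal (1 / cos \<psi> ^ 2) * H (cos \<psi> * r * tan \<psi>, cos \<psi> * r))) \<partial>lborel)"
        using cp by (subst nn_integral_real_affine[of _ "cos \<psi>" 0]) auto
      also have "\<dots> = (\<integral>\<^sup>+r. ennreal (cos \<psi>) * (indicator {0<..} (cos \<psi> * r) * (ennreal (cos \<psi> * r) * (ennreal (1 / cos \<psi> ^ 2) * H (cos \<psi> * r * tan \<psi>, cos \<psi> * r)))) \<partial>lborel)"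
        by (rule nn_integral_cmult[symmetric]) measurable
      also have "\<dots> = (\<integral>\<^sup>+r. indicator {0<..} r * (ennreal r * H (r * sin \<psi>, r * cos \<psi>)) \<partial>lborel)"
      proof (rule nn_integral_cong)
        fix r :: real
        have e1: "cos \<psi> * r = r * cos \<psi>" by simp
        have e2: "r * cos \<psi> * tan \<psi> = r * sin \<psi>" using cp by (simp add: tan_def)
        have e3: "indicator {0<..} (r * cos \<psi>) = (indicator {0<..} r :: ennreal)"
          using cp by (simp add: zero_less_mult_iff indicator_def)
        \<comment> \<open>The Jacobians t / (cos \<psi>)^2 of the first and cos \<psi> of the second
          substitution multiply to r, since t = r cos \<psi>.\<close>
        have m: "ennreal (cos \<psi>) * (ennreal (r * cos \<psi>) * (ennreal (1 / cos \<psi> ^ 2) * X)) = ennreal r * X" if "r > 0" for X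
          using cp that by (simp add: mult.assoc[symmetric] ennreal_mult'[symmetric] power2_eq_square)
        show "ennreal (cos \<psi>) * (indicator {0<..} (cos \<psi> * r) * (ennreal (cos \<psi> * r) * (ennreal (1 / cos \<psi> ^ 2) * H (cos \<psi> * r * tan \<psi>, cos \<psi> * r))))
          = indicator {0<..} r * (ennreal r * H (r * sin \<psi>, r * cos \<psi>))"
          unfolding e1 e2 e3 using m by (cases "r > 0") simp_all
      qed
      finally show ?thesis using True by simp
    qed auto
  qed
  \<comment> \<open>So far \<psi> is the angle from the axis s = 0; the reflection \<psi> = pi/2 -
    \<phi> measures it from the s-axis.\<close>
  also have "\<dots> = (\<integral>\<^sup>+\<phi>. indicator ?I (pi/2 + (-1) * \<phi>) * (\<integral>\<^sup>+r. indicator {0<..} r * 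
       (ennreal r * H (r * sin (pi/2 + (-1) * \<phi>), r * cos (pi/2 + (-1) * \<phi>))) \<partial>lborel) \<partial>lborel)"
    by (subst nn_integral_real_affine[of _ "-1" "pi/2"]) auto
  also have "\<dots> = (\<integral>\<^sup>+\<phi>. indicator {0<..<pi} \<phi> * (\<integral>\<^sup>+r. indicator {0<..} r * 
       (ennreal r * H (r * cos \<phi>, r * sin \<phi>)) \<partial>lborel) \<partial>lborel)"
    by (intro nn_integral_cong arg_cong2[where f="(*)"])
       (auto simp: sin_diff cos_diff split: split_indicator)
  also have "\<dots> = (\<integral>\<^sup>+\<phi>. indicator {0<..<pi} \<phi> * (\<integral>\<^sup>+\<theta>. indicator {0<..<pi/2} \<theta> *
       (ennreal (c\<^sup>2 * tan \<theta> / (cos \<theta>)\<^sup>2) * H (c * tan \<theta> * cos \<phi>, c * tan \<theta> * sin \<phi>)) \<partial>lborel) \<partial>lborel)"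
  proof (rule nn_integral_cong, rule arg_cong2[where f="(*)"], rule refl)
    fix \<phi> :: real
    have "(\<integral>\<^sup>+r. indicator {0<..} r * (ennreal r * H (r * cos \<phi>, r * sin \<phi>)) \<partial>lborel)
      = ennreal c * (\<integral>\<^sup>+r. indicator {0<..} (c * r) * (ennreal (c * r) * H (c * r * cos \<phi>, c * r * sin \<phi>)) \<partial>lborel)"
      using c by (subst nn_integral_real_affine[of _ c 0]) auto
    also have "(\<integral>\<^sup>+r. indicator {0<..} (c * r) * (ennreal (c * r) * H (c * r * cos \<phi>, c * r * sin \<phi>)) \<partial>lborel)
      = (\<integral>\<^sup>+\<theta>. indicator ?I \<theta> * (indicator {0<..} (c * tan \<theta>) * (ennreal (c * tan \<theta>) * H (c * tan \<theta> * cos \<phi>, c * tan \<theta> * sin \<phi>))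
           * ennreal (1 / cos \<theta> ^ 2)) \<partial>lborel)"
      by (rule nn_integral_tan) measurable
    also have "ennreal c * \<dots> = (\<integral>\<^sup>+\<theta>. ennreal c * (indicator ?I \<theta> * (indicator {0<..} (c * tan \<theta>) * (ennreal (c * tan \<theta>) * H (c * tan \<theta> * cos \<phi>, c * tan \<theta> * sin \<phi>))
           * ennreal (1 / cos \<theta> ^ 2))) \<partial>lborel)"
      by (rule nn_integral_cmult[symmetric]) measurable
    also have "\<dots> = (\<integral>\<^sup>+\<theta>. indicator {0<..<pi/2} \<theta> *
       (ennreal (c\<^sup>2 * tan \<theta> / (cos \<theta>)\<^sup>2) * H (c * tan \<theta> * cos \<phi>, c * tan \<theta> * sin \<phi>)) \<partial>lborel)"
    proof (rule nn_integral_cong)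
      fix \<theta> :: real
      \<comment> \<open>The tangent substitution covers the whole open interval from -pi/2 to pi/2;
        on its nonpositive half the radius c tan \<theta> is not positive and the indicator removes
        it.\<close>
      consider "\<theta> \<in> {0<..<pi/2}" | "\<theta> \<in> {-(pi/2)<..0}" | "\<theta> \<notin> ?I" by force
      then show "ennreal c * (indicator ?I \<theta> * (indicator {0<..} (c * tan \<theta>) * (ennreal (c * tan \<theta>) * H (c * tan \<theta> * cos \<phi>, c * tan \<theta> * sin \<phi>))
           * ennreal (1 / cos \<theta> ^ 2))) = indicator {0<..<pi/2} \<theta> *
       (ennreal (c\<^sup>2 * tan \<theta> / (cos \<theta>)\<^sup>2) * H (c * tan \<theta> * cos \<phi>, c * tan \<theta> * sin \<phi>))"
      proof cases
        case 1
        then have "tan \<theta> > 0" by (auto intro: tan_gt_zero)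
        moreover have "ennreal c * (ennreal (c * tan \<theta>) * X * ennreal (1 / cos \<theta> ^ 2)) = ennreal (c\<^sup>2 * tan \<theta> / (cos \<theta>)\<^sup>2) * X" for X
        proof -
          have "ennreal c * (ennreal (c * tan \<theta>) * X * ennreal (1 / cos \<theta> ^ 2)) = (ennreal c * ennreal (c * tan \<theta>) * ennreal (1 / cos \<theta> ^ 2)) * X"
            by (simp add: mult_ac)
          also have "ennreal c * ennreal (c * tan \<theta>) * ennreal (1 / cos \<theta> ^ 2) = ennreal (c\<^sup>2 * tan \<theta> / (cos \<theta>)\<^sup>2)"
            using c \<open>tan \<theta> > 0\<close> by (simp add: ennreal_mult'[symmetric] power2_eq_square mult.assoc)
          finally show ?thesis .
        qed
        ultimately show ?thesis using 1 c by (auto simp: zero_less_mult_iff)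
      next
        case 2
        then have "tan \<theta> \<le> 0" using tan_gt_zero[of "-\<theta>"] by (cases "\<theta> = 0") auto
        then have "\<not> c * tan \<theta> > 0" using c by (simp add: mult_le_0_iff not_less)
        then show ?thesis using 2 by auto
      next
        case 3 then show ?thesis by auto
      qed
    qed
    finally show "(\<integral>\<^sup>+r. indicator {0<..} r * (ennreal r * H (r * cos \<phi>, r * sin \<phi>)) \<partial>lborel) = (\<integral>\<^sup>+\<theta>. indicator {0<..<pi/2} \<theta> *
       (ennreal (c\<^sup>2 * tan \<theta> / (cos \<theta>)\<^sup>2) * H (c * tan \<theta> * cos \<phi>, c * tan \<theta> * sin \<phi>)) \<partial>lborel)" .
  qed
  finally show ?thesis .
qed

section \<open>The radial law of Lebesgue measure and cylindrical coordinates\<close>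

text \<open>It suffices to compare both measures on half-lines \<open>{..a}\<close>. There the left
  one is the volume of a ball of radius a, and the density on the right is the derivative of that
  volume, because \<open>sphere_area\<close> is the dimension times the volume of the unit
  ball.\<close>

lemma distr_PiM_norm:
  assumes J: "finite J" "J \<noteq> {}"
  shows "distr (Pi\<^sub>M J (\<lambda>_. lborel)) borel (\<lambda>f. sqrt (\<Sum>i\<in>J. (f i)\<^sup>2)) =
    density lborel (\<lambda>t. indicator {0<..} t * ennreal (sphere_area (card J) * t ^ (card J - 1)))"
    (is "?M = ?N")
proof (rule measure_eqI_generator_eq[where \<Omega> = UNIV and A = "\<lambda>i::nat. {..real i}"])
  let ?E = "range (\<lambda>a::real. {..a})"
  interpret product_sigma_finite "\<lambda>_. lborel :: real measure" by standard
  have [measurable]: "(\<lambda>f. sqrt (\<Sum>i\<in>J. (f i)\<^sup>2)) \<in> borel_measurable (Pi\<^sub>M J (\<lambda>_. lborel))"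
    by measurable
  have cpos: "card J > 0" using J by (simp add: card_gt_0_iff)
  show "Int_stable ?E"
    by (auto simp: Int_stable_def)
  show "?E \<subseteq> Pow UNIV" by simp
  show "sets ?M = sigma_sets UNIV ?E" "sets ?N = sigma_sets UNIV ?E"
    by (simp_all add: borel_eq_atMost)
  show "range (\<lambda>i::nat. {..real i}) \<subseteq> ?E" by auto
  show "(\<Union>i. {..real i}) = UNIV"
    using real_arch_simple by auto
  have M_pos: "emeasure ?M {..a} = ennreal (unit_ball_vol (real (card J)) * a ^ card J)" if "a > 0" for a
  proof -
    have "(\<lambda>f. sqrt (\<Sum>i\<in>J. (f i)\<^sup>2)) -` {..a} = {f. sqrt (\<Sum>i\<in>J. (f i)\<^sup>2) \<le> a}" by auto
    then show ?thesis
      using emeasure_cball_aux[OF J(1) that] by (subst emeasure_distr) simp_all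
  qed
  have M_nonpos: "emeasure ?M {..a} = 0" if "a \<le> 0" for a
  proof -
    \<comment> \<open>For a = 0 the preimage is the origin rather than empty. It is a null set
      because \<open>J\<close> is nonempty; over an empty \<open>J\<close> the law would be a point
      mass at 0.\<close>
    have "(\<lambda>f. sqrt (\<Sum>i\<in>J. (f i)\<^sup>2)) -` {..a} \<inter> space (Pi\<^sub>M J (\<lambda>_. lborel)) \<subseteq> Pi\<^sub>E J (\<lambda>_. {0::real})"
    proof
      fix f :: "'a \<Rightarrow> real" assume f: "f \<in> (\<lambda>f. sqrt (\<Sum>i\<in>J. (f i)\<^sup>2)) -` {..a} \<inter> space (Pi\<^sub>M J (\<lambda>_. lborel))"
      then have "sqrt (\<Sum>i\<in>J. (f i)\<^sup>2) \<le> a" by blast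
      then have "sqrt (\<Sum>i\<in>J. (f i)\<^sup>2) \<le> 0" using that by (rule order_trans)
      then have "(\<Sum>i\<in>J. (f i)\<^sup>2) = 0"
        by (meson antisym real_sqrt_le_0_iff sum_nonneg zero_le_power2)
      then have "\<forall>i\<in>J. f i = 0" using J by (subst (asm) sum_nonneg_eq_0_iff) auto
      then show "f \<in> Pi\<^sub>E J (\<lambda>_. {0::real})"
        using f by (intro PiE_I) (auto simp: space_PiM PiE_iff extensional_def)
    qed
    then have "emeasure ?M {..a} \<le> emeasure (Pi\<^sub>M J (\<lambda>_. lborel)) (Pi\<^sub>E J (\<lambda>_. {0::real}))"
      using sets_PiM_I_finite[OF J(1), of "\<lambda>_. {0}" "\<lambda>_. lborel"]
      by (subst emeasure_distr) (auto simp del: PiE_singleton intro!: emeasure_mono)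
    also have "\<dots> = (\<Prod>i\<in>J. emeasure lborel {0::real})"
      using J by (intro emeasure_PiM) auto
    also have "\<dots> = 0" using J by (auto simp: prod_zero_iff)
    finally show ?thesis by simp
  qed
  have N_nonpos: "emeasure ?N {..a} = 0" if "a \<le> 0" for a
  proof -
    have "emeasure ?N {..a} = (\<integral>\<^sup>+ t. indicator {0<..} t * ennreal (sphere_area (card J) * t ^ (card J - 1)) * indicator {..a} t \<partial>lborel)"
      by (subst emeasure_density) auto
    also have "\<dots> = (\<integral>\<^sup>+ t. 0 \<partial>(lborel :: real measure))"
      using that by (intro nn_integral_cong) (auto split: split_indicator)
    finally show ?thesis by simp
  qed
  have N_pos: "emeasure ?N {..a} = ennreal (unit_ball_vol (real (card J)) * a ^ card J)" if "a > 0" for a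
  proof -
    have "emeasure ?N {..a} = (\<integral>\<^sup>+ t. ennreal (sphere_area (card J) * t ^ (card J - 1)) * indicator {0..a} t \<partial>lborel)"
    proof -
      have "emeasure ?N {..a} = (\<integral>\<^sup>+ t. indicator {0<..} t * ennreal (sphere_area (card J) * t ^ (card J - 1)) * indicator {..a} t \<partial>lborel)"
        by (subst emeasure_density) auto
      also have "\<dots> = (\<integral>\<^sup>+ t. ennreal (sphere_area (card J) * t ^ (card J - 1)) * indicator {0..a} t \<partial>lborel)"
        by (rule nn_integral_cong_AE, rule AE_mp[OF AE_lborel_singleton[of 0]]) (auto split: split_indicator)
      finally show ?thesis .
    qed
    also have "\<dots> = ennreal (unit_ball_vol (real (card J)) * a ^ card J - unit_ball_vol (real (card J)) * 0 ^ card J)"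
    proof (rule nn_integral_FTC_Icc[where F = "\<lambda>t. unit_ball_vol (real (card J)) * t ^ card J"])
      show "((\<lambda>t. unit_ball_vol (real (card J)) * t ^ card J) has_real_derivative sphere_area (card J) * t ^ (card J - 1)) (at t)" for t
        using cpos by (auto intro!: derivative_eq_intros simp: sphere_area_def)
      show "0 \<le> sphere_area (card J) * t ^ (card J - 1)" if "t \<in> {0..a}" for t
        using that by (simp add: sphere_area_def)
    qed (use that in auto)
    finally show ?thesis using cpos by (simp add: zero_power)
  qed
  show "emeasure ?M X = emeasure ?N X" if "X \<in> ?E" for X
  proof -
    from that obtain a where "X = {..a}" by blast
    then show ?thesis
      using M_pos[of a] M_nonpos[of a] N_pos[of a] N_nonpos[of a] by (cases "a > 0") simp_all
  qed
  show "emeasure ?M {..real i} \<noteq> \<infinity>" for i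
    using M_pos M_nonpos by (cases "i = 0") auto
qed

lemma nn_integral_PiM_norm:
  assumes J: "finite J" "J \<noteq> {}" and [measurable]: "F \<in> borel_measurable borel"
  shows "(\<integral>\<^sup>+f. F (sqrt (\<Sum>i\<in>J. (f i)\<^sup>2)) \<partial>Pi\<^sub>M J (\<lambda>_. lborel)) =
    (\<integral>\<^sup>+t. indicator {0<..} t * (ennreal (sphere_area (card J) * t ^ (card J - 1)) * F t) \<partial>lborel)"
proof -
  have "(\<integral>\<^sup>+f. F (sqrt (\<Sum>i\<in>J. (f i)\<^sup>2)) \<partial>Pi\<^sub>M J (\<lambda>_. lborel)) =
     (\<integral>\<^sup>+t. F t \<partial>distr (Pi\<^sub>M J (\<lambda>_. lborel)) borel (\<lambda>f. sqrt (\<Sum>i\<in>J. (f i)\<^sup>2)))"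
    by (subst nn_integral_distr) measurable
  then show ?thesis
    by (simp add: distr_PiM_norm[OF J] nn_integral_density mult_ac)
qed

text \<open>The coordinate along e is split off the product measure; the remaining coordinates enter
  only through their Euclidean norm, to which the radial law applies. Dimension at least 2 keeps
  that index set nonempty.\<close>

lemma nn_integral_cylindrical_Basis:
  fixes e :: "'a::euclidean_space"
  assumes e: "e \<in> Basis" and dim: "DIM('a) \<ge> 2" and G[measurable]: "G \<in> borel_measurable borel"
  shows "(\<integral>\<^sup>+y. G (y \<bullet> e, sqrt ((norm y)\<^sup>2 - (y \<bullet> e)\<^sup>2)) \<partial>lborel) =
    (\<integral>\<^sup>+s. \<integral>\<^sup>+t. indicator {0<..} t *
       (ennreal (sphere_area (DIM('a) - 1) * t ^ (DIM('a) - 2)) * G (s, t)) \<partial>lborel \<partial>lborel)"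
proof -
  interpret product_sigma_finite "\<lambda>_. lborel :: real measure" by standard
  define J where "J = (Basis :: 'a set) - {e}"
  have J: "finite J" "e \<notin> J" "insert e J = Basis" "card J = DIM('a) - 1"
    using e by (auto simp: J_def)
  have J0: "J \<noteq> {}" using J dim by (metis card.empty diff_is_0_eq not_numeral_le_zero numeral_le_one_iff semiring_norm(69) le_trans)
  have [measurable]: "G \<in> borel_measurable (borel \<Otimes>\<^sub>M borel)"
    using G by (simp add: borel_prod)
  have sq: "sqrt ((norm y)\<^sup>2 - (y \<bullet> e)\<^sup>2) = sqrt (\<Sum>b\<in>J. (y \<bullet> b)\<^sup>2)" for y :: 'a
  proof -
    have "(norm y)\<^sup>2 = (\<Sum>b\<in>Basis. (y \<bullet> b)\<^sup>2)"
      unfolding power2_norm_eq_inner by (subst euclidean_inner) (simp add: power2_eq_square)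
    also have "\<dots> = (y \<bullet> e)\<^sup>2 + (\<Sum>b\<in>J. (y \<bullet> b)\<^sup>2)"
      by (simp only: J(3)[symmetric] sum.insert[OF J(1,2)])
    finally show ?thesis by simp
  qed
  define K where "K f = G (f e, sqrt (\<Sum>b\<in>J. (f b)\<^sup>2))" for f :: "'a \<Rightarrow> real"
  have eJ: "e \<in> insert e J" "\<And>b. b \<in> J \<Longrightarrow> b \<in> insert e J" by auto
  have Km[measurable]: "K \<in> borel_measurable (Pi\<^sub>M (insert e J) (\<lambda>_. lborel))"
    unfolding K_def using eJ by measurable
  have "(\<integral>\<^sup>+y. G (y \<bullet> e, sqrt ((norm y)\<^sup>2 - (y \<bullet> e)\<^sup>2)) \<partial>lborel) = (\<integral>\<^sup>+y. K (\<lambda>b. (y::'a) \<bullet> b) \<partial>lborel)"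
    by (simp add: K_def sq)
  also have "\<dots> = (\<integral>\<^sup>+f. K (\<lambda>b. (\<Sum>c\<in>Basis. f c *\<^sub>R c) \<bullet> (b::'a)) \<partial>Pi\<^sub>M Basis (\<lambda>_. lborel))"
    unfolding K_def by (subst lborel_eq, subst nn_integral_distr) auto
  also have "\<dots> = (\<integral>\<^sup>+f. K f \<partial>Pi\<^sub>M (insert e J) (\<lambda>_. lborel))"
  proof -
    have "K (\<lambda>b. (\<Sum>c\<in>Basis. f c *\<^sub>R c) \<bullet> (b::'a)) = K f" for f
    proof -
      have "(\<Sum>b\<in>J. ((\<Sum>c\<in>Basis. f c *\<^sub>R c) \<bullet> b)\<^sup>2) = (\<Sum>b\<in>J. (f b)\<^sup>2)"
        by (rule sum.cong) (use J in \<open>auto simp: J_def\<close>)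
      then show ?thesis using e by (simp add: K_def)
    qed
    then show ?thesis by (simp add: J(3))
  qed
  also have "\<dots> = (\<integral>\<^sup>+s. (\<integral>\<^sup>+f. K (f(e := s)) \<partial>Pi\<^sub>M J (\<lambda>_. lborel)) \<partial>lborel)"
    by (rule product_nn_integral_insert_rev[OF J(1,2)]) measurable
  also have "\<dots> = (\<integral>\<^sup>+s. (\<integral>\<^sup>+f. G (s, sqrt (\<Sum>b\<in>J. (f b)\<^sup>2)) \<partial>Pi\<^sub>M J (\<lambda>_. lborel)) \<partial>lborel)"
  proof -
    have "K (f(e := s)) = G (s, sqrt (\<Sum>b\<in>J. (f b)\<^sup>2))" for f s
    proof -
      have "(\<Sum>b\<in>J. ((f(e := s)) b)\<^sup>2) = (\<Sum>b\<in>J. (f b)\<^sup>2)"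
        by (rule sum.cong) (use J in auto)
      then show ?thesis by (simp add: K_def)
    qed
    then show ?thesis by simp
  qed
  also have "\<dots> = (\<integral>\<^sup>+s. \<integral>\<^sup>+t. indicator {0<..} t *
       (ennreal (sphere_area (card J) * t ^ (card J - 1)) * G (s, t)) \<partial>lborel \<partial>lborel)"
    by (intro nn_integral_cong nn_integral_PiM_norm J J0) measurable
  finally show ?thesis by (simp add: J(4) numeral_2_eq_2)
qed

lemma lborel_distr_reflect: "distr lborel borel (\<lambda>y. t - y) = (lborel :: 'a::euclidean_space measure)"
  using lborel_affine[of "-1" t] by (simp add: density_1)

text \<open>Translation invariance and Tonelli show that the measures \<open>A \<mapsto> \<lambda>(f\<^sup>-\<^sup>1 A)\<close> and \<open>\<lambda>\<close> are
  proportional; the unit ball, which \<open>f\<close> preserves, fixes the factor.\<close>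

lemma distr_lborel_orthogonal:
  fixes f :: "'a::euclidean_space \<Rightarrow> 'a"
  assumes f: "orthogonal_transformation f"
  shows "distr lborel borel f = lborel"
proof (rule measure_eqI)
  have lin: "linear f" and surj: "surj f"
    using f by (auto simp: orthogonal_transformation_linear orthogonal_transformation_surj)
  have "continuous_on UNIV f" using lin by (simp add: linear_continuous_on linear_conv_bounded_linear)
  then have fm[measurable]: "f \<in> borel_measurable borel" by (rule borel_measurable_continuous_onI)
  show "sets (distr lborel borel f) = sets lborel" by simp
  fix A assume "A \<in> sets (distr lborel borel f)"
  then have A[measurable]: "A \<in> sets borel" by simp
  define B where "B = cball (0::'a) 1"
  have B[measurable]: "B \<in> sets borel" by (simp add: B_def)
  have fB: "f x \<in> B \<longleftrightarrow> x \<in> B" for x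
    using orthogonal_transformation_norm[OF f] by (simp add: B_def)
  have shift: "(\<integral>\<^sup>+x. h x \<partial>lborel) = (\<integral>\<^sup>+x. h (t + x) \<partial>lborel)"
    if [measurable]: "h \<in> borel_measurable borel" for h :: "'a \<Rightarrow> ennreal" and t
    by (subst (1) lborel_distr_plus[symmetric, of t]) (simp add: nn_integral_distr)
  have refl: "(\<integral>\<^sup>+x. h x \<partial>lborel) = (\<integral>\<^sup>+x. h (t - x) \<partial>lborel)"
    if [measurable]: "h \<in> borel_measurable borel" for h :: "'a \<Rightarrow> ennreal" and t
    by (subst (1) lborel_distr_reflect[symmetric, of t]) (simp add: nn_integral_distr)
  have "emeasure lborel B * emeasure (distr lborel borel f) A =
      emeasure lborel B * (\<integral>\<^sup>+x. indicator A (f x) \<partial>lborel)"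
    by (simp add: nn_integral_distr flip: nn_integral_indicator)
  also have "\<dots> = (\<integral>\<^sup>+x. (\<integral>\<^sup>+y. indicator A (f x) * indicator B y \<partial>lborel) \<partial>lborel)"
    by (simp add: nn_integral_cmult nn_integral_multc mult.commute)
  \<comment> \<open>This begins the evaluation of one double integral in two ways: y is shifted by f
    x, the order is exchanged, x is shifted, the order is exchanged back, and y is replaced by f x -
    y. In the end the roles of f and the identity on A are interchanged.\<close>
  also have "\<dots> = (\<integral>\<^sup>+x. (\<integral>\<^sup>+y. indicator A (f x) * indicator B (f x + y) \<partial>lborel) \<partial>lborel)"
    by (intro nn_integral_cong shift) measurable
  also have "\<dots> = (\<integral>\<^sup>+y. (\<integral>\<^sup>+x. indicator A (f x) * indicator B (f x + y) \<partial>lborel) \<partial>lborel)"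
    by (rule lborel_pair.Fubini'[of "\<lambda>y x. indicator A (f x) * indicator B (f x + y)"]) measurable
  also have "\<dots> = (\<integral>\<^sup>+y. (\<integral>\<^sup>+x. indicator A (f x - y) * indicator B (f x) \<partial>lborel) \<partial>lborel)"
  proof (rule nn_integral_cong)
    fix y
    \<comment> \<open>Surjectivity turns the translation by y in the image into the translation by z
      of the variable x, under which Lebesgue measure is invariant.\<close>
    obtain z where z: "y = f z" using surj by (metis surjD)
    have "(\<integral>\<^sup>+x. indicator A (f x) * indicator B (f x + y) \<partial>lborel)
      = (\<integral>\<^sup>+x. indicator A (f (-z + x)) * indicator B (f (-z + x) + y) \<partial>lborel)"
      by (rule shift) measurable
    also have "\<dots> = (\<integral>\<^sup>+x. indicator A (f x - y) * indicator B (f x) \<partial>lborel)"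
      by (intro nn_integral_cong) (simp add: z linear_diff[OF lin])
    finally show "(\<integral>\<^sup>+x. indicator A (f x) * indicator B (f x + y) \<partial>lborel)
      = (\<integral>\<^sup>+x. indicator A (f x - y) * (indicator B (f x) :: ennreal) \<partial>lborel)" .
  qed
  also have "\<dots> = (\<integral>\<^sup>+x. (\<integral>\<^sup>+y. indicator A (f x - y) * indicator B (f x) \<partial>lborel) \<partial>lborel)"
    by (rule lborel_pair.Fubini'[symmetric, of "\<lambda>y x. indicator A (f x - y) * indicator B (f x)"]) measurable
  also have "\<dots> = (\<integral>\<^sup>+x. (\<integral>\<^sup>+y. indicator A y * indicator B (f x) \<partial>lborel) \<partial>lborel)"
    by (intro nn_integral_cong refl[symmetric]) measurable
  also have "\<dots> = emeasure lborel B * emeasure lborel A"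
  proof -
    have "indicator B (f x) = (indicator B x :: ennreal)" for x by (simp add: indicator_def fB)
    then show ?thesis by (simp add: nn_integral_cmult nn_integral_multc mult.commute)
  qed
  finally have "emeasure lborel B * emeasure (distr lborel borel f) A = emeasure lborel B * emeasure lborel A" .
  moreover have "emeasure lborel B = ennreal (unit_ball_vol (real DIM('a)))"
    by (simp add: B_def emeasure_cball)
  ultimately show "emeasure (distr lborel borel f) A = emeasure lborel A"
    using less_imp_neq[OF unit_ball_vol_pos[of "real DIM('a)"]] by (simp add: ennreal_mult_cancel_left)
qed

text \<open>A rotation taking a basis vector to e preserves the measure, the norm and the component
  along the axis, which reduces any axis to a coordinate axis.\<close>

lemma nn_integral_cylindrical:
  fixes e :: "real ^ 'm::finite"
  assumes e: "norm e = 1" and dim: "CARD('m) \<ge> 2" and G[measurable]: "G \<in> borel_measurable borel"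
  shows "(\<integral>\<^sup>+y. G (y \<bullet> e, sqrt ((norm y)\<^sup>2 - (y \<bullet> e)\<^sup>2)) \<partial>lborel) =
    (\<integral>\<^sup>+s. \<integral>\<^sup>+t. indicator {0<..} t *
       (ennreal (sphere_area (CARD('m) - 1) * t ^ (CARD('m) - 2)) * G (s, t)) \<partial>lborel \<partial>lborel)"
proof -
  have [measurable]: "G \<in> borel_measurable (borel \<Otimes>\<^sub>M borel)"
    using G by (simp add: borel_prod)
  obtain b :: "real ^ 'm" where b: "b \<in> Basis" using nonempty_Basis by blast
  obtain f :: "real ^ 'm \<Rightarrow> real ^ 'm" where f: "orthogonal_transformation f" "f b = e"
    using orthogonal_transformation_exists[of b e] e b by auto
  have [measurable]: "f \<in> borel_measurable borel"
    using f(1) by (auto intro!: borel_measurable_continuous_onI linear_continuous_on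
        simp: orthogonal_transformation_linear linear_conv_bounded_linear[symmetric])
  have "(\<integral>\<^sup>+y. G (y \<bullet> e, sqrt ((norm y)\<^sup>2 - (y \<bullet> e)\<^sup>2)) \<partial>lborel)
      = (\<integral>\<^sup>+y. G (y \<bullet> e, sqrt ((norm y)\<^sup>2 - (y \<bullet> e)\<^sup>2)) \<partial>distr lborel borel f)"
    by (simp add: distr_lborel_orthogonal[OF f(1)])
  also have "\<dots> = (\<integral>\<^sup>+y. G (f y \<bullet> e, sqrt ((norm (f y))\<^sup>2 - (f y \<bullet> e)\<^sup>2)) \<partial>lborel)"
    by (subst nn_integral_distr) auto
  also have "\<dots> = (\<integral>\<^sup>+y. G (y \<bullet> b, sqrt ((norm y)\<^sup>2 - (y \<bullet> b)\<^sup>2)) \<partial>lborel)"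
  proof -
    have "f y \<bullet> e = y \<bullet> b" "norm (f y) = norm y" for y
      using f by (auto simp: orthogonal_transformation_norm orthogonal_transformation_def)
    then show ?thesis by simp
  qed
  finally show ?thesis
    using nn_integral_cylindrical_Basis[OF b _ G] dim by simp
qed

text \<open>The scale \<open>c\<close> is free here and will be x_n. The radial weight (c tan
  \<theta> sin \<phi>)^(m-2), for m = \<open>CARD('m)\<close>, and the planar Jacobian c^2 tan
  \<theta> / (cos \<theta>)^2 combine to the weight shown.\<close>

lemma nn_integral_polar:
  fixes e :: "real ^ 'm::finite"
  assumes e: "norm e = 1" and dim: "CARD('m) \<ge> 2" and G[measurable]: "G \<in> borel_measurable borel"
    and c: "c > 0"
  shows "(\<integral>\<^sup>+y. G (y \<bullet> e, sqrt ((norm y)\<^sup>2 - (y \<bullet> e)\<^sup>2)) \<partial>lborel) =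
    ennreal (sphere_area (CARD('m) - 1) * c ^ CARD('m)) *
    (\<integral>\<^sup>+\<phi>. indicator {0<..<pi} \<phi> * (\<integral>\<^sup>+\<theta>. indicator {0<..<pi/2} \<theta> *
       (ennreal (tan \<theta> ^ (CARD('m) - 1) / (cos \<theta>)\<^sup>2 * sin \<phi> ^ (CARD('m) - 2)) *
        G (c * tan \<theta> * cos \<phi>, c * tan \<theta> * sin \<phi>)) \<partial>lborel) \<partial>lborel)"
proof -
  have [measurable]: "G \<in> borel_measurable (borel \<Otimes>\<^sub>M borel)"
    using G by (simp add: borel_prod)
  have [measurable]: "(tan :: real \<Rightarrow> real) \<in> borel_measurable borel"
    unfolding tan_def by measurable
  let ?m = "CARD('m)"
  obtain k where k: "?m = Suc (Suc k)" using dim by (metis Suc_le_D numeral_2_eq_2 Suc_le_mono)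
  let ?w = "sphere_area (?m - 1)"
  have w: "?w \<ge> 0" by (simp add: sphere_area_def)
  let ?H = "\<lambda>(s, t). ennreal (?w * t ^ (?m - 2)) * G (s, t)"
  have "?H \<in> borel_measurable (borel \<Otimes>\<^sub>M borel)" by measurable
  then have Hm: "?H \<in> borel_measurable borel" by (simp add: borel_prod)
  have "(\<integral>\<^sup>+y. G (y \<bullet> e, sqrt ((norm y)\<^sup>2 - (y \<bullet> e)\<^sup>2)) \<partial>lborel) =
    (\<integral>\<^sup>+\<phi>. indicator {0<..<pi} \<phi> * (\<integral>\<^sup>+\<theta>. indicator {0<..<pi/2} \<theta> *
       (ennreal (c\<^sup>2 * tan \<theta> / (cos \<theta>)\<^sup>2) * ?H (c * tan \<theta> * cos \<phi>, c * tan \<theta> * sin \<phi>)) \<partial>lborel) \<partial>lborel)"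
    using nn_integral_half_plane_polar[OF Hm c] nn_integral_cylindrical[OF e dim G] by simp
  also have "\<dots> = (\<integral>\<^sup>+\<phi>. ennreal (?w * c ^ ?m) * (indicator {0<..<pi} \<phi> * (\<integral>\<^sup>+\<theta>. indicator {0<..<pi/2} \<theta> *
       (ennreal (tan \<theta> ^ (?m - 1) / (cos \<theta>)\<^sup>2 * sin \<phi> ^ (?m - 2)) *
        G (c * tan \<theta> * cos \<phi>, c * tan \<theta> * sin \<phi>)) \<partial>lborel)) \<partial>lborel)"
  proof (rule nn_integral_cong)
    fix \<phi> :: real
    show "indicator {0<..<pi} \<phi> * (\<integral>\<^sup>+\<theta>. indicator {0<..<pi/2} \<theta> *
       (ennreal (c\<^sup>2 * tan \<theta> / (cos \<theta>)\<^sup>2) * ?H (c * tan \<theta> * cos \<phi>, c * tan \<theta> * sin \<phi>)) \<partial>lborel) =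
      ennreal (?w * c ^ ?m) * (indicator {0<..<pi} \<phi> * (\<integral>\<^sup>+\<theta>. indicator {0<..<pi/2} \<theta> *
       (ennreal (tan \<theta> ^ (?m - 1) / (cos \<theta>)\<^sup>2 * sin \<phi> ^ (?m - 2)) *
        G (c * tan \<theta> * cos \<phi>, c * tan \<theta> * sin \<phi>)) \<partial>lborel))"
    proof (cases "\<phi> \<in> {0<..<pi}")
      case True
      then have sp: "sin \<phi> > 0" by (auto intro: sin_gt_zero)
      have "(\<integral>\<^sup>+\<theta>. indicator {0<..<pi/2} \<theta> *
         (ennreal (c\<^sup>2 * tan \<theta> / (cos \<theta>)\<^sup>2) * ?H (c * tan \<theta> * cos \<phi>, c * tan \<theta> * sin \<phi>)) \<partial>lborel) =
         (\<integral>\<^sup>+\<theta>. ennreal (?w * c ^ ?m) * (indicator {0<..<pi/2} \<theta> *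
       (ennreal (tan \<theta> ^ (?m - 1) / (cos \<theta>)\<^sup>2 * sin \<phi> ^ (?m - 2)) *
        G (c * tan \<theta> * cos \<phi>, c * tan \<theta> * sin \<phi>))) \<partial>lborel)"
      proof (rule nn_integral_cong)
        fix \<theta> :: real
        have "ennreal (c\<^sup>2 * tan \<theta> / (cos \<theta>)\<^sup>2) * (ennreal (?w * (c * tan \<theta> * sin \<phi>) ^ (?m - 2)) * X) =
          ennreal (?w * c ^ ?m) * (ennreal (tan \<theta> ^ (?m - 1) / (cos \<theta>)\<^sup>2 * sin \<phi> ^ (?m - 2)) * X)"
          if "\<theta> \<in> {0<..<pi/2}" for X
        proof -
          have tp: "tan \<theta> > 0" using that by (auto intro: tan_gt_zero)
          have "c\<^sup>2 * tan \<theta> / (cos \<theta>)\<^sup>2 * (?w * (c * tan \<theta> * sin \<phi>) ^ (?m - 2)) =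
             ?w * c ^ ?m * (tan \<theta> ^ (?m - 1) / (cos \<theta>)\<^sup>2 * sin \<phi> ^ (?m - 2))"
            by (simp add: k power_mult_distrib power2_eq_square)
          then have "ennreal (c\<^sup>2 * tan \<theta> / (cos \<theta>)\<^sup>2) * ennreal (?w * (c * tan \<theta> * sin \<phi>) ^ (?m - 2)) =
             ennreal (?w * c ^ ?m) * ennreal (tan \<theta> ^ (?m - 1) / (cos \<theta>)\<^sup>2 * sin \<phi> ^ (?m - 2))"
            using c tp sp w by (subst (1 2) ennreal_mult''[symmetric]) auto
          then show ?thesis by (simp only: mult.assoc[symmetric])
        qed
        then show "indicator {0<..<pi/2} \<theta> *
         (ennreal (c\<^sup>2 * tan \<theta> / (cos \<theta>)\<^sup>2) * ?H (c * tan \<theta> * cos \<phi>, c * tan \<theta> * sin \<phi>)) = ennreal (?w * c ^ ?m) * (indicator {0<..<pi/2} \<theta> *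
       (ennreal (tan \<theta> ^ (?m - 1) / (cos \<theta>)\<^sup>2 * sin \<phi> ^ (?m - 2)) *
        G (c * tan \<theta> * cos \<phi>, c * tan \<theta> * sin \<phi>)))"
          by (auto split: split_indicator)
      qed
      also have "\<dots> = ennreal (?w * c ^ ?m) * (\<integral>\<^sup>+\<theta>. indicator {0<..<pi/2} \<theta> *
       (ennreal (tan \<theta> ^ (?m - 1) / (cos \<theta>)\<^sup>2 * sin \<phi> ^ (?m - 2)) *
        G (c * tan \<theta> * cos \<phi>, c * tan \<theta> * sin \<phi>)) \<partial>lborel)"
        by (rule nn_integral_cmult) measurable
      finally show ?thesis using True by simp
    qed auto
  qed
  also have "\<dots> = ennreal (?w * c ^ ?m) * (\<integral>\<^sup>+\<phi>. indicator {0<..<pi} \<phi> * (\<integral>\<^sup>+\<theta>. indicator {0<..<pi/2} \<theta> *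
       (ennreal (tan \<theta> ^ (?m - 1) / (cos \<theta>)\<^sup>2 * sin \<phi> ^ (?m - 2)) *
        G (c * tan \<theta> * cos \<phi>, c * tan \<theta> * sin \<phi>)) \<partial>lborel) \<partial>lborel)"
    by (rule nn_integral_cmult) measurable
  finally show ?thesis .
qed

subsection \<open>The constant for exponent 2\<close>

lemma has_integral_of_derivative:
  fixes f F :: "real \<Rightarrow> real"
  assumes "a \<le> b" "\<And>x. (F has_real_derivative f x) (at x)"
  shows "(f has_integral (F b - F a)) {a..b}"
  using assms by (intro fundamental_theorem_of_calculus)
    (auto simp: has_real_derivative_iff_has_vector_derivative[symmetric] intro: DERIV_subset)

text \<open>This is half the Beta function at (a+1)/2 and (b+1)/2; see
  \<open>cs_integral_eq\<close>.\<close>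

definition cs_integral :: "nat \<Rightarrow> nat \<Rightarrow> real" where
  "cs_integral a b = integral {0..pi/2} (\<lambda>t. cos t ^ a * sin t ^ b)"

lemma has_integral_cs: "((\<lambda>t. cos t ^ a * sin t ^ b) has_integral cs_integral a b) {0..pi/2}"
  unfolding cs_integral_def
  by (intro integrable_integral integrable_continuous_interval continuous_intros)

lemma cs_integral_split: "cs_integral (a + 2) b + cs_integral a (b + 2) = cs_integral a b"
proof (rule has_integral_unique[OF _ has_integral_cs])
  have "cos t ^ (a+2) * sin t ^ b + cos t ^ a * sin t ^ (b+2) = cos t ^ a * sin t ^ b" for t :: real
  proof -
    have "cos t ^ (a+2) * sin t ^ b + cos t ^ a * sin t ^ (b+2) = cos t ^ a * sin t ^ b * ((sin t)\<^sup>2 + (cos t)\<^sup>2)"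
      by (simp add: power_add distrib_left power2_eq_square mult_ac del: sin_cos_squared_add)
    then show ?thesis by simp
  qed
  then show "((\<lambda>t. cos t ^ a * sin t ^ b) has_integral cs_integral (a + 2) b + cs_integral a (b + 2)) {0..pi/2}"
    using has_integral_add[OF has_integral_cs[of "a+2" b] has_integral_cs[of a "b+2"]] by simp
qed

text \<open>Integrate the derivative of cos^(a+1) sin^(b+1), which vanishes at both ends because
  both exponents are positive.\<close>

lemma cs_integral_parts: "real (a + 1) * cs_integral a (b + 2) = real (b + 1) * cs_integral (a + 2) b"
proof -
  have "((\<lambda>t. cos t ^ (a+1) * sin t ^ (b+1)) has_real_derivative
      real (b+1) * (cos t ^ (a+2) * sin t ^ b) - real (a+1) * (cos t ^ a * sin t ^ (b+2))) (at t)" for t :: real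
    by (rule derivative_eq_intros refl)+ (simp add: algebra_simps power2_eq_square)
  from has_integral_of_derivative[OF _ this, of 0 "pi/2"]
  have "((\<lambda>t. real (b+1) * (cos t ^ (a+2) * sin t ^ b) - real (a+1) * (cos t ^ a * sin t ^ (b+2))) has_integral 0) {0..pi/2}"
    by simp
  moreover have "((\<lambda>t. real (b+1) * (cos t ^ (a+2) * sin t ^ b) - real (a+1) * (cos t ^ a * sin t ^ (b+2)))
     has_integral real (b+1) * cs_integral (a+2) b - real (a+1) * cs_integral a (b+2)) {0..pi/2}"
    by (intro has_integral_diff has_integral_mult_right has_integral_cs)
  ultimately have "real (b+1) * cs_integral (a+2) b - real (a+1) * cs_integral a (b+2) = 0"
    by (rule has_integral_unique[rotated])
  then show ?thesis by linarith
qed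

text \<open>Both recursions come from solving the two linear relations
  \<open>cs_integral_split\<close> and \<open>cs_integral_parts\<close>.\<close>

lemma cs_integral_rec:
  "cs_integral (a + 2) b = real (a + 1) / real (a + b + 2) * cs_integral a b"
  "cs_integral a (b + 2) = real (b + 1) / real (a + b + 2) * cs_integral a b"
proof -
  have eq: "real (a + 1) * (cs_integral a b - cs_integral (a + 2) b) = real (b + 1) * cs_integral (a + 2) b"
  proof -
    have "cs_integral a b - cs_integral (a + 2) b = cs_integral a (b + 2)"
      using cs_integral_split[of a b] by linarith
    then show ?thesis using cs_integral_parts[of a b] by (simp only:)
  qed
  then have "real (a + b + 2) * cs_integral (a + 2) b = real (a + 1) * cs_integral a b"
    by (simp add: algebra_simps)
  then show 1: "cs_integral (a + 2) b = real (a + 1) / real (a + b + 2) * cs_integral a b"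
    by (simp add: field_simps)
  show "cs_integral a (b + 2) = real (b + 1) / real (a + b + 2) * cs_integral a b"
    using cs_integral_split[of a b] unfolding 1 by (simp add: field_simps)
qed

lemma cs_integral_base:
  "cs_integral 0 0 = pi / 2" "cs_integral 1 0 = 1" "cs_integral 0 1 = 1" "cs_integral 1 1 = 1 / 2"
proof -
  show "cs_integral 0 0 = pi / 2" by (simp add: cs_integral_def)
  have "((\<lambda>t. cos t ^ 1 * sin t ^ 0) has_integral sin (pi/2) - sin 0) {0..pi/2}"
    by (intro has_integral_of_derivative) (auto intro!: derivative_eq_intros)
  then show "cs_integral 1 0 = 1" unfolding cs_integral_def by (simp add: integral_unique)
  have "((\<lambda>t. cos t ^ 0 * sin t ^ 1) has_integral - cos (pi/2) - (- cos 0)) {0..pi/2}"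
    by (intro has_integral_of_derivative) (auto intro!: derivative_eq_intros)
  then show "cs_integral 0 1 = 1" unfolding cs_integral_def by (simp add: integral_unique)
  have "((\<lambda>t. cos t ^ 1 * sin t ^ 1) has_integral (sin (pi/2))\<^sup>2 / 2 - (sin 0)\<^sup>2 / 2) {0..pi/2}"
    by (intro has_integral_of_derivative) (auto intro!: derivative_eq_intros)
  then show "cs_integral 1 1 = 1 / 2" unfolding cs_integral_def by (simp add: integral_unique)
qed

lemma Gamma_plus1_pos: "(x::real) > 0 \<Longrightarrow> Gamma (x + 1) = x * Gamma x"
  by (rule Gamma_plus1) (auto elim!: nonpos_Ints_cases)

text \<open>Both sides obey the recursion that lowers one exponent by 2, the right one through
  Gamma(x + 1) = x Gamma(x). This leaves the four cases with both exponents below 2.\<close>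

lemma cs_integral_eq:
  "cs_integral a b = Gamma ((real a + 1) / 2) * Gamma ((real b + 1) / 2) / (2 * Gamma ((real a + real b) / 2 + 1))"
proof (induction "a + b" arbitrary: a b rule: less_induct)
  case less
  have G32: "Gamma (3 / 2 :: real) = sqrt pi / 2"
    using Gamma_plus1_pos[of "1/2"] Gamma_one_half_real by simp
  consider a' where "a = a' + 2" | b' where "b = b' + 2" | "a < 2" "b < 2"
    by (metis add.commute le_Suc_ex not_less)
  then show ?case
  proof cases
    case 1
    define G1 where "G1 = Gamma ((real a' + 1) / 2)"
    define G2 where "G2 = Gamma ((real b + 1) / 2)"
    define G3 where "G3 = Gamma ((real a' + real b) / 2 + 1)"
    have g1: "Gamma ((real a + 1) / 2) = (real a' + 1) / 2 * G1"
      using Gamma_plus1_pos[of "(real a' + 1) / 2"] by (simp add: 1 G1_def field_simps)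
    have g3: "Gamma ((real a + real b) / 2 + 1) = ((real a' + real b) / 2 + 1) * G3"
    proof -
      have "(real a + real b) / 2 + 1 = ((real a' + real b) / 2 + 1) + 1" by (simp add: 1 field_simps)
      then show ?thesis unfolding G3_def by (simp only: Gamma_plus1_pos add_nonneg_pos divide_nonneg_pos add_nonneg_nonneg of_nat_0_le_iff zero_less_one zero_less_numeral)
    qed
    have G3: "G3 > 0" unfolding G3_def by (intro Gamma_real_pos) (simp add: add_nonneg_pos)
    have ih: "cs_integral a' b = G1 * G2 / (2 * G3)"
      using less.hyps[of a' b] by (simp add: 1 G1_def G2_def G3_def mult.commute)
    have gen: "u / v * (G1 * G2 / (2 * G3)) = u / 2 * G1 * G2 / (2 * (v / 2 * G3))" for u v
      by simp
    have "cs_integral a b = real (a' + 1) / real (a' + b + 2) * (G1 * G2 / (2 * G3))"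
      unfolding 1 cs_integral_rec(1) ih ..
    also have "\<dots> = (real a' + 1) / 2 * G1 * G2 / (2 * (((real a' + real b) / 2 + 1) * G3))"
      unfolding gen by (simp add: add_divide_distrib add_ac)
    finally show ?thesis unfolding g1 g3 by (simp add: G2_def mult_ac)
  next
    case 2
    define G1 where "G1 = Gamma ((real b' + 1) / 2)"
    define G2 where "G2 = Gamma ((real a + 1) / 2)"
    define G3 where "G3 = Gamma ((real a + real b') / 2 + 1)"
    have g1: "Gamma ((real b + 1) / 2) = (real b' + 1) / 2 * G1"
      using Gamma_plus1_pos[of "(real b' + 1) / 2"] by (simp add: 2 G1_def field_simps)
    have g3: "Gamma ((real a + real b) / 2 + 1) = ((real a + real b') / 2 + 1) * G3"
    proof -
      have "(real a + real b) / 2 + 1 = ((real a + real b') / 2 + 1) + 1" by (simp add: 2 field_simps)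
      then show ?thesis unfolding G3_def by (simp only: Gamma_plus1_pos add_nonneg_pos divide_nonneg_pos add_nonneg_nonneg of_nat_0_le_iff zero_less_one zero_less_numeral)
    qed
    have G3: "G3 > 0" unfolding G3_def by (intro Gamma_real_pos) (simp add: add_nonneg_pos)
    have ih: "cs_integral a b' = G1 * G2 / (2 * G3)"
      using less.hyps[of a b'] by (simp add: 2 G1_def G2_def G3_def mult.commute)
    have gen: "u / v * (G1 * G2 / (2 * G3)) = u / 2 * G1 * G2 / (2 * (v / 2 * G3))" for u v
      by simp
    have "cs_integral a b = real (b' + 1) / real (a + b' + 2) * (G1 * G2 / (2 * G3))"
      unfolding 2 cs_integral_rec(2) ih ..
    also have "\<dots> = (real b' + 1) / 2 * G1 * G2 / (2 * (((real a + real b') / 2 + 1) * G3))"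
      unfolding gen by (simp add: add_divide_distrib add_ac)
    finally show ?thesis unfolding g1 g3 by (simp add: G2_def mult_ac)
  next
    case 3
    then have "(a = 0 \<or> a = 1) \<and> (b = 0 \<or> b = 1)" by auto
    moreover have "Gamma (2 :: real) = 1" using Gamma_plus1_pos[of 1] by simp
    ultimately show ?thesis
      using cs_integral_base by (auto simp: G32 Gamma_one_half_real)
  qed
qed

section \<open>Integrals over the azimuth\<close>

definition sin_integral :: "nat \<Rightarrow> real" where
  "sin_integral k = integral {0..pi} (\<lambda>t. sin t ^ k)"

lemma has_integral_sin_power: "((\<lambda>t. sin t ^ k) has_integral sin_integral k) {0..pi}"
  unfolding sin_integral_def
  by (intro integrable_integral integrable_continuous_interval continuous_intros)

lemma sin_integral_rec: "sin_integral (k + 2) = real (k + 1) / real (k + 2) * sin_integral k"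
proof -
  have "((\<lambda>t. cos t * sin t ^ (k+1)) has_real_derivative
      real (k+1) * sin t ^ k - real (k+2) * sin t ^ (k+2)) (at t)" for t :: real
  proof -
    have "((\<lambda>t. cos t * sin t ^ (k+1)) has_real_derivative
      real (k+1) * (cos t)\<^sup>2 * sin t ^ k - sin t ^ (k+2)) (at t)"
      by (rule derivative_eq_intros refl)+ (simp add: algebra_simps power2_eq_square)
    moreover have "real (k+1) * (cos t)\<^sup>2 * sin t ^ k - sin t ^ (k+2) = real (k+1) * sin t ^ k - real (k+2) * sin t ^ (k+2)"
      unfolding cos_squared_eq by (simp add: algebra_simps power2_eq_square)
    ultimately show ?thesis by (simp only:)
  qed
  from has_integral_of_derivative[OF _ this, of 0 pi]
  have "((\<lambda>t. real (k+1) * sin t ^ k - real (k+2) * sin t ^ (k+2)) has_integral 0) {0..pi}"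
    by simp
  moreover have "((\<lambda>t. real (k+1) * sin t ^ k - real (k+2) * sin t ^ (k+2))
     has_integral real (k+1) * sin_integral k - real (k+2) * sin_integral (k+2)) {0..pi}"
    by (intro has_integral_diff has_integral_mult_right has_integral_sin_power)
  ultimately have "real (k+1) * sin_integral k - real (k+2) * sin_integral (k+2) = 0"
    by (rule has_integral_unique[rotated])
  then have "real (k+2) * sin_integral (k+2) = real (k+1) * sin_integral k" by linarith
  moreover have "real (k+2) \<noteq> 0" by simp
  ultimately show ?thesis by (metis nonzero_mult_div_cancel_left times_divide_eq_left)
qed

lemma sin_integral_eq: "sin_integral k = sqrt pi * Gamma ((real k + 1) / 2) / Gamma (real k / 2 + 1)"
proof (induction k rule: induct_nat_012)
  case 0 show ?case by (simp add: sin_integral_def Gamma_one_half_real)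
next
  case 1
  have "((\<lambda>t. sin t ^ 1) has_integral - cos pi - (- cos 0)) {0..pi}"
    by (intro has_integral_of_derivative) (auto intro!: derivative_eq_intros)
  then have "sin_integral 1 = 2" unfolding sin_integral_def by (simp add: integral_unique)
  moreover have G32: "Gamma (3 / 2 :: real) = sqrt pi / 2"
    using Gamma_plus1_pos[of "1/2"] Gamma_one_half_real by simp
  moreover have "(real 1 + 1) / 2 = 1" "real 1 / 2 + 1 = 3 / 2" by simp_all
  ultimately have "sin_integral 1 = sqrt pi * Gamma ((real 1 + 1) / 2) / Gamma (real 1 / 2 + 1)"
    by (simp only: Gamma_1) simp
  then show ?case by simp
next
  case (ge2 k)
  define G1 where "G1 = Gamma ((real k + 1) / 2)"
  define G2 where "G2 = Gamma (real k / 2 + 1)"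
  have g1: "Gamma ((real (Suc (Suc k)) + 1) / 2) = (real k + 1) / 2 * G1"
    using Gamma_plus1_pos[of "(k + 1) / 2"] by (simp add: G1_def field_simps)
  have "real (Suc (Suc k)) / 2 + 1 = (real k / 2 + 1) + 1" by (simp add: field_simps)
  then have g2: "Gamma (real (Suc (Suc k)) / 2 + 1) = (real k / 2 + 1) * G2"
    unfolding G2_def by (simp only: Gamma_plus1_pos add_nonneg_pos divide_nonneg_pos of_nat_0_le_iff zero_less_one zero_less_numeral)
  have gen: "u / v * (sqrt pi * G1 / G2) = sqrt pi * (u / 2 * G1) / (v / 2 * G2)" for u v
    by simp
  have "real (k + 1) / real (k + 2) * (sqrt pi * G1 / G2) = sqrt pi * ((real k + 1) / 2 * G1) / ((real k / 2 + 1) * G2)"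
    unfolding gen by (simp add: add_divide_distrib add_ac)
  then show ?case
    unfolding g1 g2 using ge2(1) sin_integral_rec[of k] by (simp add: G1_def G2_def)
qed

text \<open>The antiderivative is sin^(k+1) / (k+1), which is 0 at both ends. This removes the term
  linear in \<gamma> from the double integral for p = 2.\<close>

lemma has_integral_cos_sin_power: "((\<lambda>t. cos t * sin t ^ k) has_integral 0) {0..pi}"
proof -
  have "((\<lambda>t. sin t ^ (k+1)) has_real_derivative real (k+1) * (cos t * sin t ^ k)) (at t)" for t :: real
    by (rule derivative_eq_intros refl)+ (simp add: algebra_simps)
  then have "((\<lambda>t. sin t ^ (k+1) / real (k+1)) has_real_derivative cos t * sin t ^ k) (at t)" for t :: real
    using DERIV_cdivide[of "\<lambda>t. sin t ^ (k+1)" "real (k+1) * (cos t * sin t ^ k)" t UNIV "real (k+1)"] by simp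
  from has_integral_of_derivative[OF _ this, of 0 pi] show ?thesis by simp
qed

text \<open>For k = n - 3 the factor 1 / (k + 2) is 1 / (n - 1); it damps the term with \<gamma>^2
  and so makes \<gamma> = 0 optimal.\<close>

lemma has_integral_cos2_sin_power:
  "((\<lambda>t. (cos t)\<^sup>2 * sin t ^ k) has_integral sin_integral k / real (k + 2)) {0..pi}"
proof -
  have "sin_integral k - sin_integral (k + 2) = sin_integral k / real (k + 2)"
    unfolding sin_integral_rec by (simp add: field_simps)
  moreover have "((\<lambda>t. sin t ^ k - sin t ^ (k + 2)) has_integral sin_integral k - sin_integral (k + 2)) {0..pi}"
    by (intro has_integral_diff has_integral_sin_power)
  moreover have "(cos t)\<^sup>2 * sin t ^ k = sin t ^ k - sin t ^ (k + 2)" for t :: real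
    unfolding cos_squared_eq by (simp add: algebra_simps power2_eq_square)
  ultimately show ?thesis by (simp only:)
qed

lemma sphere_area_pos: "n > 0 \<Longrightarrow> sphere_area n > 0"
  by (simp add: sphere_area_def)

lemma Gamma_legendre_duplication_real:
  fixes x :: real
  assumes "x > 0"
  shows "Gamma x * Gamma (x + 1/2) = 2 powr (1 - 2 * x) * sqrt pi * Gamma (2 * x)"
proof -
  have np: "complex_of_real y \<notin> \<int>\<^sub>\<le>\<^sub>0" if "y > 0" for y
    using that by (auto elim!: nonpos_Ints_cases simp: complex_eq_iff)
  have "complex_of_real (Gamma x * Gamma (x + 1/2)) = Gamma (complex_of_real x) * Gamma (complex_of_real x + 1/2)"
    using Gamma_complex_of_real[of "x + 1/2"] by (simp add: Gamma_complex_of_real)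
  also have "\<dots> = exp ((1 - 2 * complex_of_real x) * of_real (ln 2)) * of_real (sqrt pi) * Gamma (2 * complex_of_real x)"
    using np[of x] np[of "x + 1/2"] assms by (intro Gamma_legendre_duplication) auto
  also have "\<dots> = complex_of_real (2 powr (1 - 2 * x) * sqrt pi * Gamma (2 * x))"
    using Gamma_complex_of_real[of "2 * x"] by (simp add: powr_def flip: exp_of_real)
  finally show ?thesis by (simp only: of_real_eq_iff)
qed

text \<open>For n = k + 3 two of the Gamma factors cancel, and what remains, Gamma(n/2)
  Gamma((n+1)/2), collapses by duplication to 2^(1-n) sqrt(pi) Gamma(n). This is the origin of 2^n
  in the constant for p = 2.\<close>

lemma sphere_area_trig_product:
  "sphere_area (k + 1) * (sin_integral k * cs_integral (k + 3) (k + 1)) = sphere_area (k + 3) / 2 ^ (k + 3)"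
proof -
  let ?g1 = "Gamma ((real k + 1) / 2)" and ?g2 = "Gamma ((real k + 2) / 2)" and ?g3 = "Gamma ((real k + 3) / 2)"
  have pos: "?g1 > 0" "?g2 > 0" "?g3 > 0" "Gamma (real k + 3) > 0"
    by (intro Gamma_real_pos; simp)+
  have 1: "sphere_area (k + 1) = 2 * pi powr ((real k + 1) / 2) / ?g1"
    by (subst sphere_area_eq_Gamma) (auto simp: add_ac)
  have 3: "sphere_area (k + 3) = 2 * pi powr ((real k + 3) / 2) / ?g3"
    by (subst sphere_area_eq_Gamma) (auto simp: add_ac)
  have s: "sin_integral k = sqrt pi * ?g1 / ?g2"
    by (simp add: sin_integral_eq add_divide_distrib)
  have e: "(real (k + 3) + real (k + 1)) / 2 + 1 = real k + 3" "(real (k + 3) + 1) / 2 = (real k + 3) / 2 + 1/2"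
    "(real (k + 1) + 1) / 2 = (real k + 2) / 2"
    by (simp_all add: field_simps)
  have c: "cs_integral (k + 3) (k + 1) = Gamma ((real k + 3) / 2 + 1/2) * ?g2 / (2 * Gamma (real k + 3))"
    unfolding cs_integral_eq e ..
  have dup: "?g3 * Gamma ((real k + 3) / 2 + 1/2) = 2 powr (1 - (real k + 3)) * sqrt pi * Gamma (real k + 3)"
  proof -
    have "2 * ((real k + 3) / 2) = real k + 3" "(real k + 3) / 2 > 0" by simp_all
    then show ?thesis using Gamma_legendre_duplication_real[of "(real k + 3) / 2"] by (simp only:)
  qed
  have p: "pi powr ((real k + 3) / 2) = pi powr ((real k + 1) / 2) * pi"
  proof -
    have "(real k + 3) / 2 = (real k + 1) / 2 + 1" by (simp add: field_simps)
    then show ?thesis by (simp only: powr_add powr_one pi_ge_zero)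
  qed
  have t: "2 powr (1 - (real k + 3)) = 2 / 2 ^ (k + 3)"
  proof -
    have "2 powr (1 - (real k + 3)) = 2 powr (1 - real (k + 3))" by simp
    also have "\<dots> = 2 powr 1 / 2 powr real (k + 3)" by (simp only: powr_diff)
    also have "\<dots> = 2 / 2 ^ (k + 3)" by (subst powr_realpow) auto
    finally show ?thesis .
  qed
  have "sphere_area (k + 1) * (sin_integral k * cs_integral (k + 3) (k + 1))
     = pi powr ((real k + 1) / 2) * sqrt pi * (?g3 * Gamma ((real k + 3) / 2 + 1/2)) / (Gamma (real k + 3) * ?g3)"
  proof -
    have gen: "2 * P / g1 * (s * g1 / g2 * (h * g2 / (2 * G))) = P * s * (g3 * h) / (G * g3)"
      if "g1 \<noteq> 0" "g2 \<noteq> 0" "g3 \<noteq> 0" "G \<noteq> 0" for P s g1 g2 g3 h G :: real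
      using that by simp
    show ?thesis unfolding 1 s c by (rule gen) (metis pos less_irrefl)+
  qed
  also have "\<dots> = pi powr ((real k + 1) / 2) * (sqrt pi * sqrt pi) * (2 / 2 ^ (k + 3)) / ?g3"
  proof -
    have gen: "P * s * (c * s * G) / (G * g) = P * (s * s) * c / g" if "G \<noteq> 0" for P s c G g :: real
      using that by simp
    show ?thesis unfolding dup t by (rule gen) (metis pos(4) less_irrefl)
  qed
  also have "\<dots> = sphere_area (k + 3) / 2 ^ (k + 3)"
    unfolding 3 p by (simp add: mult_ac)
  finally show ?thesis .
qed

section \<open>The double integral and its maximum for p = 2\<close>

lemma F_integrand_two:
  assumes n: "n = k + 3" and "t \<in> {0..pi/2}"
  shows "F_integrand n 2 \<phi> t \<gamma> =
    (((n * (cos t)\<^sup>2 - 1) + n * \<gamma> * cos t * sin t * cos \<phi>)\<^sup>2 * cos t ^ n * sin t ^ (k + 1)) * sin \<phi> ^ k"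
proof -
  have "cos t \<ge> 0" using assms by (intro cos_ge_zero) auto
  \<comment> \<open>At t = pi/2 the cosine is 0, where \<open>powr\<close> and the natural power
    agree because n is positive.\<close>
  then have "cos t powr real n = cos t ^ n"
    using n powr_realpow[of "cos t" n] by (cases "cos t = 0") auto
  then show ?thesis using assms by (simp add: F_integrand_def)
qed

text \<open>Expanding the square gives a quadratic in \<gamma> cos \<phi>. The decisive coincidence
  is that its constant and its quadratic coefficient have the same \<theta>-integral
  \<open>A\<close>, equal to n(n-1)/4 times the integral of cos^n sin^(n-2) (\<open>A1\<close> and
  \<open>C1\<close>). The middle coefficient \<open>B\<close> can stay unevaluated, since it meets
  the vanishing integral of cos \<phi> sin^k \<phi>.\<close>

lemma integral_F_integrand_two:
  fixes \<gamma> :: real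
  assumes n_def: "n = k + 3"
  shows "integral {0..pi} (\<lambda>\<phi>. integral {0..pi/2} (\<lambda>t. F_integrand n 2 \<phi> t \<gamma>)) =
     sin_integral k * cs_integral n (k + 1) * (real n * (real n - 1) / 4) * (1 + \<gamma>\<^sup>2 / (real n - 1))"
proof -
  define W where "W = cs_integral n (k + 1)"
  define A where "A = W * (real n * (real n - 1) / 4)"
  define B where "B = 2 * n * (n * cs_integral (n+3) (k+2) - cs_integral (n+1) (k+2))"
  have n0: "real n > 0" by (simp add: n_def)
  have W2: "cs_integral (n + 2) (k + 1) = real (n + 1) / (2 * real n) * W"
    unfolding cs_integral_rec(1) W_def by (simp add: n_def field_simps)
  have W4: "cs_integral (n + 4) (k + 1) = real (n + 3) / (4 * real n) * W"
  proof -
    have *: "a / (2 * N + 2) * ((N + 1) / (2 * N) * W) = a / (4 * N) * W" if "N > 0" for a N :: real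
    proof -
      have gen: "a / (2 * M) * (M / (2 * N) * W) = a / (4 * N) * W" if "M \<noteq> 0" for M
        using that by simp
      show ?thesis using gen[of "N + 1"] that by (simp add: distrib_left)
    qed
    have "cs_integral (n + 4) (k + 1) = real (n + 3) / real (2 * n + 2) * cs_integral (n + 2) (k + 1)"
      using cs_integral_rec(1)[of "n+2" "k+1"] by (simp add: n_def numeral_eq_Suc)
    then show ?thesis unfolding W2 using *[of "real n" "real (n + 3)"] n0 by (simp add: add_ac)
  qed
  have A1: "n^2 * cs_integral (n+4) (k+1) - 2 * n * cs_integral (n+2) (k+1) + W = A"
    unfolding W2 W4 A_def using n0 by (simp add: field_simps power2_eq_square)
  have C1: "n^2 * cs_integral (n+2) (k+3) = A"
  proof -
    have "cs_integral (n+2) (k+3) = cs_integral (n+2) (k+1) - cs_integral (n+4) (k+1)"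
      using cs_integral_split[of "n+2" "k+1"] by (simp add: numeral_eq_Suc)
    then show ?thesis unfolding W2 W4 A_def using n0 by (simp add: field_simps power2_eq_square)
  qed
  have inner: "integral {0..pi/2} (\<lambda>t. F_integrand n 2 \<phi> t \<gamma>) =
      (A + \<gamma> * cos \<phi> * B + \<gamma>\<^sup>2 * (cos \<phi>)\<^sup>2 * A) * sin \<phi> ^ k" for \<phi>
  proof -
    have "((\<lambda>t. (n^2 * (cos t ^ (n+4) * sin t ^ (k+1)) - 2 * n * (cos t ^ (n+2) * sin t ^ (k+1)) + cos t ^ n * sin t ^ (k+1)
       + \<gamma> * cos \<phi> * (2 * n * (n * (cos t ^ (n+3) * sin t ^ (k+2)) - cos t ^ (n+1) * sin t ^ (k+2)))
       + \<gamma>\<^sup>2 * (cos \<phi>)\<^sup>2 * (n^2 * (cos t ^ (n+2) * sin t ^ (k+3)))) * sin \<phi> ^ k) has_integral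
       (n^2 * cs_integral (n+4) (k+1) - 2 * n * cs_integral (n+2) (k+1) + cs_integral n (k+1)
       + \<gamma> * cos \<phi> * (2 * n * (n * cs_integral (n+3) (k+2) - cs_integral (n+1) (k+2)))
       + \<gamma>\<^sup>2 * (cos \<phi>)\<^sup>2 * (n^2 * cs_integral (n+2) (k+3))) * sin \<phi> ^ k) {0..pi/2}"
      by (intro has_integral_add has_integral_diff has_integral_mult_right has_integral_mult_left has_integral_cs)
    moreover have "n^2 * (cos t ^ (n+4) * sin t ^ (k+1)) - 2 * n * (cos t ^ (n+2) * sin t ^ (k+1)) + cos t ^ n * sin t ^ (k+1)
       + \<gamma> * cos \<phi> * (2 * n * (n * (cos t ^ (n+3) * sin t ^ (k+2)) - cos t ^ (n+1) * sin t ^ (k+2)))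
       + \<gamma>\<^sup>2 * (cos \<phi>)\<^sup>2 * (n^2 * (cos t ^ (n+2) * sin t ^ (k+3))) =
       ((n * (cos t)\<^sup>2 - 1) + n * \<gamma> * cos t * sin t * cos \<phi>)\<^sup>2 * cos t ^ n * sin t ^ (k + 1)" for t
      by (simp add: power_add numeral_eq_Suc) algebra
    ultimately have "((\<lambda>t. (((real n * (cos t)\<^sup>2 - 1) + real n * \<gamma> * cos t * sin t * cos \<phi>)\<^sup>2 * cos t ^ n * sin t ^ (k + 1)) * sin \<phi> ^ k)
       has_integral (A + \<gamma> * cos \<phi> * B + \<gamma>\<^sup>2 * (cos \<phi>)\<^sup>2 * A) * sin \<phi> ^ k) {0..pi/2}"
      by (simp only: C1 A1[unfolded W_def] B_def[symmetric])
    then have "((\<lambda>t. F_integrand n 2 \<phi> t \<gamma>) has_integral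
       (A + \<gamma> * cos \<phi> * B + \<gamma>\<^sup>2 * (cos \<phi>)\<^sup>2 * A) * sin \<phi> ^ k) {0..pi/2}"
      by (rule has_integral_eq[rotated]) (simp only: F_integrand_two[OF n_def])
    then show ?thesis by (rule integral_unique)
  qed
  have "((\<lambda>\<phi>. A * sin \<phi> ^ k + \<gamma> * B * (cos \<phi> * sin \<phi> ^ k) + \<gamma>\<^sup>2 * A * ((cos \<phi>)\<^sup>2 * sin \<phi> ^ k)) has_integral
     A * sin_integral k + \<gamma> * B * 0 + \<gamma>\<^sup>2 * A * (sin_integral k / real (k + 2))) {0..pi}"
    by (intro has_integral_add has_integral_mult_right has_integral_sin_power
        has_integral_cos_sin_power has_integral_cos2_sin_power)
  moreover have "A * sin \<phi> ^ k + \<gamma> * B * (cos \<phi> * sin \<phi> ^ k) + \<gamma>\<^sup>2 * A * ((cos \<phi>)\<^sup>2 * sin \<phi> ^ k) =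
     (A + \<gamma> * cos \<phi> * B + \<gamma>\<^sup>2 * (cos \<phi>)\<^sup>2 * A) * sin \<phi> ^ k" for \<phi>
    by (simp add: algebra_simps)
  ultimately have "integral {0..pi} (\<lambda>\<phi>. integral {0..pi/2} (\<lambda>t. F_integrand n 2 \<phi> t \<gamma>)) =
     A * sin_integral k + \<gamma>\<^sup>2 * A * (sin_integral k / real (k + 2))"
    unfolding inner by (simp add: integral_unique)
  also have "\<dots> = sin_integral k * W * (real n * (real n - 1) / 4) * (1 + \<gamma>\<^sup>2 / (real n - 1))"
    by (simp add: A_def n_def field_simps)
  finally show ?thesis unfolding W_def .
qed

lemma cs_integral_nonneg: "cs_integral a b \<ge> 0"
  unfolding cs_integral_def
  by (intro integral_nonneg integrable_continuous_interval continuous_intros mult_nonneg_nonneg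
      zero_le_power) (auto intro: cos_ge_zero sin_ge_zero)

lemma sin_integral_nonneg: "sin_integral k \<ge> 0"
  unfolding sin_integral_def
  by (intro integral_nonneg integrable_continuous_interval continuous_intros zero_le_power)
     (auto intro: sin_ge_zero)

text \<open>The maximum lies at \<gamma> = 0 because 1 + \<gamma>^2/(n-1) <= 1 + \<gamma>^2, and the
  right side is what the prefactor 1/sqrt(1 + \<gamma>^2) compensates. The second claim records the
  value at \<gamma> = 0, the normal direction; the sharpness for the normal derivative rests on
  it.\<close>

lemma grad_const_two:
  assumes "n \<ge> 3"
  shows "grad_const n 2 = sqrt (real n * (real n - 1) / (2 ^ n * sphere_area n))" (is ?A)
    and "grad_const n 2 = 2 * sphere_area (n - 2) powr ((2 - 1) / 2) / sphere_area n *
      (integral {0..pi} (\<lambda>\<phi>. integral {0..pi / 2} (\<lambda>\<theta>. F_integrand n 2 \<phi> \<theta> 0))) powr ((2 - 1) / 2)" (is ?B)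
proof -
  obtain k where k: "n = k + 3" using assms by (metis add.commute le_Suc_ex)
  define T where "T = sin_integral k * cs_integral n (k + 1) * (real n * (real n - 1) / 4)"
  have T0: "T \<ge> 0" using assms by (auto simp: T_def intro!: mult_nonneg_nonneg sin_integral_nonneg cs_integral_nonneg)
  have J: "integral {0..pi} (\<lambda>\<phi>. integral {0..pi/2} (\<lambda>t. F_integrand n 2 \<phi> t \<gamma>)) = T * (1 + \<gamma>\<^sup>2 / (real n - 1))" for \<gamma>
    using integral_F_integrand_two[of n k \<gamma>] by (simp add: T_def k)
  have J0: "integral {0..pi} (\<lambda>\<phi>. integral {0..pi/2} (\<lambda>t. F_integrand n 2 \<phi> t 0)) = T"
    using J[of 0] by simp
  have le: "1 / sqrt (1 + \<gamma>\<^sup>2) * (T * (1 + \<gamma>\<^sup>2 / (real n - 1))) powr ((2 - 1) / 2) \<le> T powr ((2 - 1) / 2)" for \<gamma> :: real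
  proof -
    have p1: "1 + \<gamma>\<^sup>2 > 0" by (simp add: add_pos_nonneg)
    have "T * (1 + \<gamma>\<^sup>2 / (real n - 1)) \<le> T * (1 + \<gamma>\<^sup>2)"
      using T0 assms by (intro mult_left_mono) (auto simp: divide_le_eq_1 k field_simps)
    then have "sqrt (T * (1 + \<gamma>\<^sup>2 / (real n - 1))) \<le> sqrt T * sqrt (1 + \<gamma>\<^sup>2)"
      by (simp flip: real_sqrt_mult)
    moreover have "T * (1 + \<gamma>\<^sup>2 / (real n - 1)) \<ge> 0"
      using T0 assms by (intro mult_nonneg_nonneg add_nonneg_nonneg divide_nonneg_nonneg) auto
    ultimately have "(T * (1 + \<gamma>\<^sup>2 / (real n - 1))) powr ((2 - 1) / 2) \<le> T powr ((2 - 1) / 2) * sqrt (1 + \<gamma>\<^sup>2)"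
      using T0 by (simp add: powr_half_sqrt)
    then show ?thesis using p1 by (simp add: divide_le_eq)
  qed
  have sup: "(SUP \<gamma>\<in>{0..}. 1 / sqrt (1 + \<gamma> ^ 2) *
      (integral {0..pi} (\<lambda>\<phi>. integral {0..pi / 2} (\<lambda>\<theta>. F_integrand n 2 \<phi> \<theta> \<gamma>))) powr ((2 - 1) / 2)) = T powr ((2 - 1) / 2)"
    unfolding J
  proof (rule cSup_eq_maximum)
    show "T powr ((2 - 1) / 2) \<in> (\<lambda>\<gamma>. 1 / sqrt (1 + \<gamma>\<^sup>2) * (T * (1 + \<gamma>\<^sup>2 / (real n - 1))) powr ((2 - 1) / 2)) ` {0..}"
      by (rule image_eqI[of _ _ 0]) auto
  qed (use le in blast)
  show ?B unfolding grad_const_def sup J0 by simp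
  then have "grad_const n 2 = 2 / sphere_area n * (sphere_area (n - 2) * T) powr (1/2)"
    unfolding J0 using T0 by (simp add: powr_mult sphere_area_def)
  also have "sphere_area (n - 2) * T = sphere_area n / 2 ^ n * (real n * (real n - 1) / 4)"
    using sphere_area_trig_product[of k] by (simp add: T_def k mult.assoc[symmetric])
  also have "2 / sphere_area n * (sphere_area n / 2 ^ n * (real n * (real n - 1) / 4)) powr (1/2) = sqrt ((2 / sphere_area n)\<^sup>2 * (sphere_area n / 2 ^ n * (real n * (real n - 1) / 4)))"
  proof -
    have "sphere_area n / 2 ^ n * (real n * (real n - 1) / 4) \<ge> 0"
      using sphere_area_pos[of n] assms by simp
    then show ?thesis
      using sphere_area_pos[of n] assms by (simp only: powr_half_sqrt real_sqrt_mult) simp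
  qed
  also have "(2 / sphere_area n)\<^sup>2 * (sphere_area n / 2 ^ n * (real n * (real n - 1) / 4)) = real n * (real n - 1) / (2 ^ n * sphere_area n)"
    using sphere_area_pos[of n] assms by (simp add: field_simps power2_eq_square)
  finally show ?A .
qed

subsection \<open>Derivatives of Poisson integrals\<close>

lemma isCont_lebesgue_integral:
  fixes k :: "'a::metric_space \<Rightarrow> 'b \<Rightarrow> 'c::{banach, second_countable_topology}"
  assumes r: "r > 0"
    and meas: "\<And>x. x \<in> ball x0 r \<Longrightarrow> k x \<in> borel_measurable M"
    and cont: "\<And>y. y \<in> space M \<Longrightarrow> isCont (\<lambda>x. k x y) x0"
    and bound: "\<And>x y. x \<in> ball x0 r \<Longrightarrow> y \<in> space M \<Longrightarrow> norm (k x y) \<le> G y"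
    and G: "integrable M G"
  shows "isCont (\<lambda>x. integral\<^sup>L M (k x)) x0"
  unfolding isCont_def tendsto_at_iff_sequentially
proof (intro allI impI, unfold comp_def)
  fix X assume X: "X \<longlonglongrightarrow> x0"
  have x0: "x0 \<in> ball x0 r" using r by simp
  have ev: "\<forall>\<^sub>F i in sequentially. X i \<in> ball x0 r"
    using X r by (auto simp: tendsto_iff dist_commute)
  \<comment> \<open>The sequence may start outside the ball, where neither measurability nor the
    bound is assumed; those members are replaced by the limit function.\<close>
  define s where "s i y = (if X i \<in> ball x0 r then k (X i) y else k x0 y)" for i y
  have "(\<lambda>i. integral\<^sup>L M (s i)) \<longlonglongrightarrow> integral\<^sup>L M (k x0)"
  proof (rule integral_dominated_convergence[where w = G])
    show "s i \<in> borel_measurable M" for i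
      using meas[OF x0] meas[of "X i"] by (cases "X i \<in> ball x0 r") (simp_all add: s_def[abs_def])
    show "AE y in M. (\<lambda>i. s i y) \<longlonglongrightarrow> k x0 y"
    proof (rule AE_I2)
      fix y assume "y \<in> space M"
      from cont[OF this] X have "(\<lambda>i. k (X i) y) \<longlonglongrightarrow> k x0 y"
        by (rule isCont_tendsto_compose)
      then show "(\<lambda>i. s i y) \<longlonglongrightarrow> k x0 y"
        by (rule Lim_transform_eventually) (use ev in \<open>auto elim!: eventually_mono simp: s_def\<close>)
    qed
    show "AE y in M. norm (s i y) \<le> G y" for i
      using bound[OF x0] bound[of "X i"] by (intro AE_I2) (simp add: s_def)
  qed (use G meas x0 in auto)
  then show "(\<lambda>i. integral\<^sup>L M (k (X i))) \<longlonglongrightarrow> integral\<^sup>L M (k x0)"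
    by (rule Lim_transform_eventually) (use ev in \<open>auto elim!: eventually_mono simp: s_def[abs_def]\<close>)
qed

text \<open>The remainder of the linear approximation, divided by the length of the increment, tends
  to 0 pointwise. It is dominated by \<open>2 * G\<close>: one \<open>G\<close> from the mean value
  inequality on the convex ball, one from the derivative itself.\<close>

lemma has_derivative_lebesgue_integral:
  fixes k :: "'a::real_normed_vector \<Rightarrow> 'b \<Rightarrow> 'c::{banach, second_countable_topology}"
  assumes r: "r > 0"
    and int: "\<And>x. x \<in> ball x0 r \<Longrightarrow> integrable M (k x)"
    and der: "\<And>x y. x \<in> ball x0 r \<Longrightarrow> y \<in> space M \<Longrightarrow> ((\<lambda>x. k x y) has_derivative k' x y) (at x)"
    and bound: "\<And>x y h. x \<in> ball x0 r \<Longrightarrow> y \<in> space M \<Longrightarrow> norm (k' x y h) \<le> G y * norm h"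
    and G: "integrable M G"
    and meas: "\<And>h. (\<lambda>y. k' x0 y h) \<in> borel_measurable M"
  shows "((\<lambda>x. integral\<^sup>L M (k x)) has_derivative (\<lambda>h. LINT y|M. k' x0 y h)) (at x0)"
proof -
  have x0: "x0 \<in> ball x0 r" using r by simp
  have lin: "bounded_linear (k' x0 y)" if "y \<in> space M" for y
    using der[OF x0 that] by (rule has_derivative_bounded_linear)
  have intk': "integrable M (\<lambda>y. k' x0 y h)" for h
  proof (rule Bochner_Integration.integrable_bound)
    show "integrable M (\<lambda>y. G y * norm h)" using G by simp
    show "AE y in M. norm (k' x0 y h) \<le> norm (G y * norm h)"
      using bound[OF x0] by (intro AE_I2) (metis abs_ge_self order_trans real_norm_def)
  qed (rule meas)
  have bl: "bounded_linear (\<lambda>h. LINT y|M. k' x0 y h)"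
  proof (rule bounded_linear_intro[where K = "integral\<^sup>L M G"])
    show "(LINT y|M. k' x0 y (h + h')) = (LINT y|M. k' x0 y h) + (LINT y|M. k' x0 y h')" for h h'
    proof -
      have "(LINT y|M. k' x0 y (h + h')) = (LINT y|M. k' x0 y h + k' x0 y h')"
        by (rule Bochner_Integration.integral_cong) (auto simp: linear_add[OF bounded_linear.linear[OF lin]])
      then show ?thesis by (simp add: intk')
    qed
    show "(LINT y|M. k' x0 y (c *\<^sub>R h)) = c *\<^sub>R (LINT y|M. k' x0 y h)" for c h
    proof -
      have "(LINT y|M. k' x0 y (c *\<^sub>R h)) = (LINT y|M. c *\<^sub>R k' x0 y h)"
        by (rule Bochner_Integration.integral_cong) (auto simp: linear_scale[OF bounded_linear.linear[OF lin]])
      then show ?thesis by simp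
    qed
    show "norm (LINT y|M. k' x0 y h) \<le> norm h * integral\<^sup>L M G" for h
    proof -
      have "norm (LINT y|M. k' x0 y h) \<le> (LINT y|M. G y * norm h)"
        using intk' G bound[OF x0] by (intro order_trans[OF integral_norm_bound] integral_mono) auto
      then show ?thesis by (simp add: mult.commute)
    qed
  qed
  show ?thesis
    unfolding has_derivative_at_within
  proof (intro conjI bl, unfold tendsto_at_iff_sequentially, intro allI impI, unfold comp_def)
    fix X :: "nat \<Rightarrow> 'a"
    assume X0: "\<forall>i. X i \<in> UNIV - {x0}" and X: "X \<longlonglongrightarrow> x0"
    have ev: "\<forall>\<^sub>F i in sequentially. X i \<in> ball x0 r"
      using X r by (auto simp: tendsto_iff dist_commute)
    \<comment> \<open>Outside the ball the quotient is set to 0, which is trivially dominated; only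
      finitely many members are affected.\<close>
    define s where "s i y = (if X i \<in> ball x0 r
      then ((k (X i) y - k x0 y) - k' x0 y (X i - x0)) /\<^sub>R norm (X i - x0) else 0)" for i y
    have "(\<lambda>i. integral\<^sup>L M (s i)) \<longlonglongrightarrow> integral\<^sup>L M (\<lambda>y. 0)"
    proof (rule integral_dominated_convergence[where w = "\<lambda>y. 2 * G y"])
      show "s i \<in> borel_measurable M" for i
        using int[OF x0] int[of "X i"] meas
        by (cases "X i \<in> ball x0 r") (auto simp: s_def[abs_def] simp del: mem_ball)
      show "AE y in M. (\<lambda>i. s i y) \<longlonglongrightarrow> 0"
      proof (rule AE_I2)
        fix y assume y: "y \<in> space M"
        have "((\<lambda>x. ((k x y - k x0 y) - k' x0 y (x - x0)) /\<^sub>R norm (x - x0)) \<longlongrightarrow> 0) (at x0)"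
          using der[OF x0 y] by (simp add: has_derivative_at_within)
        then have "(\<lambda>i. ((k (X i) y - k x0 y) - k' x0 y (X i - x0)) /\<^sub>R norm (X i - x0)) \<longlonglongrightarrow> 0"
          using X X0 unfolding tendsto_at_iff_sequentially comp_def by blast
        then show "(\<lambda>i. s i y) \<longlonglongrightarrow> 0"
          by (rule Lim_transform_eventually) (use ev in \<open>auto elim!: eventually_mono simp: s_def\<close>)
      qed
      show "AE y in M. norm (s i y) \<le> 2 * G y" for i
      proof (rule AE_I2)
        fix y assume y: "y \<in> space M"
        have ne: "norm (X i - x0) > 0" using X0 by simp
        have G0: "0 \<le> G y"
          using order_trans[OF norm_ge_zero bound[OF x0 y, of "X i - x0"]] ne by (simp add: zero_le_mult_iff)
        show "norm (s i y) \<le> 2 * G y"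
        proof (cases "X i \<in> ball x0 r")
          case True
          have "norm (k (X i) y - k x0 y) \<le> G y * norm (X i - x0)"
          proof (rule differentiable_bound[OF convex_ball])
            show "((\<lambda>x. k x y) has_derivative k' x y) (at x within ball x0 r)" if "x \<in> ball x0 r" for x
              using der[OF that y] by (rule has_derivative_at_withinI)
            show "onorm (k' x y) \<le> G y" if "x \<in> ball x0 r" for x
              using bound[OF that y] by (intro onorm_bound G0)
          qed (use True x0 in auto)
          then have "norm ((k (X i) y - k x0 y) - k' x0 y (X i - x0)) \<le> G y * norm (X i - x0) + G y * norm (X i - x0)"
            using bound[OF x0 y, of "X i - x0"]
              norm_triangle_ineq4[of "k (X i) y - k x0 y" "k' x0 y (X i - x0)"] by linarith
          moreover have "norm (s i y) = norm ((k (X i) y - k x0 y) - k' x0 y (X i - x0)) / norm (X i - x0)"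
            using True by (simp add: s_def divide_inverse mult.commute)
          ultimately show ?thesis using ne by (simp add: pos_divide_le_eq)
        qed (use G0 in \<open>simp add: s_def\<close>)
      qed
    qed (use G in auto)
    then have "(\<lambda>i. integral\<^sup>L M (s i)) \<longlonglongrightarrow> 0" by simp
    then show "(\<lambda>i. ((integral\<^sup>L M (k (X i)) - integral\<^sup>L M (k x0)) - (LINT y|M. k' x0 y (X i - x0))) /\<^sub>R norm (X i - x0)) \<longlonglongrightarrow> 0"
    proof (rule Lim_transform_eventually)
      show "\<forall>\<^sub>F i in sequentially. integral\<^sup>L M (s i) =
        ((integral\<^sup>L M (k (X i)) - integral\<^sup>L M (k x0)) - (LINT y|M. k' x0 y (X i - x0))) /\<^sub>R norm (X i - x0)"
        using ev
      proof eventually_elim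
        case (elim i)
        then show ?case
          using int[OF x0] int[OF elim] intk'[of "X i - x0"] by (simp add: s_def[abs_def])
      qed
    qed
  qed
qed

section \<open>The kernel, its gradient and its Hessian\<close>

lemma has_derivative_inverse_norm_power:
  fixes v :: "'a::real_inner"
  assumes "v \<noteq> 0"
  shows "((\<lambda>v. 1 / norm v ^ j) has_derivative (\<lambda>h. - real j * (v \<bullet> h) / norm v ^ (j + 2))) (at v)"
proof -
  have "((\<lambda>v. 1 / norm v ^ j) has_derivative
      (\<lambda>h. - (real j * (h \<bullet> sgn v) * norm v ^ (j - 1)) / (norm v ^ j * norm v ^ j))) (at v)"
    using assms by (auto intro!: derivative_eq_intros has_derivative_norm)
  moreover have "- (real j * (h \<bullet> sgn v) * norm v ^ (j - 1)) / (norm v ^ j * norm v ^ j) =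
      - real j * (v \<bullet> h) / norm v ^ (j + 2)" for h
    using assms by (cases j) (simp_all add: sgn_div_norm inner_commute field_simps power2_eq_square)
  ultimately show ?thesis by simp
qed

text \<open>The Poisson kernel of the half space is \<open>2 / \<omega>\<^sub>n\<close> times the following function of \<open>v = x - (y, 0)\<close>;
  note that \<open>snd v = snd x\<close>.\<close>

definition pker :: "nat \<Rightarrow> 'a::euclidean_space \<times> real \<Rightarrow> real" where
  "pker n v = snd v / norm v ^ n"

definition pker_grad :: "nat \<Rightarrow> 'a::euclidean_space \<times> real \<Rightarrow> 'a \<times> real" where
  "pker_grad n v = (1 / norm v ^ n) *\<^sub>R (0, 1) - (n * snd v / norm v ^ (n + 2)) *\<^sub>R v"

definition pker_hess :: "nat \<Rightarrow> 'a::euclidean_space \<times> real \<Rightarrow> 'a \<times> real \<Rightarrow> 'a \<times> real" where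
  "pker_hess n v h =
     (- real n * (v \<bullet> h) / norm v ^ (n + 2)) *\<^sub>R (0, 1)
     - ((n * snd h / norm v ^ (n + 2) - real n * (real n + 2) * snd v * (v \<bullet> h) / norm v ^ (n + 4)) *\<^sub>R v
        + (n * snd v / norm v ^ (n + 2)) *\<^sub>R h)"

lemma pker_has_derivative:
  assumes "v \<noteq> 0"
  shows "(pker n has_derivative (\<lambda>h. h \<bullet> pker_grad n v)) (at v)"
proof -
  have "((\<lambda>v. snd v * (1 / norm v ^ n)) has_derivative
      (\<lambda>h. snd v * (- real n * (v \<bullet> h) / norm v ^ (n + 2)) + snd h * (1 / norm v ^ n))) (at v)"
    by (intro has_derivative_mult has_derivative_inverse_norm_power[OF assms])
       (auto intro!: derivative_eq_intros)
  moreover have "snd v * (- real n * (v \<bullet> h) / norm v ^ (n + 2)) + snd h * (1 / norm v ^ n) = h \<bullet> pker_grad n v" for h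
  proof -
    have "h \<bullet> (0, 1) = snd h" by (cases h) simp
    then show ?thesis
      by (simp add: pker_grad_def inner_diff_right inner_commute[of h v] mult_ac del: scaleR_Pair)
  qed
  ultimately show ?thesis unfolding pker_def[abs_def] by simp
qed

lemma pker_grad_has_derivative:
  assumes "v \<noteq> 0"
  shows "(pker_grad n has_derivative pker_hess n v) (at v)"
proof -
  have d: "((\<lambda>v. real n * snd v / norm v ^ (n + 2)) has_derivative
      (\<lambda>h. n * snd h / norm v ^ (n + 2) - real n * (real n + 2) * snd v * (v \<bullet> h) / norm v ^ (n + 4))) (at v)"
  proof -
    have "((\<lambda>v. (real n * snd v) * (1 / norm v ^ (n + 2))) has_derivative
      (\<lambda>h. (real n * snd v) * (- real (n + 2) * (v \<bullet> h) / norm v ^ (n + 2 + 2)) + (real n * snd h) * (1 / norm v ^ (n + 2)))) (at v)"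
      by (intro has_derivative_mult has_derivative_inverse_norm_power[OF assms])
         (auto intro!: derivative_eq_intros)
    moreover have "(real n * snd v) * (- real (n + 2) * (v \<bullet> h) / norm v ^ (n + 2 + 2)) + (real n * snd h) * (1 / norm v ^ (n + 2))
      = n * snd h / norm v ^ (n + 2) - real n * (real n + 2) * snd v * (v \<bullet> h) / norm v ^ (n + 4)" for h :: "'a \<times> real"
    proof -
      have "(a * s) * (- b * w / D) + (a * t) * (1 / E) = a * t / E - a * b * s * w / D" for a s b w D t E :: real
        by (simp add: mult_ac)
      moreover have "n + 2 + 2 = n + 4" by simp
      ultimately show ?thesis by (simp only: of_nat_add of_nat_numeral)
    qed
    ultimately show ?thesis by (simp only: times_divide_eq_right mult_1_right)
  qed
  have "((\<lambda>v. (1 / norm v ^ n) *\<^sub>R ((0, 1) :: 'a \<times> real) - (n * snd v / norm v ^ (n + 2)) *\<^sub>R v) has_derivative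
    (\<lambda>h. (- real n * (v \<bullet> h) / norm v ^ (n + 2)) *\<^sub>R (0, 1)
     - ((n * snd v / norm v ^ (n + 2)) *\<^sub>R h +
       (n * snd h / norm v ^ (n + 2) - real n * (real n + 2) * snd v * (v \<bullet> h) / norm v ^ (n + 4)) *\<^sub>R v))) (at v)"
    by (intro has_derivative_diff has_derivative_scaleR_left has_derivative_scaleR d has_derivative_ident
        has_derivative_inverse_norm_power[OF assms])
  then show ?thesis unfolding pker_grad_def[abs_def] pker_hess_def[abs_def] by (simp add: add.commute)
qed

lemma abs_snd_le_norm: "\<bar>snd v\<bar> \<le> norm v"
  using norm_snd_le[of "snd v" "fst v"] by simp

text \<open>Here only the decay rate matters, for domination; the sharp constant that p = 1 requires
  is in \<open>norm_pker_grad_le\<close>.\<close>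

lemma norm_pker_grad:
  assumes "v \<noteq> 0"
  shows "norm (pker_grad n v) \<le> (real n + 1) / norm v ^ n"
proof -
  have "norm (pker_grad n v) \<le> norm ((1 / norm v ^ n) *\<^sub>R ((0, 1) :: 'a \<times> real)) + norm ((n * snd v / norm v ^ (n + 2)) *\<^sub>R v)"
    unfolding pker_grad_def by (rule norm_triangle_ineq4)
  also have "\<dots> = 1 / norm v ^ n + n * \<bar>snd v\<bar> * norm v / norm v ^ (n + 2)"
    by (simp add: abs_mult norm_Pair)
  also have "\<dots> \<le> 1 / norm v ^ n + n * norm v * norm v / norm v ^ (n + 2)"
    using abs_snd_le_norm[of v] by (intro add_mono divide_right_mono mult_right_mono mult_left_mono) auto
  also have "\<dots> = (real n + 1) / norm v ^ n"
    using assms by (simp add: field_simps power2_eq_square)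
  finally show ?thesis .
qed

lemma norm_pker_hess:
  assumes "v \<noteq> 0"
  shows "norm (pker_hess n v h) \<le> (real n * (real n + 5)) / norm v ^ (n + 1) * norm h"
proof -
  define R where "R = norm v"
  have R: "R > 0" using assms by (simp add: R_def)
  have tri: "norm (A - (B + C)) \<le> norm A + (norm B + norm C)" for A B C :: "'a \<times> real"
    using norm_triangle_ineq4[of A "B + C"] norm_triangle_ineq[of B C] by linarith
  have vh: "\<bar>v \<bullet> h\<bar> \<le> R * norm h" unfolding R_def by (rule Cauchy_Schwarz_ineq2)
  have sv: "\<bar>snd v\<bar> \<le> R" unfolding R_def by (rule abs_snd_le_norm)
  have sh: "\<bar>snd h\<bar> \<le> norm h" by (rule abs_snd_le_norm)
  have "norm (pker_hess n v h) \<le> n * \<bar>v \<bullet> h\<bar> / R ^ (n+2) +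
     ((n * \<bar>snd h\<bar> / R ^ (n+2) + real n * (real n + 2) * (\<bar>snd v\<bar> * \<bar>v \<bullet> h\<bar>) / R ^ (n+4)) * R + n * \<bar>snd v\<bar> / R ^ (n+2) * norm h)"
    unfolding pker_hess_def R_def[symmetric]
  proof (intro order_trans[OF tri] add_mono)
    show "norm ((- real n * (v \<bullet> h) / R ^ (n + 2)) *\<^sub>R ((0::'a), 1::real)) \<le> real n * \<bar>v \<bullet> h\<bar> / R ^ (n + 2)"
      using R by (simp add: norm_Pair abs_mult)
    show "norm ((real n * snd v / R ^ (n + 2)) *\<^sub>R h) \<le> real n * \<bar>snd v\<bar> / R ^ (n + 2) * norm h"
      using R by (simp add: abs_mult)
    have "\<bar>n * snd h / R ^ (n+2) - real n * (real n + 2) * snd v * (v \<bullet> h) / R ^ (n+4)\<bar> \<le>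
       \<bar>n * snd h / R ^ (n+2)\<bar> + \<bar>real n * (real n + 2) * snd v * (v \<bullet> h) / R ^ (n+4)\<bar>"
      by (rule abs_triangle_ineq4)
    also have "\<dots> = n * \<bar>snd h\<bar> / R ^ (n+2) + real n * (real n + 2) * (\<bar>snd v\<bar> * \<bar>v \<bullet> h\<bar>) / R ^ (n+4)"
      using R by (simp add: abs_mult)
    finally show "norm ((n * snd h / R ^ (n+2) - real n * (real n + 2) * snd v * (v \<bullet> h) / R ^ (n+4)) *\<^sub>R v)
       \<le> (n * \<bar>snd h\<bar> / R ^ (n+2) + real n * (real n + 2) * (\<bar>snd v\<bar> * \<bar>v \<bullet> h\<bar>) / R ^ (n+4)) * R"
      using R by (simp add: R_def[symmetric] mult_right_mono)
  qed
  also have "\<dots> \<le> n * (R * norm h) / R ^ (n+2) +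
     ((n * norm h / R ^ (n+2) + real n * (real n + 2) * (R * (R * norm h)) / R ^ (n+4)) * R + n * R / R ^ (n+2) * norm h)"
    using R vh sv sh
    by (intro add_mono mult_right_mono divide_right_mono mult_left_mono mult_mono) auto
  \<comment> \<open>The four terms contribute n, n, n(n+2) and n.\<close>
  also have "\<dots> = (real n * (real n + 5)) / R ^ (n + 1) * norm h"
    using R by (simp add: field_simps numeral_eq_Suc)
  finally show ?thesis unfolding R_def .
qed

lemma continuous_pker: "continuous_on {v. v \<noteq> 0} (pker n)"
  unfolding pker_def[abs_def] by (intro continuous_intros) auto

lemma continuous_pker_grad: "continuous_on {v. v \<noteq> 0} (pker_grad n)"
  unfolding pker_grad_def[abs_def] by (intro continuous_intros) auto

lemma continuous_pker_hess: "continuous_on {v. v \<noteq> 0} (\<lambda>v. pker_hess n v h)"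
  unfolding pker_hess_def[abs_def] by (intro continuous_intros) auto

text \<open>The trace is snd v / |v|^(n+2) times -2n + n(n+2) - n^2. One factor of the last n^2
  counts the basis vectors, so the cancellation ties the exponent of the kernel to the dimension of
  the space.\<close>

lemma trace_pker_hess:
  fixes v :: "'a::euclidean_space \<times> real"
  assumes "v \<noteq> 0" and n: "n = DIM('a) + 1"
  shows "(\<Sum>b\<in>Basis. pker_hess n v b \<bullet> b) = 0"
proof -
  define e :: "'a \<times> real" where "e = (0, 1)"
  have e: "snd w = e \<bullet> w" for w by (simp add: e_def inner_prod_def)
  define R where "R = norm v"
  have R: "R > 0" using assms by (simp add: R_def)
  have vv: "v \<bullet> v = R\<^sup>2" by (simp add: R_def power2_norm_eq_inner)
  have s: "(\<Sum>b\<in>Basis. (u \<bullet> b) * (w \<bullet> b)) = u \<bullet> w" for u w :: "'a \<times> real"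
    by (rule euclidean_inner[symmetric])
  have one: "(\<Sum>b\<in>(Basis :: ('a \<times> real) set). b \<bullet> b) = n"
    by (simp add: n inner_same_Basis)
  have "pker_hess n v b \<bullet> b =
     (- real n / R ^ (n+2)) * ((v \<bullet> b) * (e \<bullet> b))
     - ((n / R ^ (n+2)) * ((e \<bullet> b) * (v \<bullet> b)) - (real n * (real n + 2) * snd v / R ^ (n+4)) * ((v \<bullet> b) * (v \<bullet> b))
        + (n * snd v / R ^ (n+2)) * (b \<bullet> b))" for b
    unfolding pker_hess_def e_def[symmetric] R_def[symmetric] e[of b]
    by (simp add: inner_diff_left inner_add_left algebra_simps diff_divide_distrib add_divide_distrib)
  then have "(\<Sum>b\<in>Basis. pker_hess n v b \<bullet> b) =
     (- real n / R ^ (n+2)) * (v \<bullet> e)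
     - ((n / R ^ (n+2)) * (e \<bullet> v) - (real n * (real n + 2) * snd v / R ^ (n+4)) * R\<^sup>2
        + (n * snd v / R ^ (n+2)) * n)"
    by (simp only: sum_subtractf sum.distrib sum_distrib_left[symmetric] s one vv)
  also have "\<dots> = 0"
    using R by (simp add: e[symmetric] inner_commute[of v e] field_simps numeral_eq_Suc)
  finally show ?thesis .
qed

section \<open>Poisson integrals are harmonic\<close>

text \<open>This isolates what differentiation under the integral uses, so that one argument serves
  all exponents p. The weight has the decay of the kernel and of its gradient.\<close>

definition poisson_admissible :: "(real ^ 'm::finite \<Rightarrow> real) \<Rightarrow> bool" where
  "poisson_admissible f \<longleftrightarrow> f \<in> borel_measurable lebesgue \<and>
     (\<forall>x\<in>half_space. integrable lebesgue (\<lambda>y. f y / norm (x - (y, 0)) ^ (CARD('m) + 1)))"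

definition poisson_grad :: "(real ^ 'm::finite \<Rightarrow> real) \<Rightarrow> (real ^ 'm) \<times> real \<Rightarrow> (real ^ 'm) \<times> real" where
  "poisson_grad f x = (2 / sphere_area (CARD('m) + 1)) *\<^sub>R
     (LINT y|lebesgue. f y *\<^sub>R pker_grad (CARD('m) + 1) (x - (y, 0)))"

lemma integrable_norm_le:
  fixes F :: "'b \<Rightarrow> 'c::{banach, second_countable_topology}" and g :: "'b \<Rightarrow> real"
  assumes "integrable M g" "F \<in> borel_measurable M" "\<And>y. norm (F y) \<le> g y"
  shows "integrable M F"
  using assms(1,2) by (rule Bochner_Integration.integrable_bound)
    (use assms(3) in \<open>auto intro: order_trans[OF _ abs_ge_self]\<close>)

lemma half_space_diff_nonzero: "x \<in> half_space \<Longrightarrow> x - (y, 0) \<noteq> 0"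
  by (auto simp: half_space_def prod_eq_iff)

lemma snd_le_norm_half_space: "x \<in> half_space \<Longrightarrow> snd x \<le> norm (x - (y, 0))"
  using abs_snd_le_norm[of "x - (y, 0)"] by (simp add: half_space_def)

lemma open_half_space: "open half_space"
  unfolding half_space_def by (intro open_Collect_less continuous_intros)

text \<open>A point of this ball is displaced by less than half the height of \<open>x0\<close>,
  hence by less than half its distance to any boundary point. Distances to the boundary thus shrink
  by at most a factor 2, and one dominating function serves the whole ball.\<close>

lemma half_space_ball:
  assumes x0: "x0 \<in> half_space" and x: "x \<in> ball x0 (snd x0 / 2)"
  shows "x \<in> half_space" "snd x0 / 2 \<le> snd x" "norm (x0 - (y, 0)) / 2 \<le> norm (x - (y, 0))"
proof -
  have d: "norm (x0 - x) < snd x0 / 2" using x by (simp add: dist_norm)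
  have "\<bar>snd x0 - snd x\<bar> < snd x0 / 2" using abs_snd_le_norm[of "x0 - x"] d by simp
  then show *: "snd x0 / 2 \<le> snd x" by linarith
  then show "x \<in> half_space" using x0 by (simp add: half_space_def)
  have "norm (x0 - (y, 0)) \<le> norm (x0 - x) + norm (x - (y, 0))"
    using dist_triangle[of x0 "(y, 0)" x] by (simp only: dist_norm)
  then show "norm (x0 - (y, 0)) / 2 \<le> norm (x - (y, 0))"
    using d snd_le_norm_half_space[OF x0, of y] by linarith
qed

lemma half_space_ball_power:
  assumes x0: "x0 \<in> half_space" and x: "x \<in> ball x0 (snd x0 / 2)"
  shows "1 / norm (x - (y, 0)) ^ n \<le> 2 ^ n / norm (x0 - (y, 0)) ^ n"
proof -
  have p: "norm (x0 - (y, 0)) > 0" using half_space_diff_nonzero[OF x0] by simp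
  have "(norm (x0 - (y, 0)) / 2) ^ n \<le> norm (x - (y, 0)) ^ n"
    by (intro power_mono half_space_ball[OF x0 x]) simp
  then have "1 / norm (x - (y, 0)) ^ n \<le> 1 / (norm (x0 - (y, 0)) / 2) ^ n"
    using p by (intro divide_left_mono mult_pos_pos) (auto intro: less_le_trans[of 0 "(norm (x0 - (y, 0)) / 2) ^ n"])
  then show ?thesis by (simp add: power_divide)
qed

lemma has_derivative_shift:
  assumes "(g has_derivative g') (at (x - c))"
  shows "((\<lambda>x. g (x - c)) has_derivative g') (at x)"
proof -
  have "((\<lambda>x. x - c) has_derivative (\<lambda>h. h)) (at x)" by (auto intro!: derivative_eq_intros)
  from has_derivative_compose[OF this assms] show ?thesis .
qed

lemma borel_measurable_half_space_slice:
  fixes g :: "'a::euclidean_space \<times> real \<Rightarrow> 'b::euclidean_space"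
  assumes "continuous_on {v. v \<noteq> 0} g" and x: "snd x > 0"
  shows "(\<lambda>y. g (x - (y, 0))) \<in> borel_measurable borel"
proof (rule borel_measurable_continuous_onI)
  show "continuous_on UNIV (\<lambda>y. g (x - (y, 0)))"
    by (rule continuous_on_compose2[OF assms(1)]) (use x in \<open>auto intro!: continuous_intros simp: prod_eq_iff\<close>)
qed

text \<open>Differentiate twice under the integral on the ball of half the height; all dominating
  functions are multiples of |f| / |x0 - (y, 0)|^n. Harmonicity follows by moving the trace of the
  Hessian inside the integral.\<close>

lemma
  fixes f :: "real ^ 'm::finite \<Rightarrow> real"
  assumes f: "poisson_admissible f"
  shows poisson_integral_has_gradient:
      "\<And>x. x \<in> half_space \<Longrightarrow> GDERIV (poisson_integral f) x :> poisson_grad f x"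
    and poisson_integral_harmonic: "harmonic_on (poisson_integral f) half_space"
proof -
  define n where "n = CARD('m) + 1"
  define c where "c = 2 / sphere_area n"
  define R where "R x y = norm (x - (y, 0))" for x :: "(real ^ 'm) \<times> real" and y
  have fm[measurable]: "f \<in> borel_measurable lebesgue" using f by (simp add: poisson_admissible_def)
  have fint: "integrable lebesgue (\<lambda>y. C * (\<bar>f y\<bar> / R x y ^ n))" if "x \<in> half_space" for C x
  proof -
    have "integrable lebesgue (\<lambda>y. f y / R x y ^ n)"
      using f that by (simp only: poisson_admissible_def n_def R_def)
    then have "integrable lebesgue (\<lambda>y. C * \<bar>f y / R x y ^ n\<bar>)" by (intro integrable_mult_right integrable_abs)
    then show ?thesis by (simp add: R_def power_abs)
  qed
  have nz: "x - (y, 0) \<noteq> 0" if "x \<in> half_space" for x and y :: "real ^ 'm" by (rule half_space_diff_nonzero[OF that])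
  have meas: "(\<lambda>y. g (x - (y, 0))) \<in> borel_measurable lebesgue"
    if "continuous_on {v. v \<noteq> 0} g" "x \<in> half_space" for g :: "(real ^ 'm) \<times> real \<Rightarrow> 'b::euclidean_space" and x
  proof (rule measurable_completion)
    have "snd x > 0" using that(2) by (simp add: half_space_def)
    from borel_measurable_half_space_slice[OF that(1) this]
    show "(\<lambda>y. g (x - (y, 0))) \<in> borel_measurable lborel" by (simp only: measurable_lborel2)
  qed
  let ?K = "\<lambda>x y. f y *\<^sub>R pker n (x - (y, 0))"
  let ?G = "\<lambda>x y. f y *\<^sub>R pker_grad n (x - (y, 0))"
  let ?H = "\<lambda>x h y. f y *\<^sub>R pker_hess n (x - (y, 0)) h"
  note [measurable] = meas[OF continuous_pker] meas[OF continuous_pker_grad] meas[OF continuous_pker_hess]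
  have bK: "norm (?K x y) \<le> snd x * (\<bar>f y\<bar> / R x y ^ n)" if "x \<in> half_space" for x y
    using that by (simp add: pker_def R_def half_space_def abs_mult mult_ac)
  have bG: "norm (?G x y) \<le> (real n + 1) * (\<bar>f y\<bar> / R x y ^ n)" if "x \<in> half_space" for x y
    using mult_left_mono[OF norm_pker_grad[OF nz[OF that]], of "\<bar>f y\<bar>"] by (simp add: R_def mult_ac)
  have bH: "norm (?H x h y) \<le> (real n * (real n + 5) / snd x) * (\<bar>f y\<bar> / R x y ^ n) * norm h"
    if x: "x \<in> half_space" for x y h
  proof -
    have s: "snd x > 0" "snd x \<le> R x y" using x snd_le_norm_half_space[OF x] by (auto simp: half_space_def R_def)
    have "norm (pker_hess n (x - (y, 0)) h) \<le> (real n * (real n + 5)) / R x y ^ (n + 1) * norm h"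
      unfolding R_def by (rule norm_pker_hess[OF nz[OF x]])
    \<comment> \<open>The Hessian decays one power faster than the weight in
      \<open>poisson_admissible\<close>; the surplus factor of the distance is bounded below by the
      height of x.\<close>
    also have "\<dots> \<le> (real n * (real n + 5)) / (snd x * R x y ^ n) * norm h"
      using s by (intro mult_right_mono divide_left_mono) (auto intro!: mult_right_mono mult_pos_pos)
    finally have "\<bar>f y\<bar> * norm (pker_hess n (x - (y, 0)) h) \<le> \<bar>f y\<bar> * ((real n * (real n + 5)) / (snd x * R x y ^ n) * norm h)"
      by (rule mult_left_mono) simp
    then show ?thesis by (simp add: mult_ac)
  qed
  have ball: "x \<in> half_space" "snd x0 / 2 \<le> snd x" "\<bar>f y\<bar> / R x y ^ n \<le> 2 ^ n * (\<bar>f y\<bar> / R x0 y ^ n)"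
    if "x0 \<in> half_space" "x \<in> ball x0 (snd x0 / 2)" for x x0 y
    using half_space_ball[OF that] mult_left_mono[OF half_space_ball_power[OF that, of y n], of "\<bar>f y\<bar>"]
    by (auto simp: R_def mult_ac)
  have Kint: "integrable lebesgue (?K x)" if "x \<in> half_space" for x
    using that by (intro integrable_norm_le[OF fint[OF that] _ bK[OF that]]) measurable
  have Gint: "integrable lebesgue (?G x)" if "x \<in> half_space" for x
    using that by (intro integrable_norm_le[OF fint[OF that] _ bG[OF that]]) measurable
  have Hint: "integrable lebesgue (?H x h)" if "x \<in> half_space" for x h
    using that by (intro integrable_norm_le[OF integrable_mult_left[OF fint[OF that]] _ bH[OF that]]) measurable
  have bG': "norm (?G x y) \<le> (real n + 1) * 2 ^ n * (\<bar>f y\<bar> / R x0 y ^ n)"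
    if "x0 \<in> half_space" "x \<in> ball x0 (snd x0 / 2)" for x x0 y
  proof -
    have "norm (?G x y) \<le> (real n + 1) * (\<bar>f y\<bar> / R x y ^ n)" by (rule bG[OF ball(1)[OF that]])
    also have "\<dots> \<le> (real n + 1) * (2 ^ n * (\<bar>f y\<bar> / R x0 y ^ n))"
      by (intro mult_left_mono ball(3)[OF that]) simp
    finally show ?thesis by (simp add: mult.assoc)
  qed
  have bH': "norm (?H x h y) \<le> (real n * (real n + 5) / (snd x0 / 2) * 2 ^ n * (\<bar>f y\<bar> / R x0 y ^ n)) * norm h"
    if "x0 \<in> half_space" "x \<in> ball x0 (snd x0 / 2)" for x x0 y h
  proof -
    have s: "snd x0 / 2 \<le> snd x" "snd x0 > 0" using ball(2)[OF that] that(1) by (auto simp: half_space_def)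
    have "norm (?H x h y) \<le> (real n * (real n + 5) / snd x) * (\<bar>f y\<bar> / R x y ^ n) * norm h"
      by (rule bH[OF ball(1)[OF that]])
    also have "\<dots> \<le> (real n * (real n + 5) / (snd x0 / 2)) * (2 ^ n * (\<bar>f y\<bar> / R x0 y ^ n)) * norm h"
      using s by (intro mult_right_mono mult_mono divide_left_mono ball(3)[OF that])
        (auto intro!: mult_pos_pos divide_nonneg_pos simp: R_def)
    finally show ?thesis by (simp add: mult.assoc)
  qed
  have d1: "((\<lambda>x. LINT y|lebesgue. ?K x y) has_derivative (\<lambda>h. h \<bullet> (LINT y|lebesgue. ?G x0 y))) (at x0)"
    if x0: "x0 \<in> half_space" for x0
  proof -
    have r: "snd x0 / 2 > 0" using x0 by (simp add: half_space_def)
    have "((\<lambda>x. LINT y|lebesgue. ?K x y) has_derivative (\<lambda>h. LINT y|lebesgue. h \<bullet> ?G x0 y)) (at x0)"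
    proof (rule has_derivative_lebesgue_integral[OF r])
      show "integrable lebesgue (?K x)" if "x \<in> ball x0 (snd x0 / 2)" for x
        by (rule Kint[OF ball(1)[OF x0 that]])
      show "((\<lambda>x. ?K x y) has_derivative (\<lambda>h. h \<bullet> ?G x y)) (at x)" if "x \<in> ball x0 (snd x0 / 2)" for x y
        using has_derivative_scaleR_right[OF has_derivative_shift[OF pker_has_derivative[OF nz[OF ball(1)[OF x0 that]], of n]], of "f y"]
        by simp
      show "norm (h \<bullet> ?G x y) \<le> ((real n + 1) * 2 ^ n * (\<bar>f y\<bar> / R x0 y ^ n)) * norm h"
        if "x \<in> ball x0 (snd x0 / 2)" for x y h
      proof -
        have "norm (h \<bullet> ?G x y) \<le> norm h * norm (?G x y)"
          by (simp only: real_norm_def Cauchy_Schwarz_ineq2)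
        also have "\<dots> \<le> norm h * ((real n + 1) * 2 ^ n * (\<bar>f y\<bar> / R x0 y ^ n))"
          by (intro mult_left_mono bG'[OF x0 that]) simp
        finally show ?thesis by (simp only: mult.commute)
      qed
      show "integrable lebesgue (\<lambda>y. (real n + 1) * 2 ^ n * (\<bar>f y\<bar> / R x0 y ^ n))" by (rule fint[OF x0])
      show "(\<lambda>y. h \<bullet> ?G x0 y) \<in> borel_measurable lebesgue" for h using x0 by measurable
    qed
    moreover have "(LINT y|lebesgue. h \<bullet> ?G x0 y) = h \<bullet> (LINT y|lebesgue. ?G x0 y)" for h
      by (rule integral_inner_right) (use Gint[OF x0] in auto)
    ultimately show ?thesis by simp
  qed
  have d2: "((\<lambda>x. LINT y|lebesgue. ?G x y) has_derivative (\<lambda>h. LINT y|lebesgue. ?H x0 h y)) (at x0)"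
    if x0: "x0 \<in> half_space" for x0
  proof -
    have r: "snd x0 / 2 > 0" using x0 by (simp add: half_space_def)
    show ?thesis
    proof (rule has_derivative_lebesgue_integral[OF r, where k' = "\<lambda>x y h. ?H x h y"])
      show "integrable lebesgue (?G x)" if "x \<in> ball x0 (snd x0 / 2)" for x
        by (rule Gint[OF ball(1)[OF x0 that]])
      show "((\<lambda>x. ?G x y) has_derivative (\<lambda>h. ?H x h y)) (at x)" if "x \<in> ball x0 (snd x0 / 2)" for x y
        by (rule has_derivative_scaleR_right[OF has_derivative_shift[OF pker_grad_has_derivative[OF nz[OF ball(1)[OF x0 that]], of n]], of "f y"])
      show "norm (?H x h y) \<le> (real n * (real n + 5) / (snd x0 / 2) * 2 ^ n * (\<bar>f y\<bar> / R x0 y ^ n)) * norm h"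
        if "x \<in> ball x0 (snd x0 / 2)" for x y h
        by (rule bH'[OF x0 that])
      show "integrable lebesgue (\<lambda>y. real n * (real n + 5) / (snd x0 / 2) * 2 ^ n * (\<bar>f y\<bar> / R x0 y ^ n))" by (rule fint[OF x0])
      show "(\<lambda>y. ?H x0 h y) \<in> borel_measurable lebesgue" for h using x0 by measurable
    qed
  qed
  have ct: "continuous_on half_space (\<lambda>x. LINT y|lebesgue. ?H x b y)" for b
  proof (rule continuous_at_imp_continuous_on, rule ballI)
    fix x0 :: "(real ^ 'm) \<times> real" assume x0: "x0 \<in> half_space"
    have r: "snd x0 / 2 > 0" using x0 by (simp add: half_space_def)
    show "isCont (\<lambda>x. LINT y|lebesgue. ?H x b y) x0"
    proof (rule isCont_lebesgue_integral[OF r])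
      show "?H x b \<in> borel_measurable lebesgue" if "x \<in> ball x0 (snd x0 / 2)" for x
        using ball(1)[OF x0 that] by measurable
      show "isCont (\<lambda>x. ?H x b y) x0" for y
      proof -
        have "isCont (\<lambda>v. pker_hess n v b) (x0 - (y, 0))"
        proof -
          have "open {v :: (real ^ 'm) \<times> real. v \<noteq> 0}" by (rule open_Collect_neq) (intro continuous_intros)+
          from continuous_on_eq_continuous_at[THEN iffD1, OF this continuous_pker_hess, of n b]
          show ?thesis using nz[OF x0, of y] by blast
        qed
        then have "isCont (\<lambda>x. pker_hess n (x - (y, 0)) b) x0"
          by (rule isCont_o2[rotated]) (auto intro!: continuous_intros)
        then show ?thesis by (intro continuous_intros)
      qed
      show "norm (?H x b y) \<le> (real n * (real n + 5) / (snd x0 / 2) * 2 ^ n * (\<bar>f y\<bar> / R x0 y ^ n)) * norm b"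
        if "x \<in> ball x0 (snd x0 / 2)" for x y
        by (rule bH'[OF x0 that])
      show "integrable lebesgue (\<lambda>y. (real n * (real n + 5) / (snd x0 / 2) * 2 ^ n * (\<bar>f y\<bar> / R x0 y ^ n)) * norm b)"
        by (rule integrable_mult_left[OF fint[OF x0]])
    qed
  qed
  have tr: "(\<Sum>b\<in>Basis. (LINT y|lebesgue. ?H x b y) \<bullet> b) = 0" if x: "x \<in> half_space" for x
  proof -
    have "(\<Sum>b\<in>Basis. (LINT y|lebesgue. ?H x b y) \<bullet> b) = (\<Sum>b\<in>Basis. (LINT y|lebesgue. ?H x b y \<bullet> b))"
      by (intro sum.cong refl integral_inner_left[symmetric]) (use Hint[OF x] in auto)
    also have "\<dots> = (LINT y|lebesgue. (\<Sum>b\<in>Basis. ?H x b y \<bullet> b))"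
      by (rule Bochner_Integration.integral_sum[symmetric]) (intro integrable_inner_left Hint[OF x])
    also have "\<dots> = (LINT y|(lebesgue :: (real ^ 'm) measure). 0)"
    proof (rule Bochner_Integration.integral_cong[OF refl])
      fix y :: "real ^ 'm"
      have "(\<Sum>b\<in>Basis. ?H x b y \<bullet> b) = f y * (\<Sum>b\<in>Basis. pker_hess n (x - (y, 0)) b \<bullet> b)"
        by (simp add: sum_distrib_left)
      then show "(\<Sum>b\<in>Basis. ?H x b y \<bullet> b) = 0"
        using trace_pker_hess[OF nz[OF x], of n y] by (simp add: n_def)
    qed
    finally show ?thesis by simp
  qed
  have U: "poisson_integral f = (\<lambda>x. c * (LINT y|lebesgue. ?K x y))"
    unfolding poisson_integral_def n_def[symmetric] c_def pker_def
    by (intro ext arg_cong2[where f = "(*)"] refl Bochner_Integration.integral_cong)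
       (simp add: norm_minus_commute mult_ac)
  have P: "poisson_grad f = (\<lambda>x. c *\<^sub>R (LINT y|lebesgue. ?G x y))"
    by (simp add: poisson_grad_def[abs_def] n_def c_def)
  show g: "GDERIV (poisson_integral f) x :> poisson_grad f x" if "x \<in> half_space" for x
    unfolding gderiv_def U P using has_derivative_mult_right[OF d1[OF that], of c] by simp
  show "harmonic_on (poisson_integral f) half_space"
    unfolding harmonic_on_def
  proof (intro exI conjI ballI)
    fix x :: "(real ^ 'm) \<times> real" assume x: "x \<in> half_space"
    show "GDERIV (poisson_integral f) x :> poisson_grad f x" by (rule g[OF x])
    show "(poisson_grad f has_derivative (\<lambda>h. c *\<^sub>R (LINT y|lebesgue. ?H x h y))) (at x)"
      unfolding P by (rule has_derivative_scaleR_right[OF d2[OF x]])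
    show "(\<Sum>b\<in>Basis. c *\<^sub>R (LINT y|lebesgue. ?H x b y) \<bullet> b) = 0"
      using tr[OF x] by (simp add: sum_distrib_left[symmetric])
  next
    fix b :: "(real ^ 'm) \<times> real"
    show "continuous_on half_space (\<lambda>x. c *\<^sub>R (LINT y|lebesgue. ?H x b y))"
      by (intro continuous_intros ct)
  qed
qed

subsection \<open>Norms of the kernels\<close>

text \<open>This links the two integrals in play: polar coordinates produce nonnegative integrals
  over open intervals, while \<open>grad_const\<close> is written with gauge integrals over closed
  ones.\<close>

lemma nn_integral_Ioo_continuous:
  fixes h :: "real \<Rightarrow> real"
  assumes "continuous_on {a..b} h" "\<And>t. t \<in> {a..b} \<Longrightarrow> 0 \<le> h t"
  shows "(\<integral>\<^sup>+t. indicator {a<..<b} t * ennreal (h t) \<partial>lborel) = ennreal (integral {a..b} h)"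
proof -
  have "(h has_integral integral {a..b} h) {a<..<b}"
    using assms(1) by (simp add: has_integral_Icc_iff_Ioo[symmetric] integrable_integral integrable_continuous_interval)
  from nn_integral_has_integral_lebesgue[OF _ this] assms(2)
  have "(\<integral>\<^sup>+t. ennreal (indicator {a<..<b} t * h t) \<partial>lborel) = ennreal (integral {a..b} h)" by auto
  then show ?thesis by (simp add: ennreal_mult'' ennreal_mult' flip: ennreal_indicator)
qed

lemma nn_integral_rectangle_continuous:
  fixes h :: "real \<Rightarrow> real \<Rightarrow> real"
  assumes cont: "continuous_on ({a..b} \<times> {c..d}) (\<lambda>(s, t). h s t)"
    and nonneg: "\<And>s t. s \<in> {a..b} \<Longrightarrow> t \<in> {c..d} \<Longrightarrow> 0 \<le> h s t"
  shows "(\<integral>\<^sup>+s. indicator {a<..<b} s * (\<integral>\<^sup>+t. indicator {c<..<d} t * ennreal (h s t) \<partial>lborel) \<partial>lborel)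
    = ennreal (integral {a..b} (\<lambda>s. integral {c..d} (h s)))"
proof -
  have sect: "continuous_on {c..d} (h s)" if "s \<in> {a..b}" for s
    by (rule continuous_on_compose2[OF cont, of _ "\<lambda>t. (s, t)", simplified])
       (use that in \<open>auto intro!: continuous_intros\<close>)
  have "(\<integral>\<^sup>+s. indicator {a<..<b} s * (\<integral>\<^sup>+t. indicator {c<..<d} t * ennreal (h s t) \<partial>lborel) \<partial>lborel)
    = (\<integral>\<^sup>+s. indicator {a<..<b} s * ennreal (integral {c..d} (h s)) \<partial>lborel)"
  proof (rule nn_integral_cong)
    fix s :: real
    show "indicator {a<..<b} s * (\<integral>\<^sup>+t. indicator {c<..<d} t * ennreal (h s t) \<partial>lborel)
      = indicator {a<..<b} s * ennreal (integral {c..d} (h s))"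
    proof (cases "s \<in> {a<..<b}")
      case True
      then have "s \<in> {a..b}" by simp
      then show ?thesis by (subst nn_integral_Ioo_continuous[OF sect nonneg]) auto
    qed simp
  qed
  also have "\<dots> = ennreal (integral {a..b} (\<lambda>s. integral {c..d} (h s)))"
  proof (rule nn_integral_Ioo_continuous)
    show "continuous_on {a..b} (\<lambda>s. integral {c..d} (h s))"
      using integral_continuous_on_param[of "{a..b}" c d h] cont by simp
    show "0 \<le> integral {c..d} (h s)" if "s \<in> {a..b}" for s
      using nonneg[OF that] by (intro integral_nonneg integrable_continuous_interval sect[OF that]) auto
  qed
  finally show ?thesis .
qed

text \<open>The three parameters let one computation cover two kernels: (-1, n, n\<gamma>) is the
  directional derivative, and (1, 0, 0) is the bare power of the inverse distance. The exponent q is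
  the one conjugate to p.\<close>

definition kernel_trig_integral :: "nat \<Rightarrow> real \<Rightarrow> real \<Rightarrow> real \<Rightarrow> real \<Rightarrow> real" where
  "kernel_trig_integral n q \<alpha> \<beta> \<delta> = integral {0..pi} (\<lambda>\<phi>. integral {0..pi/2} (\<lambda>\<theta>.
     \<bar>\<alpha> + \<beta> * (cos \<theta>)\<^sup>2 + \<delta> * (cos \<theta> * sin \<theta> * cos \<phi>)\<bar> powr q * cos \<theta> powr (real n * (q - 1)) *
     sin \<theta> ^ (n - 2) * sin \<phi> ^ (n - 3)))"

text \<open>In polar coordinates |w|^2 + c^2 = (c / cos \<theta>)^2 and w . e = c tan \<theta> cos
  \<phi>, so the two quotients become (cos \<theta>)^2 and cos \<theta> sin \<theta> cos \<phi>. The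
  volume element gives c^(n-1) and the denominator c^(-nq); the cosine collects nq from the
  denominator and -n from the volume element.\<close>

lemma nn_integral_kernel_power:
  fixes e :: "real ^ 'm::finite"
  assumes e: "norm e = 1" and dim: "CARD('m) \<ge> 2" and c: "c > 0" and q: "q > 1" and n: "n = CARD('m) + 1"
  shows "(\<integral>\<^sup>+w. ennreal (\<bar>(\<alpha> + \<beta> * (c\<^sup>2 / ((norm w)\<^sup>2 + c\<^sup>2)) + \<delta> * (c * (w \<bullet> e) / ((norm w)\<^sup>2 + c\<^sup>2)))
      / sqrt ((norm w)\<^sup>2 + c\<^sup>2) ^ n\<bar> powr q) \<partial>lborel) =
    ennreal (sphere_area (n - 2) * c powr (real n - 1 - real n * q) * kernel_trig_integral n q \<alpha> \<beta> \<delta>)"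
proof -
  define G where "G = (\<lambda>(a, t). ennreal (\<bar>(\<alpha> + \<beta> * (c\<^sup>2 / (a\<^sup>2 + t\<^sup>2 + c\<^sup>2)) + \<delta> * (c * a / (a\<^sup>2 + t\<^sup>2 + c\<^sup>2)))
      / sqrt (a\<^sup>2 + t\<^sup>2 + c\<^sup>2) ^ n\<bar> powr q))"
  define F where "F \<phi> \<theta> = \<bar>\<alpha> + \<beta> * (cos \<theta>)\<^sup>2 + \<delta> * (cos \<theta> * sin \<theta> * cos \<phi>)\<bar> powr q * cos \<theta> powr (real n * (q - 1)) *
     sin \<theta> ^ (n - 2) * sin \<phi> ^ (n - 3)" for \<phi> \<theta>
  have n0: "real n > 0" using n by simp
  have "G \<in> borel_measurable (borel \<Otimes>\<^sub>M borel)" unfolding G_def by measurable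
  then have Gm: "G \<in> borel_measurable borel" by (simp add: borel_prod)
  have sq: "(w \<bullet> e)\<^sup>2 + (sqrt ((norm w)\<^sup>2 - (w \<bullet> e)\<^sup>2))\<^sup>2 = (norm w)\<^sup>2" for w
  proof -
    have "\<bar>w \<bullet> e\<bar> \<le> norm w" using Cauchy_Schwarz_ineq2[of w e] e by simp
    then have "(w \<bullet> e)\<^sup>2 \<le> (norm w)\<^sup>2" by (metis abs_le_square_iff abs_norm_cancel)
    then show ?thesis by simp
  qed
  have "(\<integral>\<^sup>+w. ennreal (\<bar>(\<alpha> + \<beta> * (c\<^sup>2 / ((norm w)\<^sup>2 + c\<^sup>2)) + \<delta> * (c * (w \<bullet> e) / ((norm w)\<^sup>2 + c\<^sup>2)))
      / sqrt ((norm w)\<^sup>2 + c\<^sup>2) ^ n\<bar> powr q) \<partial>lborel) =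
      (\<integral>\<^sup>+w. G (w \<bullet> e, sqrt ((norm w)\<^sup>2 - (w \<bullet> e)\<^sup>2)) \<partial>lborel)"
    by (simp only: G_def split sq)
  also have "\<dots> = ennreal (sphere_area (CARD('m) - 1) * c ^ CARD('m)) *
    (\<integral>\<^sup>+\<phi>. indicator {0<..<pi} \<phi> * (\<integral>\<^sup>+\<theta>. indicator {0<..<pi/2} \<theta> *
       (ennreal (tan \<theta> ^ (CARD('m) - 1) / (cos \<theta>)\<^sup>2 * sin \<phi> ^ (CARD('m) - 2)) *
        G (c * tan \<theta> * cos \<phi>, c * tan \<theta> * sin \<phi>)) \<partial>lborel) \<partial>lborel)"
    by (rule nn_integral_polar[OF e dim Gm c])
  also have "(\<integral>\<^sup>+\<phi>. indicator {0<..<pi} \<phi> * (\<integral>\<^sup>+\<theta>. indicator {0<..<pi/2} \<theta> *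
       (ennreal (tan \<theta> ^ (CARD('m) - 1) / (cos \<theta>)\<^sup>2 * sin \<phi> ^ (CARD('m) - 2)) *
        G (c * tan \<theta> * cos \<phi>, c * tan \<theta> * sin \<phi>)) \<partial>lborel) \<partial>lborel) =
     (\<integral>\<^sup>+\<phi>. indicator {0<..<pi} \<phi> * (\<integral>\<^sup>+\<theta>. indicator {0<..<pi/2} \<theta> *
       ennreal (c powr (- (real n * q)) * F \<phi> \<theta>) \<partial>lborel) \<partial>lborel)"
  proof (rule nn_integral_cong)
    fix \<phi> :: real
    show "indicator {0<..<pi} \<phi> * (\<integral>\<^sup>+\<theta>. indicator {0<..<pi/2} \<theta> *
       (ennreal (tan \<theta> ^ (CARD('m) - 1) / (cos \<theta>)\<^sup>2 * sin \<phi> ^ (CARD('m) - 2)) *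
        G (c * tan \<theta> * cos \<phi>, c * tan \<theta> * sin \<phi>)) \<partial>lborel) =
      indicator {0<..<pi} \<phi> * (\<integral>\<^sup>+\<theta>. indicator {0<..<pi/2} \<theta> *
       ennreal (c powr (- (real n * q)) * F \<phi> \<theta>) \<partial>lborel)"
    proof (cases "\<phi> \<in> {0<..<pi}")
      case True
      then have sp: "sin \<phi> > 0" by (auto intro: sin_gt_zero)
      have eq: "ennreal (tan \<theta> ^ (CARD('m) - 1) / (cos \<theta>)\<^sup>2 * sin \<phi> ^ (CARD('m) - 2)) *
        G (c * tan \<theta> * cos \<phi>, c * tan \<theta> * sin \<phi>) = ennreal (c powr (- (real n * q)) * F \<phi> \<theta>)"
        if th: "\<theta> \<in> {0<..<pi/2}" for \<theta>
      proof -
        have cp: "cos \<theta> > 0" using th by (auto intro: cos_gt_zero_pi)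
        have st: "sin \<theta> > 0" using th by (auto intro: sin_gt_zero)
        have tp: "tan \<theta> > 0" using th by (auto intro: tan_gt_zero)
        have Q: "(c * tan \<theta> * cos \<phi>)\<^sup>2 + (c * tan \<theta> * sin \<phi>)\<^sup>2 + c\<^sup>2 = (c / cos \<theta>)\<^sup>2"
        proof -
          have "(c * tan \<theta> * cos \<phi>)\<^sup>2 + (c * tan \<theta> * sin \<phi>)\<^sup>2 + c\<^sup>2 = (c * tan \<theta>)\<^sup>2 * ((sin \<phi>)\<^sup>2 + (cos \<phi>)\<^sup>2) + c\<^sup>2"
            by (simp only: power_mult_distrib distrib_left add.commute)
          also have "\<dots> = c\<^sup>2 * ((sin \<theta>)\<^sup>2 + (cos \<theta>)\<^sup>2) / (cos \<theta>)\<^sup>2"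
          proof -
            have "(c * (S / C))\<^sup>2 * 1 + c\<^sup>2 = c\<^sup>2 * (S\<^sup>2 + C\<^sup>2) / C\<^sup>2" if "C \<noteq> 0" for S C :: real
              using that by (simp add: power_mult_distrib power_divide field_simps)
            from this[of "cos \<theta>" "sin \<theta>"] show ?thesis using cp by (simp add: tan_def)
          qed
          finally show ?thesis by (simp add: power_divide)
        qed
        have c1: "c\<^sup>2 / (c / cos \<theta>)\<^sup>2 = (cos \<theta>)\<^sup>2" using c cp by (simp add: power_divide)
        have c2: "c * (c * tan \<theta> * cos \<phi>) / (c / cos \<theta>)\<^sup>2 = cos \<theta> * sin \<theta> * cos \<phi>"
          using c cp by (simp add: tan_def power2_eq_square)
        have sr: "sqrt ((c / cos \<theta>)\<^sup>2) = c / cos \<theta>" using c cp by simp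
        define X where "X = \<bar>\<alpha> + \<beta> * (cos \<theta>)\<^sup>2 + \<delta> * (cos \<theta> * sin \<theta> * cos \<phi>)\<bar>"
        have G: "G (c * tan \<theta> * cos \<phi>, c * tan \<theta> * sin \<phi>) = ennreal ((X / (c / cos \<theta>) ^ n) powr q)"
          unfolding G_def split Q c1 c2 sr X_def using c cp by (simp add: abs_divide power_abs)
        have p1: "(X / (c / cos \<theta>) ^ n) powr q = X powr q * (cos \<theta> powr (real n * q) * c powr (- (real n * q)))"
        proof -
          have "(X / (c / cos \<theta>) ^ n) powr q = X powr q / ((c / cos \<theta>) ^ n) powr q"
            using c cp by (subst powr_divide) (auto simp: X_def)
          also have "((c / cos \<theta>) ^ n) powr q = (c / cos \<theta>) powr (real n * q)"
            using c cp by (subst powr_realpow[symmetric]) (auto simp: powr_powr)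
          also have "\<dots> = c powr (real n * q) / cos \<theta> powr (real n * q)"
            using c cp by (subst powr_divide) auto
          finally show ?thesis by (simp add: powr_minus divide_inverse)
        qed
        have p2: "tan \<theta> ^ (CARD('m) - 1) / (cos \<theta>)\<^sup>2 * cos \<theta> powr (real n * q) = sin \<theta> ^ (n - 2) * cos \<theta> powr (real n * (q - 1))"
        proof -
          have m: "CARD('m) - 1 = n - 2" "n - 2 + 2 = n" using n dim by auto
          have "tan \<theta> ^ (CARD('m) - 1) / (cos \<theta>)\<^sup>2 = sin \<theta> ^ (n - 2) / cos \<theta> ^ (n - 2 + 2)"
            unfolding m(1) tan_def by (simp only: power_divide power_add divide_divide_eq_left)
          also have "cos \<theta> ^ (n - 2 + 2) = cos \<theta> powr real n"
            unfolding m(2) using cp by (simp add: powr_realpow)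
          finally show ?thesis by (simp add: right_diff_distrib powr_diff)
        qed
        have m2: "CARD('m) - 2 = n - 3" using n by simp
        have "tan \<theta> ^ (CARD('m) - 1) / (cos \<theta>)\<^sup>2 * sin \<phi> ^ (CARD('m) - 2) * (X / (c / cos \<theta>) ^ n) powr q
           = (tan \<theta> ^ (CARD('m) - 1) / (cos \<theta>)\<^sup>2 * cos \<theta> powr (real n * q)) * (sin \<phi> ^ (n - 3) * X powr q * c powr (- (real n * q)))"
          unfolding p1 m2 by (simp add: mult_ac)
        also have "\<dots> = c powr (- (real n * q)) * F \<phi> \<theta>"
          unfolding p2 F_def X_def by (simp add: mult_ac)
        finally show ?thesis unfolding G using tp sp by (subst ennreal_mult'[symmetric]) auto
      qed
      show ?thesis
      proof (rule arg_cong2[where f = "(*)", OF refl], rule nn_integral_cong)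
        fix \<theta> :: real
        show "indicator {0<..<pi/2} \<theta> * (ennreal (tan \<theta> ^ (CARD('m) - 1) / (cos \<theta>)\<^sup>2 * sin \<phi> ^ (CARD('m) - 2)) *
          G (c * tan \<theta> * cos \<phi>, c * tan \<theta> * sin \<phi>)) = indicator {0<..<pi/2} \<theta> * ennreal (c powr (- (real n * q)) * F \<phi> \<theta>)"
          by (cases "\<theta> \<in> {0<..<pi/2}") (simp_all only: eq indicator_simps mult_zero_left not_False_eq_True)
      qed
    qed simp
  qed
  also have "\<dots> = ennreal (integral {0..pi} (\<lambda>\<phi>. integral {0..pi/2} (\<lambda>\<theta>. c powr (- (real n * q)) * F \<phi> \<theta>)))"
  proof (rule nn_integral_rectangle_continuous)
    have cpos: "cos \<theta> \<ge> 0" if "\<theta> \<in> {0..pi/2}" for \<theta> using that by (intro cos_ge_zero) auto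
    show "continuous_on ({0..pi} \<times> {0..pi/2}) (\<lambda>(\<phi>, \<theta>). c powr (- (real n * q)) * F \<phi> \<theta>)"
    proof -
      \<comment> \<open>Both real exponents, q and n(q-1), are positive, which keeps
        \<open>powr\<close> continuous where the base vanishes.\<close>
      have "continuous_on ({0..pi} \<times> {0..pi/2}) (\<lambda>x. \<bar>\<alpha> + \<beta> * (cos (snd x))\<^sup>2 + \<delta> * (cos (snd x) * sin (snd x) * cos (fst x))\<bar> powr q)"
        by (rule continuous_on_powr') (use q in \<open>auto intro!: continuous_intros\<close>)
      moreover have "continuous_on ({0..pi} \<times> {0..pi/2}) (\<lambda>x. cos (snd x) powr (real n * (q - 1)))"
        by (rule continuous_on_powr') (use q n0 cpos in \<open>auto intro!: continuous_intros\<close>)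
      ultimately show ?thesis
        unfolding F_def split_beta
        by (intro continuous_on_mult continuous_on_power continuous_on_const continuous_on_sin
            continuous_on_fst continuous_on_snd continuous_on_id)
    qed
    show "0 \<le> c powr (- (real n * q)) * F \<phi> \<theta>" if "\<phi> \<in> {0..pi}" "\<theta> \<in> {0..pi/2}" for \<phi> \<theta>
      using that unfolding F_def by (intro mult_nonneg_nonneg zero_le_power) (auto intro: sin_ge_zero)
  qed
  also have "integral {0..pi} (\<lambda>\<phi>. integral {0..pi/2} (\<lambda>\<theta>. c powr (- (real n * q)) * F \<phi> \<theta>)) =
      c powr (- (real n * q)) * kernel_trig_integral n q \<alpha> \<beta> \<delta>"
    by (simp add: kernel_trig_integral_def F_def)
  also have "ennreal (sphere_area (CARD('m) - 1) * c ^ CARD('m)) * ennreal (c powr (- (real n * q)) * kernel_trig_integral n q \<alpha> \<beta> \<delta>)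
     = ennreal ((sphere_area (CARD('m) - 1) * c ^ CARD('m)) * (c powr (- (real n * q)) * kernel_trig_integral n q \<alpha> \<beta> \<delta>))"
    using c by (subst ennreal_mult') (auto simp: sphere_area_def)
  also have "(sphere_area (CARD('m) - 1) * c ^ CARD('m)) * (c powr (- (real n * q)) * kernel_trig_integral n q \<alpha> \<beta> \<delta>)
     = sphere_area (n - 2) * c powr (real n - 1 - real n * q) * kernel_trig_integral n q \<alpha> \<beta> \<delta>"
  proof -
    have "c ^ CARD('m) = c powr (real n - 1)" using c n by (simp add: powr_realpow)
    then have "c ^ CARD('m) * c powr (- (real n * q)) = c powr (real n - 1 - real n * q)"
      by (simp add: powr_add[symmetric])
    then show ?thesis using n by (simp add: mult_ac)
  qed
  finally show ?thesis .
qed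

text \<open>A function that is not integrable has integral 0 by convention, so integrability need
  not be known.\<close>

lemma Henstock_integral_nonneg:
  fixes f :: "'a::euclidean_space \<Rightarrow> real"
  assumes "\<And>x. x \<in> S \<Longrightarrow> 0 \<le> f x"
  shows "0 \<le> integral S f"
  using assms by (cases "f integrable_on S") (auto intro: integral_nonneg simp: not_integrable_integral)

lemma nn_integral_lebesgue_translate:
  fixes x' :: "'a::euclidean_space"
  assumes [measurable]: "F \<in> borel_measurable borel"
  shows "(\<integral>\<^sup>+y. F (y - x') \<partial>lebesgue) = (\<integral>\<^sup>+w. F w \<partial>lborel)"
proof -
  have "(\<integral>\<^sup>+y. F (y - x') \<partial>lebesgue) = (\<integral>\<^sup>+y. F (y - x') \<partial>distr lborel borel ((+) x'))"
    by (simp add: nn_integral_completion lborel_distr_plus)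
  also have "\<dots> = (\<integral>\<^sup>+w. F w \<partial>lborel)"
    by (subst nn_integral_distr) auto
  finally show ?thesis .
qed

text \<open>The nonnegative integral is a finite real number, which yields integrability and the
  value at once.\<close>

lemma integral_kernel_power:
  fixes e :: "real ^ 'm::finite"
  assumes e: "norm e = 1" and dim: "CARD('m) \<ge> 2" and c: "c > 0" and q: "q > 1" and n: "n = CARD('m) + 1"
    and k: "\<And>y. \<bar>k y\<bar> = \<bar>(\<alpha> + \<beta> * (c\<^sup>2 / ((norm (y - x'))\<^sup>2 + c\<^sup>2)) + \<delta> * (c * ((y - x') \<bullet> e) / ((norm (y - x'))\<^sup>2 + c\<^sup>2)))
      / sqrt ((norm (y - x'))\<^sup>2 + c\<^sup>2) ^ n\<bar>"
  shows "integrable lebesgue (\<lambda>y. \<bar>k y\<bar> powr q)"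
    and "(LINT y|lebesgue. \<bar>k y\<bar> powr q) =
      sphere_area (n - 2) * c powr (real n - 1 - real n * q) * kernel_trig_integral n q \<alpha> \<beta> \<delta>"
proof -
  let ?F = "\<lambda>w. \<bar>(\<alpha> + \<beta> * (c\<^sup>2 / ((norm w)\<^sup>2 + c\<^sup>2)) + \<delta> * (c * (w \<bullet> e) / ((norm w)\<^sup>2 + c\<^sup>2)))
      / sqrt ((norm w)\<^sup>2 + c\<^sup>2) ^ n\<bar> powr q"
  let ?I = "sphere_area (n - 2) * c powr (real n - 1 - real n * q) * kernel_trig_integral n q \<alpha> \<beta> \<delta>"
  have m: "(\<lambda>y. \<bar>k y\<bar> powr q) \<in> borel_measurable lebesgue"
    unfolding k by (rule measurable_completion) measurable
  have "(\<integral>\<^sup>+y. ennreal (\<bar>k y\<bar> powr q) \<partial>lebesgue) = (\<integral>\<^sup>+y. ennreal (?F (y - x')) \<partial>lebesgue)"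
    unfolding k ..
  also have "\<dots> = (\<integral>\<^sup>+w. ennreal (?F w) \<partial>lborel)"
    by (rule nn_integral_lebesgue_translate) measurable
  also have "\<dots> = ennreal ?I"
    by (rule nn_integral_kernel_power[OF e dim c q n])
  finally have I: "(\<integral>\<^sup>+y. ennreal (\<bar>k y\<bar> powr q) \<partial>lebesgue) = ennreal ?I" .
  show i: "integrable lebesgue (\<lambda>y. \<bar>k y\<bar> powr q)"
    unfolding integrable_iff_bounded using m I by (auto simp: less_top[symmetric])
  have "?I \<ge> 0"
    unfolding kernel_trig_integral_def sphere_area_def
    by (intro mult_nonneg_nonneg Henstock_integral_nonneg zero_le_power) (auto intro: sin_ge_zero)
  then show "(LINT y|lebesgue. \<bar>k y\<bar> powr q) = ?I"
    using I m by (subst integral_eq_nn_integral) auto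
qed

section \<open>Kernels of directional derivatives\<close>

text \<open>Here \<gamma> is the ratio of the horizontal to the vertical component. The vector
  points down so that the kernel acquires n (cos \<theta>)^2 - 1 with the sign it has in
  \<open>F_integrand\<close>.\<close>

definition unit_dir :: "real \<Rightarrow> 'a::euclidean_space \<Rightarrow> 'a \<times> real" where
  "unit_dir \<gamma> e = (1 / sqrt (1 + \<gamma>\<^sup>2)) *\<^sub>R (\<gamma> *\<^sub>R e, -1)"

lemma norm_unit_dir:
  assumes "norm e = 1"
  shows "norm (unit_dir \<gamma> e) = 1"
proof -
  have "1 + \<gamma>\<^sup>2 > 0" by (simp add: add_pos_nonneg)
  moreover have "norm (\<gamma> *\<^sub>R e, - 1 :: real) = sqrt (1 + \<gamma>\<^sup>2)"
    using assms by (simp add: norm_Pair add.commute)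
  ultimately show ?thesis unfolding unit_dir_def norm_scaleR by simp
qed

lemma unit_dir_representation:
  fixes z :: "(real ^ 'm::finite) \<times> real"
  assumes "snd z < 0"
  obtains \<gamma> e where "\<gamma> \<ge> 0" "norm e = 1" "z = norm z *\<^sub>R unit_dir \<gamma> e"
proof -
  define \<gamma> where "\<gamma> = norm (fst z) / - snd z"
  obtain e where e: "norm e = 1" "fst z = norm (fst z) *\<^sub>R e"
  \<comment> \<open>For vertical z the ratio \<gamma> is 0 and any unit vector serves as
    axis.\<close>
  proof (cases "fst z = 0")
    case True
    obtain b :: "real ^ 'm" where "b \<in> Basis" using nonempty_Basis by blast
    then show ?thesis using True by (intro that[of b]) auto
  next
    case False
    then show ?thesis by (intro that[of "fst z /\<^sub>R norm (fst z)"]) auto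
  qed
  have nz: "norm z > 0" using assms by auto
  have "1 + \<gamma>\<^sup>2 = (norm z / - snd z)\<^sup>2"
    using assms by (simp add: \<gamma>_def norm_prod_def power_divide field_simps)
  then have s: "sqrt (1 + \<gamma>\<^sup>2) = norm z / - snd z"
    using assms nz by (simp only: real_sqrt_abs) (simp add: abs_of_neg divide_nonneg_neg)
  have "norm z *\<^sub>R unit_dir \<gamma> e = (- snd z) *\<^sub>R (\<gamma> *\<^sub>R e, -1)"
    unfolding unit_dir_def s scaleR_scaleR using nz assms by simp
  also have "\<dots> = (fst z, snd z)"
    using assms e(2) by (simp add: \<gamma>_def)
  finally have "norm z *\<^sub>R unit_dir \<gamma> e = z" by simp
  moreover have "\<gamma> \<ge> 0" unfolding \<gamma>_def using assms by (intro divide_nonneg_pos) auto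
  ultimately show ?thesis using e(1) by (intro that[of \<gamma> e]) auto
qed

text \<open>This brings the directional kernel into the shape of
  \<open>integral_kernel_power\<close> with \<alpha> = -1, \<beta> = n, \<delta> = n\<gamma>; the
  normalising root is moved to the left.\<close>

lemma unit_dir_inner_pker_grad:
  fixes e :: "'a::euclidean_space"
  assumes c: "snd x > 0"
  shows "sqrt (1 + \<gamma>\<^sup>2) * (unit_dir \<gamma> e \<bullet> pker_grad n (x - (y, 0))) =
    (-1 + real n * ((snd x)\<^sup>2 / ((norm (y - fst x))\<^sup>2 + (snd x)\<^sup>2))
      + (real n * \<gamma>) * (snd x * ((y - fst x) \<bullet> e) / ((norm (y - fst x))\<^sup>2 + (snd x)\<^sup>2)))
      / sqrt ((norm (y - fst x))\<^sup>2 + (snd x)\<^sup>2) ^ n"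
proof -
  define Q where "Q = (norm (y - fst x))\<^sup>2 + (snd x)\<^sup>2"
  define a where "a = (y - fst x) \<bullet> e"
  define s where "s = sqrt (1 + \<gamma>\<^sup>2)"
  define v where "v = x - (y, 0)"
  define N where "N = sqrt Q ^ n"
  have "1 + \<gamma>\<^sup>2 > 0" by (simp add: add_pos_nonneg)
  then have s: "s > 0" by (simp add: s_def)
  have Q: "Q > 0" using c by (simp add: Q_def add_nonneg_pos)
  then have N: "N > 0" by (simp add: N_def)
  have fv: "fst v = - (y - fst x)" and sv: "snd v = snd x" by (simp_all add: v_def)
  have nv: "norm v = sqrt Q" by (simp add: norm_prod_def fv sv Q_def norm_minus_commute)
  have N2: "norm v ^ n = N" "norm v ^ (n + 2) = N * Q" using Q by (simp_all add: nv N_def power_add)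
  have u: "s * (unit_dir \<gamma> e \<bullet> w) = \<gamma> * (e \<bullet> fst w) - snd w" for w
    using s by (cases w) (simp add: unit_dir_def s_def[symmetric] inner_diff_left field_simps)
  have w: "fst (pker_grad n v) = (real n * snd x / (N * Q)) *\<^sub>R (y - fst x)"
    "snd (pker_grad n v) = 1 / N - real n * snd x / (N * Q) * snd x"
    unfolding pker_grad_def N2 sv by (simp_all add: fv sv algebra_simps)
  have "s * (unit_dir \<gamma> e \<bullet> pker_grad n v) = \<gamma> * (real n * snd x / (N * Q) * a) - (1 / N - real n * snd x / (N * Q) * snd x)"
    unfolding u w by (simp add: a_def inner_commute)
  also have "\<dots> = (-1 + real n * ((snd x)\<^sup>2 / Q) + (real n * \<gamma>) * (snd x * a / Q)) / N"
    using N Q by (simp add: field_simps power2_eq_square)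
  finally show ?thesis by (simp only: s_def v_def a_def Q_def N_def)
qed

text \<open>By \<open>kernel_Lq\<close> this is, up to factors that do not involve \<gamma>, the
  \<open>L\<^sup>q\<close> norm of the kernel for \<open>unit_dir \<gamma> e\<close>; it is the same
  for every axis e.\<close>

definition direction_norm :: "nat \<Rightarrow> real \<Rightarrow> real \<Rightarrow> real" where
  "direction_norm n p \<gamma> = 1 / sqrt (1 + \<gamma>\<^sup>2) *
     (integral {0..pi} (\<lambda>\<phi>. integral {0..pi / 2} (\<lambda>\<theta>. F_integrand n p \<phi> \<theta> \<gamma>))) powr ((p - 1) / p)"

lemma kernel_trig_integral_F:
  fixes \<gamma> :: real
  assumes "p > 1"
  shows "kernel_trig_integral n (p / (p - 1)) (-1) n (n * \<gamma>) =
    integral {0..pi} (\<lambda>\<phi>. integral {0..pi / 2} (\<lambda>\<theta>. F_integrand n p \<phi> \<theta> \<gamma>))"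
proof -
  have e: "real n * (p / (p - 1) - 1) = real n / (p - 1)" using assms by (simp add: field_simps)
  have "\<bar>-1 + real n * (cos \<theta>)\<^sup>2 + real n * \<gamma> * (cos \<theta> * sin \<theta> * cos \<phi>)\<bar> powr (p / (p - 1)) * cos \<theta> powr (real n * (p / (p - 1) - 1)) *
     sin \<theta> ^ (n - 2) * sin \<phi> ^ (n - 3) = F_integrand n p \<phi> \<theta> \<gamma>" for \<phi> \<theta>
    unfolding F_integrand_def e by (simp add: mult.assoc)
  then show ?thesis unfolding kernel_trig_integral_def by (simp only:)
qed

text \<open>With q = p/(p-1) the outer exponent is 1/q: it undoes the q-th power of the normalising
  root and turns n - 1 - nq, the exponent of x_n, into (1-n-p)/p.\<close>

lemma kernel_Lq:
  fixes e :: "real ^ 'm::finite" and x :: "(real ^ 'm) \<times> real" and \<gamma> :: real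
  assumes e: "norm e = 1" and dim: "CARD('m) \<ge> 2" and x: "x \<in> half_space" and p: "p > 1"
    and n: "n = CARD('m) + 1"
  defines "k \<equiv> \<lambda>y. unit_dir \<gamma> e \<bullet> pker_grad n (x - (y, 0))"
  shows "integrable lebesgue (\<lambda>y. \<bar>k y\<bar> powr (p / (p - 1)))"
    and "(LINT y|lebesgue. \<bar>k y\<bar> powr (p / (p - 1))) powr ((p - 1) / p) =
      sphere_area (n - 2) powr ((p - 1) / p) * snd x powr ((1 - real n - p) / p) * direction_norm n p \<gamma>"
proof -
  define s where "s = sqrt (1 + \<gamma>\<^sup>2)"
  have "1 + \<gamma>\<^sup>2 > 0" by (simp add: add_pos_nonneg)
  then have s: "s > 0" by (simp add: s_def)
  have c: "snd x > 0" using x by (simp add: half_space_def)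
  have q: "p / (p - 1) > 1" using p by (simp add: field_simps)
  let ?J = "integral {0..pi} (\<lambda>\<phi>. integral {0..pi / 2} (\<lambda>\<theta>. F_integrand n p \<phi> \<theta> \<gamma>))"
  have sk: "\<bar>s * k y\<bar> powr r = s powr r * \<bar>k y\<bar> powr r" for y r
    using s by (simp add: abs_mult powr_mult)
  have I: "integrable lebesgue (\<lambda>y. \<bar>s * k y\<bar> powr (p / (p - 1)))"
    "(LINT y|lebesgue. \<bar>s * k y\<bar> powr (p / (p - 1))) =
      sphere_area (n - 2) * snd x powr (real n - 1 - real n * (p / (p - 1))) * ?J"
    using integral_kernel_power[OF e dim c q n, of "\<lambda>y. s * k y" "-1" "real n" "fst x" "real n * \<gamma>"]
    unfolding kernel_trig_integral_F[OF p] k_def s_def unit_dir_inner_pker_grad[OF c] by auto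
  show "integrable lebesgue (\<lambda>y. \<bar>k y\<bar> powr (p / (p - 1)))"
    using I(1) s unfolding sk by simp
  have J0: "?J \<ge> 0"
    unfolding F_integrand_def
    by (intro Henstock_integral_nonneg mult_nonneg_nonneg zero_le_power) (auto intro: sin_ge_zero)
  have "(LINT y|lebesgue. \<bar>k y\<bar> powr (p / (p - 1))) =
     (1 / s) powr (p / (p - 1)) * (sphere_area (n - 2) * snd x powr (real n - 1 - real n * (p / (p - 1))) * ?J)"
    using I(2) s unfolding sk by (simp add: powr_divide field_simps)
  then have "(LINT y|lebesgue. \<bar>k y\<bar> powr (p / (p - 1))) powr ((p - 1) / p) =
     ((1 / s) powr (p / (p - 1))) powr ((p - 1) / p) * (sphere_area (n - 2) powr ((p - 1) / p) *
       (snd x powr (real n - 1 - real n * (p / (p - 1)))) powr ((p - 1) / p) * ?J powr ((p - 1) / p))"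
    using J0 by (simp add: powr_mult sphere_area_def)
  also have "((1 / s) powr (p / (p - 1))) powr ((p - 1) / p) = 1 / s"
    using s p by (simp add: powr_powr)
  also have "(snd x powr (real n - 1 - real n * (p / (p - 1)))) powr ((p - 1) / p) = snd x powr ((1 - real n - p) / p)"
  proof -
    have "(real n - 1 - real n * (p / (p - 1))) * ((p - 1) / p) = (1 - real n - p) / p"
      using p by (simp add: field_simps)
    then show ?thesis by (simp only: powr_powr)
  qed
  finally show "(LINT y|lebesgue. \<bar>k y\<bar> powr (p / (p - 1))) powr ((p - 1) / p) =
      sphere_area (n - 2) powr ((p - 1) / p) * snd x powr ((1 - real n - p) / p) * direction_norm n p \<gamma>"
    by (simp add: direction_norm_def s_def mult_ac)
qed

text \<open>The same polar computation with \<alpha> = 1 and \<beta> = \<delta> = 0, where the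
  choice of axis is immaterial.\<close>

lemma inverse_distance_Lq:
  fixes x :: "(real ^ 'm::finite) \<times> real"
  assumes dim: "CARD('m) \<ge> 2" and x: "x \<in> half_space" and q: "q > 1"
  shows "integrable lebesgue (\<lambda>y. \<bar>1 / norm (x - (y, 0)) ^ (CARD('m) + 1)\<bar> powr q)"
proof -
  obtain e :: "real ^ 'm" where "e \<in> Basis" using nonempty_Basis by blast
  then have e: "norm e = 1" by simp
  have c: "snd x > 0" using x by (simp add: half_space_def)
  have R: "norm (x - (y, 0)) = sqrt ((norm (y - fst x))\<^sup>2 + (snd x)\<^sup>2)" for y
    by (simp add: norm_prod_def norm_minus_commute)
  show ?thesis
    by (rule integral_kernel_power(1)[OF e dim c q refl, of _ 1 0 "fst x" 0]) (simp add: R)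
qed

section \<open>Hoelder's inequality\<close>

text \<open>Young's inequality is applied pointwise to f and g divided by their norms. If one of the
  norms is 0, the product vanishes almost everywhere.\<close>

lemma Holder_integral:
  fixes f g :: "'a \<Rightarrow> real"
  assumes p: "p > 1" and q: "q = p / (p - 1)"
    and [measurable]: "f \<in> borel_measurable M" "g \<in> borel_measurable M"
    and f: "integrable M (\<lambda>y. \<bar>f y\<bar> powr p)" and g: "integrable M (\<lambda>y. \<bar>g y\<bar> powr q)"
  shows "integrable M (\<lambda>y. f y * g y)"
    and "\<bar>LINT y|M. f y * g y\<bar> \<le> (LINT y|M. \<bar>f y\<bar> powr p) powr (1 / p) * (LINT y|M. \<bar>g y\<bar> powr q) powr ((p - 1) / p)"
proof -
  have q1: "q > 1" "1 / p + 1 / q = 1" using p by (simp_all add: q field_simps)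
  have pq: "(p - 1) / p = 1 / q" using p by (simp add: q)
  have int: "integrable M (\<lambda>y. a * (\<bar>f y\<bar> powr p) + b * (\<bar>g y\<bar> powr q))" for a b
    using f g by simp
  show fg: "integrable M (\<lambda>y. f y * g y)"
  proof (rule integrable_norm_le[OF int[of "1/p" "1/q"]])
    show "norm (f y * g y) \<le> 1 / p * (\<bar>f y\<bar> powr p) + 1 / q * (\<bar>g y\<bar> powr q)" for y
      using Youngs_inequality[OF p q1, of "\<bar>f y\<bar>" "\<bar>g y\<bar>"] by (simp add: abs_mult)
  qed measurable
  define I where "I = (LINT y|M. \<bar>f y\<bar> powr p)"
  define K where "K = (LINT y|M. \<bar>g y\<bar> powr q)"
  have I0: "I \<ge> 0" "K \<ge> 0" by (simp_all add: I_def K_def)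
  show "\<bar>LINT y|M. f y * g y\<bar> \<le> (LINT y|M. \<bar>f y\<bar> powr p) powr (1 / p) * (LINT y|M. \<bar>g y\<bar> powr q) powr ((p - 1) / p)"
  proof (cases "I = 0 \<or> K = 0")
    case True
    then have "AE y in M. \<bar>f y\<bar> powr p = 0 \<or> \<bar>g y\<bar> powr q = 0"
    proof
      assume "I = 0"
      then have "AE y in M. \<bar>f y\<bar> powr p = 0"
        unfolding I_def by (subst (asm) integral_nonneg_eq_0_iff_AE[OF f]) auto
      then show ?thesis by (rule AE_mp) simp
    next
      assume "K = 0"
      then have "AE y in M. \<bar>g y\<bar> powr q = 0"
        unfolding K_def by (subst (asm) integral_nonneg_eq_0_iff_AE[OF g]) auto
      then show ?thesis by (rule AE_mp) simp
    qed
    then have "AE y in M. f y * g y = 0" by (rule AE_mp) auto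
    then have "(LINT y|M. f y * g y) = 0" by (rule integral_eq_zero_AE)
    then show ?thesis by simp
  next
    case False
    define A where "A = I powr (1 / p)"
    define B where "B = K powr (1 / q)"
    have AB: "A > 0" "B > 0" using False I0 by (simp_all add: A_def B_def)
    have Ap: "A powr p = I" "B powr q = K" using False I0 p q1 by (simp_all add: A_def B_def powr_powr)
    \<comment> \<open>Since \<open>A powr p = I\<close> and \<open>B powr q = K\<close>, normalising
      by \<open>A\<close> and \<open>B\<close> divides the powers by \<open>I\<close> and
      \<open>K\<close>; the integral of the right side is then A B (1/p + 1/q).\<close>
    have pt: "\<bar>f y * g y\<bar> \<le> A * B / (p * I) * (\<bar>f y\<bar> powr p) + A * B / (q * K) * (\<bar>g y\<bar> powr q)" for y
    proof -
      have "\<bar>f y * g y\<bar> = A * B * ((\<bar>f y\<bar> / A) * (\<bar>g y\<bar> / B))" using AB by (simp add: abs_mult)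
      also have "\<dots> \<le> A * B * ((\<bar>f y\<bar> / A) powr p / p + (\<bar>g y\<bar> / B) powr q / q)"
        using AB by (intro mult_left_mono Youngs_inequality[OF p q1]) auto
      also have "\<dots> = A * B / (p * I) * (\<bar>f y\<bar> powr p) + A * B / (q * K) * (\<bar>g y\<bar> powr q)"
        using AB by (simp add: powr_divide Ap distrib_left mult.commute)
      finally show ?thesis .
    qed
    have "\<bar>LINT y|M. f y * g y\<bar> \<le> (LINT y|M. \<bar>f y * g y\<bar>)"
      using integral_abs_bound[of M "\<lambda>y. f y * g y"] .
    also have "\<dots> \<le> (LINT y|M. A * B / (p * I) * (\<bar>f y\<bar> powr p) + A * B / (q * K) * (\<bar>g y\<bar> powr q))"
      by (rule integral_mono[OF integrable_abs[OF fg] int pt])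
    also have "\<dots> = A * B / (p * I) * I + A * B / (q * K) * K"
      using f g by (simp add: I_def K_def)
    also have "\<dots> = A * B * (1 / p + 1 / q)" using False by (simp add: distrib_left)
    finally show ?thesis unfolding q1(2) by (simp add: A_def B_def I_def K_def pq)
  qed
qed

subsection \<open>Sharpness\<close>

text \<open>For p = 1 the weight is bounded by a power of the height of x; for p > 1 it lies in
  \<open>L\<^sup>q\<close> and Hoelder's inequality applies.\<close>

lemma Lp_space_poisson_admissible:
  fixes f :: "real ^ 'm::finite \<Rightarrow> real"
  assumes dim: "CARD('m) \<ge> 2" and p: "p \<ge> 1" and f: "f \<in> Lp_space p"
  shows "poisson_admissible f"
  unfolding poisson_admissible_def
proof (intro conjI ballI)
  show fm: "f \<in> borel_measurable lebesgue" using f by (simp add: Lp_space_def)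
  have fi: "integrable lebesgue (\<lambda>y. \<bar>f y\<bar> powr p)" using f by (simp add: Lp_space_def)
  fix x :: "(real ^ 'm) \<times> real" assume x: "x \<in> half_space"
  have c: "snd x > 0" using x by (simp add: half_space_def)
  define n where "n = CARD('m) + 1"
  have Rm: "(\<lambda>y. 1 / norm (x - (y, 0)) ^ n) \<in> borel_measurable lebesgue"
    using half_space_diff_nonzero[OF x]
    by (intro measurable_completion) (auto intro!: borel_measurable_continuous_onI continuous_intros)
  have "integrable lebesgue (\<lambda>y. f y * (1 / norm (x - (y, 0)) ^ n))"
  proof (cases "p = 1")
    case True
    show ?thesis
    proof (rule integrable_norm_le)
      show "integrable lebesgue (\<lambda>y. 1 / snd x ^ n * (\<bar>f y\<bar> powr p))" using fi by simp
      show "(\<lambda>y. f y * (1 / norm (x - (y, 0)) ^ n)) \<in> borel_measurable lebesgue"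
        using fm Rm by (rule borel_measurable_times)
      show "norm (f y * (1 / norm (x - (y, 0)) ^ n)) \<le> 1 / snd x ^ n * (\<bar>f y\<bar> powr p)" for y
      proof -
        have "1 / norm (x - (y, 0)) ^ n \<le> 1 / snd x ^ n"
          using c snd_le_norm_half_space[OF x, of y] half_space_diff_nonzero[OF x, of y]
          by (intro divide_left_mono power_mono mult_pos_pos zero_less_power) auto
        then have "\<bar>f y\<bar> * (1 / norm (x - (y, 0)) ^ n) \<le> \<bar>f y\<bar> * (1 / snd x ^ n)"
          by (rule mult_left_mono) simp
        then show ?thesis using True by (simp add: abs_mult)
      qed
    qed
  next
    case False
    then have p1: "p > 1" using p by simp
    then have "p / (p - 1) > 1" by (simp add: field_simps)
    from inverse_distance_Lq[OF dim x this] show ?thesis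
      unfolding n_def[symmetric] by (rule Holder_integral(1)[OF p1 refl fm Rm fi])
  qed
  then show "integrable lebesgue (\<lambda>y. f y / norm (x - (y, 0)) ^ (CARD('m) + 1))"
    by (simp add: n_def)
qed

lemma pker_grad_measurable:
  assumes "x \<in> half_space"
  shows "(\<lambda>y. pker_grad n (x - (y, 0))) \<in> borel_measurable lebesgue"
proof (rule measurable_completion)
  have "snd x > 0" using assms by (simp add: half_space_def)
  from borel_measurable_half_space_slice[OF continuous_pker_grad this]
  show "(\<lambda>y. pker_grad n (x - (y, 0))) \<in> borel_measurable lborel" by (simp only: measurable_lborel2)
qed

lemma inner_pker_grad_measurable:
  assumes "x \<in> half_space"
  shows "(\<lambda>y. z \<bullet> pker_grad n (x - (y, 0))) \<in> borel_measurable lebesgue"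
  by (intro borel_measurable_inner borel_measurable_const pker_grad_measurable[OF assms])

lemma inner_poisson_grad:
  fixes f :: "real ^ 'm::finite \<Rightarrow> real"
  assumes f: "poisson_admissible f" and x: "x \<in> half_space"
  shows "z \<bullet> poisson_grad f x = 2 / sphere_area (CARD('m) + 1) *
     (LINT y|lebesgue. f y * (z \<bullet> pker_grad (CARD('m) + 1) (x - (y, 0))))"
proof -
  define n where "n = CARD('m) + 1"
  have "f \<in> borel_measurable lebesgue" using f by (simp add: poisson_admissible_def)
  then have m: "(\<lambda>y. f y *\<^sub>R pker_grad n (x - (y, 0))) \<in> borel_measurable lebesgue"
    by (intro borel_measurable_scaleR pker_grad_measurable[OF x])
  have "integrable lebesgue (\<lambda>y. f y / norm (x - (y, 0)) ^ n)"
    using f x by (simp only: poisson_admissible_def n_def)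
  then have "integrable lebesgue (\<lambda>y. (real n + 1) * \<bar>f y / norm (x - (y, 0)) ^ n\<bar>)"
    by (intro integrable_mult_right integrable_abs)
  then have "integrable lebesgue (\<lambda>y. f y *\<^sub>R pker_grad n (x - (y, 0)))"
  proof (rule integrable_norm_le[OF _ m])
    show "norm (f y *\<^sub>R pker_grad n (x - (y, 0))) \<le> (real n + 1) * \<bar>f y / norm (x - (y, 0)) ^ n\<bar>" for y
      using mult_left_mono[OF norm_pker_grad[OF half_space_diff_nonzero[OF x, of y], of n], of "\<bar>f y\<bar>"]
      by (simp add: power_abs mult_ac)
  qed
  then have "(LINT y|lebesgue. z \<bullet> (f y *\<^sub>R pker_grad n (x - (y, 0)))) =
      z \<bullet> (LINT y|lebesgue. f y *\<^sub>R pker_grad n (x - (y, 0)))"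
    by (intro integral_inner_right)
  then show ?thesis by (simp add: poisson_grad_def n_def)
qed

text \<open>The function \<open>u\<close> is a Poisson integral only on the half space; as this set
  is open, that determines the derivatives at \<open>x\<close>.\<close>

lemma boundary_values_gradient:
  fixes f :: "real ^ 'm::finite \<Rightarrow> real"
  assumes dim: "CARD('m) \<ge> 2" and p: "p \<ge> 1" and u: "boundary_values p u f" and x: "x \<in> half_space"
  shows "grad u x = poisson_grad f x" and "normal_deriv u x = (0, 1) \<bullet> poisson_grad f x"
proof -
  have "poisson_admissible f"
    using u by (intro Lp_space_poisson_admissible[OF dim p]) (simp add: boundary_values_def)
  from poisson_integral_has_gradient[OF this x]
  have "(poisson_integral f has_derivative (\<lambda>h. h \<bullet> poisson_grad f x)) (at x)"
    by (simp add: gderiv_def)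
  then have d: "(u has_derivative (\<lambda>h. h \<bullet> poisson_grad f x)) (at x)"
  proof (rule has_derivative_transform_within_open[OF _ open_half_space x])
    show "poisson_integral f y = u y" if "y \<in> half_space" for y
      using u that by (simp add: boundary_values_def)
  qed
  then show "grad u x = poisson_grad f x" by (intro grad_eq) (simp add: gderiv_def)
  have "((\<lambda>t. (fst x, t)) has_derivative (\<lambda>h. (0, h))) (at (snd x))"
    by (auto intro!: derivative_eq_intros)
  moreover have "(u has_derivative (\<lambda>h. h \<bullet> poisson_grad f x)) (at (fst x, snd x))"
    using d by (simp only: prod.collapse)
  ultimately have "((\<lambda>t. u (fst x, t)) has_derivative (\<lambda>h. (0, h) \<bullet> poisson_grad f x)) (at (snd x))"
    by (rule has_derivative_compose)
  moreover have "(\<lambda>h. (0, h) \<bullet> poisson_grad f x) = (*) ((0, 1) \<bullet> poisson_grad f x)"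
    by (rule ext, cases "poisson_grad f x") simp
  ultimately have "((\<lambda>t. u (fst x, t)) has_derivative (*) ((0, 1) \<bullet> poisson_grad f x)) (at (snd x))"
    by (simp only:)
  then have "((\<lambda>t. u (fst x, t)) has_real_derivative (0, 1) \<bullet> poisson_grad f x) (at (snd x))"
    by (rule has_derivative_imp_has_field_derivative) simp
  then show "normal_deriv u x = (0, 1) \<bullet> poisson_grad f x"
    unfolding normal_deriv_def by (rule DERIV_imp_deriv)
qed

text \<open>Every \<open>L\<^sup>p\<close> function thereby becomes a legitimate test function for
  lower bounds.\<close>

lemma Lp_space_hardy_space:
  fixes f :: "real ^ 'm::finite \<Rightarrow> real"
  assumes dim: "CARD('m) \<ge> 2" and p: "p \<ge> 1" and f: "f \<in> Lp_space p"
  shows "poisson_integral f \<in> hardy_space p" "boundary_values p (poisson_integral f) f"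
proof -
  show b: "boundary_values p (poisson_integral f) f"
    using f unfolding boundary_values_def by blast
  show "poisson_integral f \<in> hardy_space p"
    using b poisson_integral_harmonic[OF Lp_space_poisson_admissible[OF assms]]
    unfolding hardy_space_def by blast
qed

lemma hardy_boundD:
  fixes f :: "real ^ 'm::finite \<Rightarrow> real"
  assumes "hardy_bound p T C" "CARD('m) \<ge> 2" "p \<ge> 1" "f \<in> Lp_space p"
  shows "T (poisson_integral f) \<le> C * Lp_norm p f"
  using assms(1) Lp_space_hardy_space[OF assms(2-4)] unfolding hardy_bound_def by blast

lemma indicator_ball_Lp:
  fixes a :: "'a::euclidean_space"
  assumes r: "r > 0" and p: "p \<ge> 1"
  shows "indicat_real (ball a r) \<in> Lp_space p"
    and "Lp_norm p (indicat_real (ball a r)) = measure lebesgue (ball a r) powr (1 / p)"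
    and "measure lebesgue (ball a r) > 0"
proof -
  have eq: "(\<lambda>y. \<bar>indicat_real (ball a r) y\<bar> powr p) = indicat_real (ball a r)"
    using p by (auto simp: indicator_def)
  show "indicat_real (ball a r) \<in> Lp_space p"
    unfolding Lp_space_def mem_Collect_eq eq
  proof
    show i: "integrable lebesgue (indicat_real (ball a r))"
      using emeasure_bounded_finite[OF bounded_ball, of a r] by (intro integrable_real_indicator) auto
    show "indicat_real (ball a r) \<in> borel_measurable lebesgue"
      using i by (rule borel_measurable_integrable)
  qed
  show "Lp_norm p (indicat_real (ball a r)) = measure lebesgue (ball a r) powr (1 / p)"
    unfolding Lp_norm_def eq by simp
  show "measure lebesgue (ball a r) > 0" using r by (simp add: content_ball_pos)
qed

section \<open>Lower bounds for p > 1 and boundedness of the supremum\<close>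

text \<open>The indicator of a ball has positive norm, so it detects the sign of C. This settles the
  case of a kernel whose norm is 0.\<close>

lemma hardy_bound_nonneg:
  fixes T :: "((real ^ 'm::finite) \<times> real \<Rightarrow> real) \<Rightarrow> real"
  assumes C: "hardy_bound p T C" and dim: "CARD('m) \<ge> 2" and p: "p \<ge> 1" and T: "\<And>u. 0 \<le> T u"
  shows "0 \<le> C"
proof -
  let ?f = "indicat_real (ball (0 :: real ^ 'm) 1)"
  have "0 \<le> C * Lp_norm p ?f"
    using hardy_boundD[OF C dim p indicator_ball_Lp(1)[of 1 p 0]] T[of "poisson_integral ?f"] p by simp
  moreover have "Lp_norm p ?f > 0"
    using indicator_ball_Lp(2,3)[of 1 p "0 :: real ^ 'm"] p by simp
  ultimately show ?thesis by (simp add: zero_le_mult_iff)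
qed

text \<open>The extremal boundary values in Hoelder's inequality, \<open>sgn k * \<bar>k\<bar> powr (q - 1)\<close> for the kernel \<open>k\<close>
  of the derivative in direction \<open>z\<close>, show that no constant below the \<open>L\<^sup>q\<close> norm of the kernel is admissible.\<close>

lemma hardy_bound_ge_kernel_norm:
  fixes x z :: "(real ^ 'm::finite) \<times> real" and T :: "((real ^ 'm) \<times> real \<Rightarrow> real) \<Rightarrow> real"
  assumes C: "hardy_bound p T C" and dim: "CARD('m) \<ge> 2" and p: "p > 1" and x: "x \<in> half_space"
    and T: "\<And>u. 0 \<le> T u" and Tz: "\<And>f. f \<in> Lp_space p \<Longrightarrow> z \<bullet> poisson_grad f x \<le> T (poisson_integral f)"
    and int: "integrable lebesgue (\<lambda>y. \<bar>z \<bullet> pker_grad (CARD('m) + 1) (x - (y, 0))\<bar> powr (p / (p - 1)))"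
  shows "2 / sphere_area (CARD('m) + 1) *
    (LINT y|lebesgue. \<bar>z \<bullet> pker_grad (CARD('m) + 1) (x - (y, 0))\<bar> powr (p / (p - 1))) powr ((p - 1) / p) \<le> C"
proof -
  define n where "n = CARD('m) + 1"
  define k where "k y = z \<bullet> pker_grad n (x - (y, 0))" for y
  define q where "q = p / (p - 1)"
  define f where "f y = sgn (k y) * \<bar>k y\<bar> powr (q - 1)" for y
  define N where "N = (LINT y|lebesgue. \<bar>k y\<bar> powr q)"
  \<comment> \<open>The identity (q-1)p = q makes both |f|^p and f k equal to |k|^q, so that testing
    with f leaves only powers of \<open>N\<close>.\<close>
  have q1: "q > 1" "(q - 1) * p = q" using p by (simp_all add: q_def field_simps)
  have km[measurable]: "k \<in> borel_measurable lebesgue"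
    unfolding k_def by (rule inner_pker_grad_measurable[OF x])
  have fp: "\<bar>f y\<bar> powr p = \<bar>k y\<bar> powr q" for y
    using q1 by (cases "k y = 0") (simp_all add: f_def abs_mult powr_powr abs_sgn_eq)
  have fk: "f y * k y = \<bar>k y\<bar> powr q" for y
  proof (cases "k y = 0")
    case False
    have "f y * k y = k y * sgn (k y) * \<bar>k y\<bar> powr (q - 1)"
      by (simp add: f_def mult_ac)
    also have "\<dots> = \<bar>k y\<bar> powr (1 + (q - 1))"
      unfolding abs_sgn[symmetric] by (rule powr_mult_base) simp
    finally show ?thesis by simp
  qed (use q1 in simp)
  have ik: "integrable lebesgue (\<lambda>y. \<bar>k y\<bar> powr q)"
    using int by (simp only: k_def[abs_def] n_def q_def)
  have f: "f \<in> Lp_space p"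
    unfolding Lp_space_def mem_Collect_eq fp using ik unfolding f_def[abs_def] by simp
  have norm: "Lp_norm p f = N powr (1 / p)" unfolding Lp_norm_def fp N_def ..
  have "z \<bullet> poisson_grad f x = 2 / sphere_area n * N"
    using inner_poisson_grad[OF Lp_space_poisson_admissible[OF dim _ f] x, of z] p
    unfolding n_def[symmetric] k_def[symmetric] fk N_def by simp
  then have le: "2 / sphere_area n * N \<le> C * N powr (1 / p)"
    using Tz[OF f] hardy_boundD[OF C dim _ f] p by (simp add: norm)
  have N0: "N \<ge> 0" unfolding N_def by simp
  have "2 / sphere_area n * N powr ((p - 1) / p) \<le> C"
  proof (cases "N = 0")
    \<comment> \<open>If \<open>N\<close> is 0, the test function vanishes almost everywhere and
      gives no information; the claim is then just C >= 0.\<close>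
    case True
    then show ?thesis using hardy_bound_nonneg[OF C dim _ T] p by simp
  next
    case False
    then have "N > 0" using N0 by simp
    then have "N = N powr ((p - 1) / p) * N powr (1 / p)"
      using p by (simp add: powr_add[symmetric] diff_divide_distrib)
    then have "2 / sphere_area n * N powr ((p - 1) / p) * N powr (1 / p) \<le> C * N powr (1 / p)"
      using le by (simp only: mult.assoc)
    from mult_right_le_imp_le[OF this] \<open>N > 0\<close> show ?thesis by simp
  qed
  then show ?thesis by (simp only: N_def k_def n_def q_def)
qed

text \<open>A unit direction sees at most the norm of the kernel gradient, which is bounded by (n+1)
  / |x - (y, 0)|^n independently of \<gamma>. Without a bound the supremum in
  \<open>grad_const\<close> could not be used as an upper bound.\<close>

lemma direction_norm_bdd_above:
  assumes n: "n = CARD('m::finite) + 1" and dim: "CARD('m) \<ge> 2" and p: "p > 1"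
  shows "bdd_above (direction_norm n p ` {0..})"
proof -
  obtain e :: "real ^ 'm" where "e \<in> Basis" using nonempty_Basis by blast
  then have e: "norm e = 1" by simp
  \<comment> \<open>The quantity to be bounded does not depend on the point; at height 1 the power
    of x_n in \<open>kernel_Lq\<close> is 1.\<close>
  define x :: "(real ^ 'm) \<times> real" where "x = (0, 1)"
  have x: "x \<in> half_space" by (simp add: x_def half_space_def)
  have q: "p / (p - 1) > 1" using p by (simp add: field_simps)
  let ?q = "p / (p - 1)"
  define B where "B = (LINT y|lebesgue. (real n + 1) powr ?q * \<bar>1 / norm (x - (y, 0)) ^ n\<bar> powr ?q)"
  have w: "sphere_area (n - 2) powr ((p - 1) / p) > 0"
    using sphere_area_pos[of "n - 2"] n dim by simp
  have "direction_norm n p \<gamma> \<le> B powr ((p - 1) / p) / sphere_area (n - 2) powr ((p - 1) / p)" for \<gamma>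
  proof -
    let ?k = "\<lambda>y. unit_dir \<gamma> e \<bullet> pker_grad n (x - (y, 0))"
    note L = kernel_Lq[OF e dim x p n, of \<gamma>]
    have "(LINT y|lebesgue. \<bar>?k y\<bar> powr ?q) \<le> B"
      unfolding B_def
    proof (rule integral_mono[OF L(1)])
      show "integrable lebesgue (\<lambda>y. (real n + 1) powr ?q * \<bar>1 / norm (x - (y, 0)) ^ n\<bar> powr ?q)"
        using inverse_distance_Lq[OF dim x q] unfolding n by (rule integrable_mult_right)
      show "\<bar>?k y\<bar> powr ?q \<le> (real n + 1) powr ?q * \<bar>1 / norm (x - (y, 0)) ^ n\<bar> powr ?q" for y
      proof -
        have "\<bar>?k y\<bar> \<le> norm (pker_grad n (x - (y, 0)))"
          using Cauchy_Schwarz_ineq2[of "unit_dir \<gamma> e" "pker_grad n (x - (y, 0))"] norm_unit_dir[OF e, of \<gamma>] by simp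
        also have "\<dots> \<le> (real n + 1) * \<bar>1 / norm (x - (y, 0)) ^ n\<bar>"
          using norm_pker_grad[OF half_space_diff_nonzero[OF x, of y], of n] by (simp add: power_abs)
        finally have "\<bar>?k y\<bar> powr ?q \<le> ((real n + 1) * \<bar>1 / norm (x - (y, 0)) ^ n\<bar>) powr ?q"
          using q by (intro powr_mono2) auto
        also have "\<dots> = (real n + 1) powr ?q * \<bar>1 / norm (x - (y, 0)) ^ n\<bar> powr ?q"
          by (rule powr_mult)
        finally show ?thesis .
      qed
    qed
    then have "(LINT y|lebesgue. \<bar>?k y\<bar> powr ?q) powr ((p - 1) / p) \<le> B powr ((p - 1) / p)"
      using p by (intro powr_mono2) auto
    then have "sphere_area (n - 2) powr ((p - 1) / p) * direction_norm n p \<gamma> \<le> B powr ((p - 1) / p)"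
      unfolding L(2) by (simp add: x_def)
    then show ?thesis using w by (simp add: pos_le_divide_eq mult.commute)
  qed
  then show ?thesis by (auto simp: bdd_above_def)
qed

section \<open>The upper bound for the gradient, and p = 1\<close>

text \<open>If D is not horizontal, D or -D points down and can be tested itself. A horizontal D is
  tilted by a small vertical vector, which is orthogonal to D and so leaves the inner product equal
  to |D|^2.\<close>

lemma norm_le_of_downward:
  fixes D :: "'a::euclidean_space \<times> real"
  assumes M: "\<And>z. snd z < 0 \<Longrightarrow> \<bar>z \<bullet> D\<bar> \<le> M * norm z"
  shows "norm D \<le> M"
proof -
  have M0: "M \<ge> 0"
  proof -
    have "0 \<le> \<bar>(0, -1) \<bullet> D\<bar>" by simp
    also have "\<dots> \<le> M * norm ((0 :: 'a), -1 :: real)" by (rule M) simp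
    finally show ?thesis by (simp add: norm_Pair)
  qed
  have "(norm D)\<^sup>2 \<le> M * norm D + \<epsilon>" if "\<epsilon> > 0" for \<epsilon>
  proof -
    \<comment> \<open>The tilt is chosen with M t <= \<epsilon>; the denominator M + 1 is safe when
      M = 0.\<close>
    define t where "t = (if snd D = 0 then \<epsilon> / (M + 1) else 0)"
    define z where "z = (if snd D > 0 then - D else D - (0, t))"
    have t: "t \<ge> 0" "M * t \<le> \<epsilon>"
    proof -
      show "t \<ge> 0" using that M0 by (simp add: t_def)
      have "M * (\<epsilon> / (M + 1)) \<le> \<epsilon>" using that M0 by (simp add: field_simps)
      then show "M * t \<le> \<epsilon>" using that by (simp add: t_def)
    qed
    have "snd z < 0" using that M0 by (auto simp: z_def t_def add_nonneg_pos)
    from M[OF this] have "\<bar>z \<bullet> D\<bar> \<le> M * norm z" .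
    moreover have "\<bar>z \<bullet> D\<bar> = (norm D)\<^sup>2"
    proof (cases "snd D > 0")
      case True
      then show ?thesis by (simp add: z_def power2_norm_eq_inner)
    next
      case False
      have "(0, t) \<bullet> D = 0" by (cases D) (simp add: t_def)
      then show ?thesis using False by (simp add: z_def inner_diff_left power2_norm_eq_inner)
    qed
    moreover have "norm z \<le> norm D + t"
      using norm_triangle_ineq4[of D "(0, t)"] t(1) by (auto simp: z_def norm_Pair simp del: diff_Pair)
    ultimately have "(norm D)\<^sup>2 \<le> M * (norm D + t)"
      using mult_left_mono[OF _ M0] by (metis order_trans)
    then show ?thesis using t(2) by (simp add: distrib_left)
  qed
  then have "norm D * norm D \<le> M * norm D"
    by (metis field_le_epsilon power2_eq_square)
  then show ?thesis using M0 by (cases "norm D = 0") (auto simp: mult_le_cancel_right)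
qed

lemma grad_const_eq_Sup:
  assumes "p \<noteq> 1"
  shows "grad_const n p = 2 * sphere_area (n - 2) powr ((p - 1) / p) / sphere_area n * (SUP \<gamma>\<in>{0..}. direction_norm n p \<gamma>)"
  using assms by (simp add: grad_const_def direction_norm_def)

text \<open>Hoelder's inequality bounds each downward derivative by its own kernel norm. That norm
  depends on the direction only through \<gamma>, so the supremum over \<gamma> is uniform in the
  axis as well.\<close>

lemma norm_poisson_grad_le:
  fixes f :: "real ^ 'm::finite \<Rightarrow> real"
  assumes dim: "CARD('m) \<ge> 2" and n: "n = CARD('m) + 1" and p: "p > 1" and f: "f \<in> Lp_space p" and x: "x \<in> half_space"
  shows "norm (poisson_grad f x) \<le> grad_const n p * snd x powr ((1 - real n - p) / p) * Lp_norm p f"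
proof (rule norm_le_of_downward)
  fix z :: "(real ^ 'm) \<times> real" assume "snd z < 0"
  then obtain \<gamma> e where ge: "\<gamma> \<ge> 0" "norm e = 1" and z: "z = norm z *\<^sub>R unit_dir \<gamma> e"
    by (rule unit_dir_representation)
  let ?k = "\<lambda>y. unit_dir \<gamma> e \<bullet> pker_grad n (x - (y, 0))"
  note L = kernel_Lq[OF ge(2) dim x p n, of \<gamma>]
  have fm: "f \<in> borel_measurable lebesgue" "integrable lebesgue (\<lambda>y. \<bar>f y\<bar> powr p)"
    using f by (simp_all add: Lp_space_def)
  have adm: "poisson_admissible f" using p by (intro Lp_space_poisson_admissible[OF dim _ f]) simp
  have w0: "sphere_area n > 0" by (rule sphere_area_pos) (simp add: n)
  have "\<bar>unit_dir \<gamma> e \<bullet> poisson_grad f x\<bar> = 2 / sphere_area n * \<bar>LINT y|lebesgue. f y * ?k y\<bar>"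
    unfolding inner_poisson_grad[OF adm x] n using w0 by (simp add: abs_mult n)
  also have "\<dots> \<le> 2 / sphere_area n * (Lp_norm p f * (sphere_area (n - 2) powr ((p - 1) / p) *
      snd x powr ((1 - real n - p) / p) * direction_norm n p \<gamma>))"
    using Holder_integral(2)[OF p refl fm(1) inner_pker_grad_measurable[OF x] fm(2) L(1)] w0
    unfolding L(2) Lp_norm_def by (intro mult_left_mono) auto
  also have "\<dots> \<le> 2 / sphere_area n * (Lp_norm p f * (sphere_area (n - 2) powr ((p - 1) / p) *
      snd x powr ((1 - real n - p) / p) * (SUP \<gamma>\<in>{0..}. direction_norm n p \<gamma>)))"
    using w0 ge(1) by (intro mult_left_mono cSUP_upper direction_norm_bdd_above[OF n dim p]) (auto simp: Lp_norm_def)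
  also have "\<dots> = grad_const n p * snd x powr ((1 - real n - p) / p) * Lp_norm p f"
    using p by (simp add: grad_const_eq_Sup)
  finally have "\<bar>unit_dir \<gamma> e \<bullet> poisson_grad f x\<bar> \<le> grad_const n p * snd x powr ((1 - real n - p) / p) * Lp_norm p f" .
  from mult_left_mono[OF this norm_ge_zero[of z]]
  have "\<bar>(norm z *\<^sub>R unit_dir \<gamma> e) \<bullet> poisson_grad f x\<bar> \<le> grad_const n p * snd x powr ((1 - real n - p) / p) * Lp_norm p f * norm z"
    by (simp add: abs_mult mult.commute)
  then show "\<bar>z \<bullet> poisson_grad f x\<bar> \<le> grad_const n p * snd x powr ((1 - real n - p) / p) * Lp_norm p f * norm z"
    by (simp only: z[symmetric])
qed

lemma hardy_bound_ge_direction_norm: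
  fixes e :: "real ^ 'm::finite" and x :: "(real ^ 'm) \<times> real" and T :: "((real ^ 'm) \<times> real \<Rightarrow> real) \<Rightarrow> real"
  assumes C: "hardy_bound p T C" and dim: "CARD('m) \<ge> 2" and n: "n = CARD('m) + 1" and p: "p > 1" and x: "x \<in> half_space"
    and e: "norm e = 1" and T: "\<And>u. 0 \<le> T u"
    and Tz: "\<And>f. f \<in> Lp_space p \<Longrightarrow> unit_dir \<gamma> e \<bullet> poisson_grad f x \<le> T (poisson_integral f)"
  shows "2 * sphere_area (n - 2) powr ((p - 1) / p) / sphere_area n * direction_norm n p \<gamma> * snd x powr ((1 - real n - p) / p) \<le> C"
  using hardy_bound_ge_kernel_norm[OF C dim p x T Tz kernel_Lq(1)[OF e dim x p n, unfolded n]]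
  unfolding n[symmetric] kernel_Lq(2)[OF e dim x p n] by (simp add: mult_ac)

text \<open>With c = snd v and R = |v|, the vector \<open>w\<close> has squared norm 1 + n(n-2)
  c^2/R^2, at most (n-1)^2 since c <= R and n >= 2. The remaining factor R^(-n) is at most c^(-n);
  both estimates become equalities for vertical v.\<close>

lemma norm_pker_grad_le:
  fixes v :: "'a::euclidean_space \<times> real"
  assumes v: "snd v > 0" and n: "n \<ge> 2"
  shows "norm (pker_grad n v) \<le> (real n - 1) / snd v ^ n"
proof -
  define c where "c = snd v"
  define R where "R = norm v"
  define w :: "'a \<times> real" where "w = (0, 1) - (n * c / R\<^sup>2) *\<^sub>R v"
  have c: "c > 0" "c \<le> R" using v abs_snd_le_norm[of v] by (auto simp: c_def R_def)
  then have R: "R > 0" by simp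
  have g: "pker_grad n v = (1 / R ^ n) *\<^sub>R w"
    by (simp add: pker_grad_def w_def scaleR_diff_right c_def R_def power_add power2_eq_square)
  have "(norm w)\<^sup>2 = 1 - 2 * (n * c / R\<^sup>2) * c + (n * c / R\<^sup>2)\<^sup>2 * R\<^sup>2"
  proof -
    have ip: "(0, 1) \<bullet> v = c" "v \<bullet> (0, 1) = c" "v \<bullet> v = R\<^sup>2" "((0 :: 'a), 1 :: real) \<bullet> (0, 1) = 1"
      by (simp_all add: inner_prod_def[of v] inner_prod_def[of _ v] c_def R_def power2_norm_eq_inner)
    have "(norm ((0, 1) - a *\<^sub>R v))\<^sup>2 = 1 - 2 * a * c + a\<^sup>2 * R\<^sup>2" for a
      unfolding power2_norm_eq_inner inner_diff_left inner_diff_right inner_scaleR_left inner_scaleR_right ip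
      by (simp add: power2_eq_square[of a] right_diff_distrib)
    then show ?thesis by (simp only: w_def)
  qed
  also have "\<dots> = 1 + real n * (real n - 2) * (c\<^sup>2 / R\<^sup>2)"
    using R by (simp add: field_simps power2_eq_square)
  also have "\<dots> \<le> 1 + real n * (real n - 2) * 1"
  proof -
    have "c\<^sup>2 / R\<^sup>2 \<le> 1" using c R by (simp add: divide_le_eq_1 power_mono)
    then show ?thesis using n by (intro add_left_mono mult_left_mono) auto
  qed
  also have "\<dots> = (real n - 1)\<^sup>2" by (simp add: power2_eq_square algebra_simps)
  finally have "norm w \<le> real n - 1" by (rule power2_le_imp_le) (use n in auto)
  then have "norm (pker_grad n v) \<le> (real n - 1) / R ^ n"
    using R by (simp add: g divide_right_mono)
  also have "\<dots> \<le> (real n - 1) / c ^ n"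
    using c n by (intro divide_left_mono power_mono mult_pos_pos) auto
  finally show ?thesis by (simp add: c_def)
qed

lemma norm_poisson_grad_le_L1:
  fixes f :: "real ^ 'm::finite \<Rightarrow> real"
  assumes dim: "CARD('m) \<ge> 2" and n: "n = CARD('m) + 1" and f: "f \<in> Lp_space 1" and x: "x \<in> half_space"
  shows "norm (poisson_grad f x) \<le> 2 * (real n - 1) / sphere_area n / snd x ^ n * Lp_norm 1 f"
proof (rule norm_le_of_downward)
  fix z :: "(real ^ 'm) \<times> real"
  have fi: "integrable lebesgue (\<lambda>y. \<bar>f y\<bar>)" and fm: "f \<in> borel_measurable lebesgue"
    using f by (simp_all add: Lp_space_def)
  have adm: "poisson_admissible f" by (rule Lp_space_poisson_admissible[OF dim _ f]) simp
  have c: "snd x > 0" using x by (simp add: half_space_def)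
  have w0: "sphere_area n > 0" by (rule sphere_area_pos) (simp add: n)
  have N: "Lp_norm 1 f = (LINT y|lebesgue. \<bar>f y\<bar>)" by (simp add: Lp_norm_def)
  have b: "\<bar>f y * (z \<bullet> pker_grad n (x - (y, 0)))\<bar> \<le> (real n - 1) / snd x ^ n * norm z * \<bar>f y\<bar>" for y
  proof -
    have "\<bar>z \<bullet> pker_grad n (x - (y, 0))\<bar> \<le> norm z * ((real n - 1) / snd x ^ n)"
      using norm_pker_grad_le[of "x - (y, 0)" n] c n dim
      by (intro order_trans[OF Cauchy_Schwarz_ineq2] mult_left_mono) auto
    from mult_left_mono[OF this, of "\<bar>f y\<bar>"] show ?thesis by (simp add: abs_mult mult_ac)
  qed
  have "\<bar>z \<bullet> poisson_grad f x\<bar> = 2 / sphere_area n * \<bar>LINT y|lebesgue. f y * (z \<bullet> pker_grad n (x - (y, 0)))\<bar>"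
    unfolding inner_poisson_grad[OF adm x] n using w0 by (simp add: abs_mult n)
  also have "\<dots> \<le> 2 / sphere_area n * (LINT y|lebesgue. (real n - 1) / snd x ^ n * norm z * \<bar>f y\<bar>)"
  proof (rule mult_left_mono)
    have i: "integrable lebesgue (\<lambda>y. (real n - 1) / snd x ^ n * norm z * \<bar>f y\<bar>)" using fi by simp
    have m: "(\<lambda>y. f y * (z \<bullet> pker_grad n (x - (y, 0)))) \<in> borel_measurable lebesgue"
      by (intro borel_measurable_times fm inner_pker_grad_measurable[OF x])
    have "integrable lebesgue (\<lambda>y. f y * (z \<bullet> pker_grad n (x - (y, 0))))"
      by (rule integrable_norm_le[OF i m]) (use b in simp)
    then show "\<bar>LINT y|lebesgue. f y * (z \<bullet> pker_grad n (x - (y, 0)))\<bar> \<le> (LINT y|lebesgue. (real n - 1) / snd x ^ n * norm z * \<bar>f y\<bar>)"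
      by (intro order_trans[OF integral_abs_bound] integral_mono[OF integrable_abs i] b)
  qed (use w0 in simp)
  also have "\<dots> = 2 * (real n - 1) / sphere_area n / snd x ^ n * Lp_norm 1 f * norm z"
    unfolding N by simp
  finally show "\<bar>z \<bullet> poisson_grad f x\<bar> \<le> 2 * (real n - 1) / sphere_area n / snd x ^ n * Lp_norm 1 f * norm z" .
qed

text \<open>For \<open>p = 1\<close> the boundary values concentrate at \<open>(x', 0)\<close>, where the kernel of the normal derivative
  is largest.\<close>

lemma hardy_bound_ge_L1:
  fixes x :: "(real ^ 'm::finite) \<times> real" and T :: "((real ^ 'm) \<times> real \<Rightarrow> real) \<Rightarrow> real"
  assumes C: "hardy_bound 1 T C" and dim: "CARD('m) \<ge> 2" and n: "n = CARD('m) + 1" and x: "x \<in> half_space"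
    and Tz: "\<And>f. f \<in> Lp_space 1 \<Longrightarrow> (0, -1) \<bullet> poisson_grad f x \<le> T (poisson_integral f)"
  shows "2 * (real n - 1) / sphere_area n / snd x ^ n \<le> C"
proof (rule field_le_epsilon)
  fix \<epsilon> :: real assume eps: "\<epsilon> > 0"
  define k where "k y = (0, -1) \<bullet> pker_grad n (x - (y, 0))" for y
  have c: "snd x > 0" using x by (simp add: half_space_def)
  have w0: "sphere_area n > 0" by (rule sphere_area_pos) (simp add: n)
  have k0: "k (fst x) = (real n - 1) / snd x ^ n"
  proof -
    have "x - (fst x, 0) = (0, snd x)" by (simp add: prod_eq_iff)
    then have "k (fst x) = - (1 / snd x ^ n - real n * snd x / (snd x ^ n * (snd x)\<^sup>2) * snd x)"
      using c by (simp add: k_def pker_grad_def norm_Pair power_add power2_eq_square)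
    then show ?thesis using c by (simp add: field_simps power2_eq_square)
  qed
  have km: "k \<in> borel_measurable lebesgue" unfolding k_def[abs_def] by (rule inner_pker_grad_measurable[OF x])
  have kb: "\<bar>k y\<bar> \<le> (real n - 1) / snd x ^ n" for y
  proof -
    have "\<bar>k y\<bar> \<le> norm (pker_grad n (x - (y, 0)))"
      using Cauchy_Schwarz_ineq2[of "(0, -1)" "pker_grad n (x - (y, 0))"] by (simp add: k_def norm_Pair)
    also have "\<dots> \<le> (real n - 1) / snd x ^ n"
      using norm_pker_grad_le[of "x - (y, 0)" n] c n dim by simp
    finally show ?thesis .
  qed
  have "continuous_on UNIV (\<lambda>y. pker_grad n (x - (y, 0)))"
    by (rule continuous_on_compose2[OF continuous_pker_grad])
      (use c in \<open>auto intro!: continuous_intros simp: prod_eq_iff\<close>)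
  then have "isCont k (fst x)"
    unfolding k_def[abs_def] by (intro continuous_intros) (simp add: continuous_on_eq_continuous_at)
  \<comment> \<open>The tolerance is scaled by half the sphere area to offset the factor 2 /
    \<open>sphere_area n\<close> of the Poisson integral.\<close>
  then obtain r where r: "r > 0" "\<And>y. dist y (fst x) < r \<Longrightarrow> dist (k y) (k (fst x)) < \<epsilon> * sphere_area n / 2"
    using eps w0 unfolding continuous_at_eps_delta by (metis divide_pos_pos mult_pos_pos zero_less_numeral)
  define B where "B = ball (fst x) r"
  define m where "m = measure lebesgue B"
  have B: "indicat_real B \<in> Lp_space 1" "Lp_norm 1 (indicat_real B) = m" "m > 0"
    using indicator_ball_Lp[OF r(1), of 1 "fst x"] by (auto simp: B_def m_def)
  have iB: "integrable lebesgue (indicat_real B)"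
    using B(1) by (simp add: Lp_space_def)
  have mB: "(LINT y|lebesgue. indicat_real B y) = m" by (simp add: m_def)
  have int: "integrable lebesgue (\<lambda>y. indicat_real B y * k y)"
  proof (rule integrable_norm_le)
    show "integrable lebesgue (\<lambda>y. (real n - 1) / snd x ^ n * indicat_real B y)" using iB by simp
    show "(\<lambda>y. indicat_real B y * k y) \<in> borel_measurable lebesgue"
      using iB by (intro borel_measurable_times km) (rule borel_measurable_integrable)
    show "norm (indicat_real B y * k y) \<le> (real n - 1) / snd x ^ n * indicat_real B y" for y
      using kb[of y] by (simp add: indicator_def)
  qed
  have "(k (fst x) - \<epsilon> * sphere_area n / 2) * m = (LINT y|lebesgue. (k (fst x) - \<epsilon> * sphere_area n / 2) * indicat_real B y)"
    using mB by simp
  also have "\<dots> \<le> (LINT y|lebesgue. indicat_real B y * k y)"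
  proof (rule integral_mono[OF _ int])
    show "integrable lebesgue (\<lambda>y. (k (fst x) - \<epsilon> * sphere_area n / 2) * indicat_real B y)" using iB by simp
    show "(k (fst x) - \<epsilon> * sphere_area n / 2) * indicat_real B y \<le> indicat_real B y * k y" for y
    proof (cases "y \<in> B")
      case True
      then have "dist y (fst x) < r" by (simp add: B_def dist_commute)
      from r(2)[OF this] have "k (fst x) - \<epsilon> * sphere_area n / 2 \<le> k y"
        unfolding dist_real_def by linarith
      then show ?thesis using True by simp
    qed simp
  qed
  also have "\<dots> = sphere_area n / 2 * ((0, -1) \<bullet> poisson_grad (indicat_real B) x)"
    unfolding inner_poisson_grad[OF Lp_space_poisson_admissible[OF dim order_refl B(1)] x]
    using w0 by (simp add: k_def n)
  also have "\<dots> \<le> sphere_area n / 2 * (C * m)"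
    using Tz[OF B(1)] hardy_boundD[OF C dim order_refl B(1)] w0 by (intro mult_left_mono) (auto simp: B(2))
  finally have "k (fst x) - \<epsilon> * sphere_area n / 2 \<le> sphere_area n / 2 * C"
    using B(3) by (simp add: mult.assoc[symmetric])
  then show "2 * (real n - 1) / sphere_area n / snd x ^ n \<le> C + \<epsilon>"
    using w0 c unfolding k0 by (simp add: field_simps)
qed

theorem proposition1:
  fixes n :: nat and p :: real and x :: "(real ^ 'm::finite) \<times> real"
  assumes "n = CARD('m) + 1" and "n \<ge> 3"
    and "1 \<le> p"
    and "x \<in> half_space"
  shows "sharp_coefficient p (\<lambda>u. norm (grad u x))
           (grad_const n p * snd x powr ((1 - real n - p) / p)) \<and>
         grad_const n 2 = sqrt (real n * (real n - 1) / (2 ^ n * sphere_area n)) \<and>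
         (p = 1 \<or> p = 2 \<longrightarrow>
           sharp_coefficient p (\<lambda>u. \<bar>normal_deriv u x\<bar>)
             (grad_const n p * snd x powr ((1 - real n - p) / p)))"
proof -
  note n = assms(1) and p = assms(3) and x = assms(4)
  let ?C = "grad_const n p * snd x powr ((1 - real n - p) / p)"
  have dim: "CARD('m) \<ge> 2" using assms(1,2) by simp
  have c: "snd x > 0" using x by (simp add: half_space_def)
  \<comment> \<open>For p = 1 the exponent (1-n-p)/p is -n.\<close>
  have C1: "?C = 2 * (real n - 1) / sphere_area n / snd x ^ n" if "p = 1"
  proof -
    have "snd x powr ((1 - real n - p) / p) = inverse (snd x powr real n)"
      using that by (simp add: powr_minus)
    also have "\<dots> = inverse (snd x ^ n)" using c by (simp add: powr_realpow)
    finally show ?thesis using that by (simp add: grad_const_def divide_inverse)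
  qed
  have poisson_le: "norm (poisson_grad f x) \<le> ?C * Lp_norm p f" if "f \<in> Lp_space p" for f
  proof (cases "p = 1")
    case True
    then show ?thesis using norm_poisson_grad_le_L1[OF dim n _ x, of f] that unfolding C1[OF True] by simp
  next
    case False
    then show ?thesis using norm_poisson_grad_le[OF dim n _ that x] p by simp
  qed
  have normal_le: "\<bar>(0, s) \<bullet> poisson_grad f x\<bar> \<le> norm (poisson_grad f x)" if "\<bar>s\<bar> = 1" for f s
    using Cauchy_Schwarz_ineq2[of "(0, s)" "poisson_grad f x"] that by (simp add: norm_Pair)
  have upper_grad: "hardy_bound p (\<lambda>u :: (real ^ 'm) \<times> real \<Rightarrow> real. norm (grad u x)) ?C"
    unfolding hardy_bound_def
  proof (intro ballI allI impI)
    fix u :: "(real ^ 'm) \<times> real \<Rightarrow> real" and f assume "boundary_values p u f"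
    then show "norm (grad u x) \<le> ?C * Lp_norm p f"
      using boundary_values_gradient(1)[OF dim p _ x, of u f] poisson_le[of f] by (simp add: boundary_values_def)
  qed
  have upper_normal: "hardy_bound p (\<lambda>u :: (real ^ 'm) \<times> real \<Rightarrow> real. \<bar>normal_deriv u x\<bar>) ?C"
    unfolding hardy_bound_def
  proof (intro ballI allI impI)
    fix u :: "(real ^ 'm) \<times> real \<Rightarrow> real" and f assume u: "boundary_values p u f"
    have "\<bar>normal_deriv u x\<bar> \<le> norm (poisson_grad f x)"
      unfolding boundary_values_gradient(2)[OF dim p u x] by (rule normal_le) simp
    then show "\<bar>normal_deriv u x\<bar> \<le> ?C * Lp_norm p f"
      using poisson_le[of f] u by (simp add: boundary_values_def)
  qed
  have grad_ge: "z \<bullet> poisson_grad f x \<le> norm (grad (poisson_integral f) x)" if "f \<in> Lp_space p" "norm z = 1" for z f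
    unfolding boundary_values_gradient(1)[OF dim p Lp_space_hardy_space(2)[OF dim p that(1)] x]
    using norm_cauchy_schwarz[of z "poisson_grad f x"] that(2) by simp
  \<comment> \<open>The downward normal is tested because its kernel is positive at the foot of the
    perpendicular; the absolute value absorbs the sign.\<close>
  have normal_ge: "(0, -1) \<bullet> poisson_grad f x \<le> \<bar>normal_deriv (poisson_integral f) x\<bar>" if "f \<in> Lp_space p" for f
    unfolding boundary_values_gradient(2)[OF dim p Lp_space_hardy_space(2)[OF dim p that] x]
    by (cases "poisson_grad f x") simp
  \<comment> \<open>One axis suffices for the lower bounds, since the kernel norm is the same for
    all of them.\<close>
  obtain e :: "real ^ 'm" where "e \<in> Basis" using nonempty_Basis by blast
  then have e: "norm e = 1" by simp
  have lower_grad: "?C \<le> C'" if C': "hardy_bound p (\<lambda>u :: (real ^ 'm) \<times> real \<Rightarrow> real. norm (grad u x)) C'" for C'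
  proof (cases "p = 1")
    case True
    show ?thesis unfolding C1[OF True]
      using C' grad_ge unfolding True by (intro hardy_bound_ge_L1[OF _ dim n x]) (auto simp: norm_Pair)
  next
    case False
    then have p1: "p > 1" using p by simp
    define K where "K = 2 * sphere_area (n - 2) powr ((p - 1) / p) / sphere_area n * snd x powr ((1 - real n - p) / p)"
    have K: "K > 0" using c sphere_area_pos[of n] sphere_area_pos[of "n - 2"] assms(2) by (simp add: K_def)
    have "direction_norm n p \<gamma> * K \<le> C'" for \<gamma>
      using hardy_bound_ge_direction_norm[OF C' dim n p1 x e _ grad_ge, of \<gamma>] norm_unit_dir[OF e]
      unfolding K_def by (simp add: mult_ac)
    then have "direction_norm n p \<gamma> \<le> C' / K" for \<gamma>
      using K by (simp add: pos_le_divide_eq)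
    \<comment> \<open>The lower bounds hold for each \<gamma> separately; dividing by the positive
      \<open>K\<close> turns them into one upper bound for the supremum.\<close>
    then have "(SUP \<gamma>\<in>{0..}. direction_norm n p \<gamma>) \<le> C' / K" by (intro cSUP_least) auto
    then have "(SUP \<gamma>\<in>{0..}. direction_norm n p \<gamma>) * K \<le> C'"
      using K by (simp add: pos_le_divide_eq)
    then show ?thesis unfolding grad_const_eq_Sup[OF False] K_def by (simp add: mult_ac)
  qed
  have lower_normal: "?C \<le> C'" if C': "hardy_bound p (\<lambda>u :: (real ^ 'm) \<times> real \<Rightarrow> real. \<bar>normal_deriv u x\<bar>) C'" and p12: "p = 1 \<or> p = 2" for C'
  proof (cases "p = 1")
    case True
    show ?thesis unfolding C1[OF True]
      using C' normal_ge unfolding True by (intro hardy_bound_ge_L1[OF _ dim n x]) auto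
  next
    case False
    then have p2: "p = 2" using p12 by simp
    then have p1: "p > 1" by simp
    have u0: "unit_dir 0 e = (0, -1)" by (simp add: unit_dir_def)
    \<comment> \<open>For p = 2 the supremum is attained at \<gamma> = 0, so the normal direction
      alone already forces the full constant.\<close>
    have "grad_const n p = 2 * sphere_area (n - 2) powr ((p - 1) / p) / sphere_area n * direction_norm n p 0"
      unfolding p2 using grad_const_two(2)[OF assms(2)] by (simp add: direction_norm_def)
    then show ?thesis
      using hardy_bound_ge_direction_norm[OF C' dim n p1 x e, of 0] normal_ge by (simp add: u0)
  qed
  show ?thesis
    unfolding sharp_coefficient_def
    using upper_grad upper_normal lower_grad lower_normal grad_const_two(1)[OF assms(2)] by blast
qed

end
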